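(* Let $d\ge 1$, let $\Omega=\mathbb{T}^d$ or $\Omega=\mathbb{R}^d$, and let $W:\Omega\times\Omega\to(-\infty,+\infty]$ be a symmetric interaction potential satisfying the structural assumptions (H), (1), (2), (3) listed in the context. Let $\bar\rho\in\mathcal{P}(\Omega)$ have an essentially bounded Lebesgue density (and be such that $W$ is integrable against $\bar\rho$ in the sense stated in the context), and let $\beta>0$. Then there exists a constant $C<\infty$, depending (for given $\Omega$ and $W$) only on $\beta$ and $\left\lVert \frac{d\bar\rho}{dx}\right\rVert_{L^\infty(\Omega)}$, such that for every $N\in\mathbb{N}$ and every $\rho^N\in\mathcal{P}(\Omega^N)$, $$-\frac{\beta}{N}\int_{\Omega^N}\mathring{I}_W[\eta^N_x]\,d\rho^N(x)\le \frac12\,\overline{\mathcal{H}}(\rho^N|\bar\rho^{\otimes N})+\frac{C}{N}.$$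
   Context: Notation. $\mathcal{P}(\Omega)$ is the set of Borel probability measures on $\Omega$; $\mathbb{T}^d=\mathbb{R}^d/\mathbb{Z}^d$. $\overline{\mathcal{H}}(\mu|\nu)=\frac1N\mathcal{H}(\mu|\nu)$ is the dimension-averaged relative entropy of $\mu,\nu\in\mathcal{P}(\Omega^N)$, where $\mathcal{H}(\mu|\nu)=\int\log\frac{d\mu}{d\nu}\,d\mu$ if $\mu\ll\nu$ and $+\infty$ otherwise. For $x=(x_1,\dots,x_N)\in\Omega^N$, $$\eta^N_x:=N^{-1/2}\sum_{i=1}^N(\delta_{x_i}-\bar\rho),\qquad \mathring{I}_W[\eta]:=\frac12\int_{\Omega^2\setminus\Delta}W(x,y)\,d\eta(x)\,d\eta(y),\qquad \Delta=\{(x,y)\in\Omega^2:x=y\}.$$ The integrability of $W$ against $\bar\rho$ means: $\int_\Omega|W(x,y)|\,d\bar\rho(y)<\infty$ for all $x\in\Omega$ and $\int_{\Omega^2}|W|\,d\bar\rho\,d\bar\rho<\infty$, so that $\mathring{I}_W[\eta^N_x]$ is well defined. $P_\varepsilon$ denotes the heat semigroup on $\Omega^2$ (generator the Laplacian on $\Omega^2$), and $P^{1/2}_\varepsilon$ the $1/2$-fractional heat semigroup on $\Omega^2$ (generator $-(-\Delta)^{1/2}$). Assumptions on $W$ ($W(x,y)=W(y,x)$): (H) $W\in L^1_{\rm loc}(\Omega^2)$ is lower semicontinuous and repulsive (H-stable): for all $\varepsilon>0$, $\int_{\Omega^2}(P_\varepsilon W)(x,y)\,d\eta(x)\,d\eta(y)\ge0$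 for all finite signed measures $\eta$ on $\Omega$ with $\eta(\Omega)=0$ (for which the integral is well defined). (1) There is $C_0<\infty$ such that for all $x\in\Omega$ and $\varepsilon\in(0,1)$: $|(P_\varepsilon W)(x,x)|\le C_0(|\ln\varepsilon|+1)$. (2) For every probability measure $\bar\rho$ on $\Omega$ with essentially bounded density and every $p\in[1,\infty)$ there exist $\kappa>0$ and $C=C\big(p,\lVert\frac{d\bar\rho}{dx}\rVert_{L^\infty(\Omega)}\big)<\infty$ such that for all $\varepsilon>0$: $\sup_{x\in\Omega}\lVert((P_\varepsilon-\mathrm{id})W)(x,\cdot)\rVert^p_{L^p(\Omega;\bar\rho)}<C\varepsilon^\kappa$. (3) There are $\alpha,\varepsilon_0>0$ and $K<\infty$ such that $W(x,y)-(P_\varepsilon W)(x,y)\ge-K\varepsilon^\alpha$ for all $(x,y)\in\Omega^2$ and $0<\varepsilon<\varepsilon_0$. For $d=1$, $P_\varepsilon$ is replaced by $P^{1/2}_\varepsilon$ in (1), (2), (3). *)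

theory Defs
  imports "HOL-Probability.Probability"
begin

section \<open>The torus\<close>

definition lattice_rel :: "real ^ 'd \<Rightarrow> real ^ 'd \<Rightarrow> bool" where
  "lattice_rel x y \<longleftrightarrow> (\<forall>i. x $ i - y $ i \<in> \<int>)"

lemma equivp_lattice_rel: "equivp lattice_rel"
proof (rule equivpI)
  show "reflp lattice_rel"
    by (simp add: reflp_def lattice_rel_def)
  show "symp lattice_rel"
    by (rule sympI) (metis Ints_minus minus_diff_eq lattice_rel_def)
  show "transp lattice_rel"
  proof (rule transpI)
    fix x y z :: "real ^ 'd"
    assume "lattice_rel x y" "lattice_rel y z"
    then have "(x $ i - y $ i) + (y $ i - z $ i) \<in> \<int>" for i
      unfolding lattice_rel_def by (blast intro: Ints_add)
    then show "lattice_rel x z"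
      by (simp add: lattice_rel_def)
  qed
qed

quotient_type (overloaded) 'd torus = "real ^ ('d::finite)" / lattice_rel
  morphisms rep_torus proj_torus
  by (rule equivp_lattice_rel)

lemma proj_torus_eq_iff: "proj_torus x = proj_torus y \<longleftrightarrow> lattice_rel x y"
  by (simp add: torus.abs_eq_iff)

lemma proj_rep_torus [simp]: "proj_torus (rep_torus p) = p"
  by (rule Quotient_abs_rep[OF Quotient_torus])

instantiation torus :: (finite) topological_space
begin

definition open_torus :: "'a torus set \<Rightarrow> bool" where
  "open_torus U \<longleftrightarrow> open (proj_torus -` U)"

instance
  by standard (auto simp: open_torus_def vimage_Union open_Int)

end

lemma continuous_proj_torus: "continuous_on UNIV (proj_torus :: real ^ 'd \<Rightarrow> 'd torus)"
  by (simp add: continuous_on_open_vimage open_torus_def)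

lemma open_proj_torus_image:
  fixes U :: "(real ^ 'd) set"
  assumes "open U"
  shows "open (proj_torus ` U)"
proof -
  have "proj_torus -` proj_torus ` U =
      (\<Union>k\<in>{k :: real ^ 'd. \<forall>i. k $ i \<in> \<int>}. (+) k ` U)" (is "?L = ?R")
  proof
    show "?L \<subseteq> ?R"
    proof
      fix x assume "x \<in> ?L"
      then obtain u where u: "u \<in> U" "lattice_rel x u"
        by (auto simp: proj_torus_eq_iff)
      then have "x = (x - u) + u" "\<forall>i. (x - u) $ i \<in> \<int>"
        by (simp_all add: lattice_rel_def)
      with u(1) show "x \<in> ?R"
        by blast
    qed
    show "?R \<subseteq> ?L"
    proof
      fix x assume "x \<in> ?R"
      then obtain k u where ku: "x = k + u" "\<forall>i. k $ i \<in> \<int>" "u \<in> U"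
        by blast
      then have "proj_torus x = proj_torus u"
        by (simp add: proj_torus_eq_iff lattice_rel_def)
      with ku(3) show "x \<in> ?L"
        by simp
    qed
  qed
  moreover have "open ?R"
    by (intro open_UN ballI open_translation assms)
  ultimately show ?thesis
    by (simp add: open_torus_def)
qed

instance torus :: (finite) second_countable_topology
proof
  obtain B :: "(real ^ 'a) set set" where B: "countable B" "topological_basis B"
    using ex_countable_basis by blast
  have "topological_basis ((`) proj_torus ` B)"
  proof (rule topological_basisI)
    fix V assume "V \<in> (`) proj_torus ` B"
    then obtain b where "b \<in> B" "V = proj_torus ` b"
      by blast
    then show "open V"
      using open_proj_torus_image[OF topological_basis_open[OF B(2)]] by simp
  next
    fix V :: "'a torus set" and p
    assume V: "open V" and p: "p \<in> V"
    have "open (proj_torus -` V)"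
      using V by (simp add: open_torus_def)
    moreover have "rep_torus p \<in> proj_torus -` V"
      using p by simp
    ultimately obtain b where b: "b \<in> B" "rep_torus p \<in> b" "b \<subseteq> proj_torus -` V"
      by (rule topological_basisE[OF B(2)])
    have "p \<in> proj_torus ` b"
      using b(2) by (rule image_eqI[rotated]) simp
    moreover have "proj_torus ` b \<subseteq> V"
      using b(3) by (simp add: image_subset_iff_subset_vimage)
    ultimately show "\<exists>V'\<in>(`) proj_torus ` B. p \<in> V' \<and> V' \<subseteq> V"
      using b(1) by (intro bexI[of _ "proj_torus ` b"] conjI imageI)
  qed
  then have "open = generate_topology ((`) proj_torus ` B)"
    by (rule topological_basis_imp_subbasis)
  moreover have "countable ((`) proj_torus ` B)"
    using B(1) by (rule countable_image)
  ultimately show "\<exists>S :: 'a torus set set. countable S \<and> open = generate_topology S"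
    by (intro exI conjI)
qed

instance torus :: (finite) t2_space
proof
  fix p q :: "'a torus"
  assume "p \<noteq> q"
  then have "\<not> lattice_rel (rep_torus p) (rep_torus q)"
    by (metis proj_rep_torus proj_torus_eq_iff)
  then obtain i where i: "rep_torus p $ i - rep_torus q $ i \<notin> \<int>"
    by (auto simp: lattice_rel_def)
  define g :: "'a torus \<Rightarrow> complex" where "g = (\<lambda>r. cis (2 * pi * rep_torus r $ i))"
  have cis_eq: "cis (2 * pi * a) = cis (2 * pi * b) \<longleftrightarrow> a - b \<in> \<int>" for a b
  proof -
    have "cis (2 * pi * a) / cis (2 * pi * b) = exp (\<i> * complex_of_real (2 * pi * (a - b)))"
      unfolding cis_divide unfolding cis_conv_exp right_diff_distrib ..
    then have "cis (2 * pi * a) = cis (2 * pi * b) \<longleftrightarrow>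
        exp (\<i> * complex_of_real (2 * pi * (a - b))) = 1"
      by (metis cis_neq_zero divide_eq_1_iff)
    also have "\<dots> \<longleftrightarrow> (\<exists>n::int. 2 * pi * (a - b) = of_int (2 * n) * pi)"
      by (simp only: exp_eq_1 Re_i_times Im_i_times Im_complex_of_real Re_complex_of_real) simp
    also have "\<dots> \<longleftrightarrow> (\<exists>n::int. a - b = of_int n)"
      by (intro ex_cong1) simp
    also have "\<dots> \<longleftrightarrow> a - b \<in> \<int>"
      by (metis Ints_cases Ints_of_int)
    finally show ?thesis .
  qed
  have g_proj: "g (proj_torus x) = cis (2 * pi * x $ i)" for x
  proof -
    have "lattice_rel (rep_torus (proj_torus x)) x"
      by (simp only: proj_torus_eq_iff[symmetric] proj_rep_torus)
    then show ?thesis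
      unfolding g_def cis_eq lattice_rel_def by (rule spec)
  qed
  have "g p \<noteq> g q"
    using i unfolding g_def cis_eq .
  then obtain U V where UV: "open U" "open V" "g p \<in> U" "g q \<in> V" "U \<inter> V = {}"
    using hausdorff[of "g p" "g q"] by auto
  have g_open: "open (g -` S)" if "open S" for S
  proof -
    have "continuous_on UNIV (\<lambda>x :: real ^ 'a. cis (2 * pi * x $ i))"
      unfolding cis_conv_exp by (intro continuous_intros)
    then have "open ((\<lambda>x :: real ^ 'a. cis (2 * pi * x $ i)) -` S)"
      using that by (rule open_vimage[rotated])
    then show ?thesis
      by (simp add: open_torus_def vimage_def g_proj)
  qed
  have "open (g -` U) \<and> open (g -` V) \<and> p \<in> g -` U \<and> q \<in> g -` V \<and> g -` U \<inter> g -` V = {}"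
    using UV g_open by (simp add: vimage_Int[symmetric])
  then show "\<exists>U V. open U \<and> open V \<and> p \<in> U \<and> q \<in> V \<and> U \<inter> V = {}"
    by (intro exI)
qed

definition torus_lebesgue :: "('d::finite) torus measure" where
  "torus_lebesgue =
     distr (restrict_space lborel {x :: real ^ 'd. \<forall>i. 0 \<le> x $ i \<and> x $ i < 1}) borel proj_torus"


section \<open>Integrals of extended real functions\<close>

text \<open>Both parts of the integrand are integrated separately.  If both are infinite, the value is
  \<open>\<infinity> - \<infinity> = \<infinity>\<close>, so a finite value always means absolute integrability.\<close>

definition eintegral :: "'a measure \<Rightarrow> ('a \<Rightarrow> ereal) \<Rightarrow> ereal" where
  "eintegral M f =
     enn2ereal (\<integral>\<^sup>+ x. e2ennreal (f x) \<partial>M) - enn2ereal (\<integral>\<^sup>+ x. e2ennreal (- f x) \<partial>M)"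

definition eabs_integrable :: "'a measure \<Rightarrow> ('a \<Rightarrow> ereal) \<Rightarrow> bool" where
  "eabs_integrable M f \<longleftrightarrow> (\<integral>\<^sup>+ x. e2ennreal \<bar>f x\<bar> \<partial>M) < \<infinity>"

definition abs_powr :: "ereal \<Rightarrow> real \<Rightarrow> ennreal" where
  "abs_powr a p = (if \<bar>a\<bar> = \<infinity> then \<infinity> else ennreal (\<bar>real_of_ereal a\<bar> powr p))"


section \<open>Heat and fractional heat semigroups\<close>

definition heat_kernel :: "real \<Rightarrow> 'b::euclidean_space \<Rightarrow> real" where
  "heat_kernel \<epsilon> z =
     exp (- (norm z)\<^sup>2 / (4 * \<epsilon>)) / (4 * pi * \<epsilon>) powr (real DIM('b) / 2)"

text \<open>The convolution kernel of the semigroup generated by \<open>-(-\<Delta>)\<^sup>1\<^sup>/\<^sup>2\<close> on a Euclidean space is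
  the Poisson kernel of the upper half-space, \<open>\<epsilon>\<close> being the height.\<close>

definition half_heat_kernel :: "real \<Rightarrow> 'b::euclidean_space \<Rightarrow> real" where
  "half_heat_kernel \<epsilon> z =
     Gamma ((real DIM('b) + 1) / 2) / pi powr ((real DIM('b) + 1) / 2)
       * (\<epsilon> / (\<epsilon>\<^sup>2 + (norm z)\<^sup>2) powr ((real DIM('b) + 1) / 2))"

definition convolve :: "('b::euclidean_space \<Rightarrow> real) \<Rightarrow> ('b \<Rightarrow> ereal) \<Rightarrow> 'b \<Rightarrow> ereal" where
  "convolve k f z = eintegral lborel (\<lambda>w. ereal (k (z - w)) * f w)"

definition heat_Rd ::
  "real \<Rightarrow> ((real ^ 'd) \<times> (real ^ 'd) \<Rightarrow> ereal) \<Rightarrow> (real ^ 'd) \<times> (real ^ 'd) \<Rightarrow> ereal" where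
  "heat_Rd \<epsilon> W = convolve (heat_kernel \<epsilon>) W"

definition half_heat_Rd ::
  "real \<Rightarrow> ((real ^ 'd) \<times> (real ^ 'd) \<Rightarrow> ereal) \<Rightarrow> (real ^ 'd) \<times> (real ^ 'd) \<Rightarrow> ereal" where
  "half_heat_Rd \<epsilon> W = convolve (half_heat_kernel \<epsilon>) W"

text \<open>On the torus the semigroups act through periodic lifts; the lift of the result is periodic
  again, so the representatives chosen by \<^const>\<open>rep_torus\<close> play no role.\<close>

definition lift_torus ::
  "(('d::finite) torus \<times> 'd torus \<Rightarrow> ereal) \<Rightarrow> (real ^ 'd) \<times> (real ^ 'd) \<Rightarrow> ereal" where
  "lift_torus W = W \<circ> map_prod proj_torus proj_torus"

definition heat_Td ::
  "real \<Rightarrow> (('d::finite) torus \<times> 'd torus \<Rightarrow> ereal) \<Rightarrow> 'd torus \<times> 'd torus \<Rightarrow> ereal" where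
  "heat_Td \<epsilon> W z = heat_Rd \<epsilon> (lift_torus W) (map_prod rep_torus rep_torus z)"

definition half_heat_Td ::
  "real \<Rightarrow> (('d::finite) torus \<times> 'd torus \<Rightarrow> ereal) \<Rightarrow> 'd torus \<times> 'd torus \<Rightarrow> ereal" where
  "half_heat_Td \<epsilon> W z = half_heat_Rd \<epsilon> (lift_torus W) (map_prod rep_torus rep_torus z)"

definition smoothing_Rd ::
  "real \<Rightarrow> ((real ^ 'd) \<times> (real ^ 'd) \<Rightarrow> ereal) \<Rightarrow> (real ^ 'd) \<times> (real ^ 'd) \<Rightarrow> ereal" where
  "smoothing_Rd = (if CARD('d) = 1 then half_heat_Rd else heat_Rd)"

definition smoothing_Td ::
  "real \<Rightarrow> (('d::finite) torus \<times> 'd torus \<Rightarrow> ereal) \<Rightarrow> 'd torus \<times> 'd torus \<Rightarrow> ereal" where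
  "smoothing_Td = (if CARD('d) = 1 then half_heat_Td else heat_Td)"


section \<open>Measures\<close>

definition borel_probability :: "('a::topological_space) measure \<Rightarrow> bool" where
  "borel_probability \<rho> \<longleftrightarrow> prob_space \<rho> \<and> sets \<rho> = sets borel"

definition density_norm :: "'a measure \<Rightarrow> 'a measure \<Rightarrow> ennreal" where
  "density_norm L \<rho> = esssup L (RN_deriv L \<rho>)"

definition bounded_density :: "'a measure \<Rightarrow> 'a measure \<Rightarrow> bool" where
  "bounded_density L \<rho> \<longleftrightarrow> absolutely_continuous L \<rho> \<and> density_norm L \<rho> < \<infinity>"

definition relative_entropy :: "'a measure \<Rightarrow> 'a measure \<Rightarrow> ereal" where
  "relative_entropy \<mu> \<nu> =
     (if absolutely_continuous \<nu> \<mu>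
      then eintegral \<mu> (\<lambda>x. ereal (ln (enn2real (RN_deriv \<nu> \<mu> x)))) else \<infinity>)"

text \<open>\<open>\<Omega>\<^sup>N\<close> consists of the extensional functions on \<open>{..<N}\<close>.  As \<open>\<Omega>\<close> is second countable, the
  product \<open>\<sigma>\<close>-algebra is the Borel \<open>\<sigma>\<close>-algebra.\<close>

definition borel_probability_pow :: "nat \<Rightarrow> (nat \<Rightarrow> 'a::topological_space) measure \<Rightarrow> bool" where
  "borel_probability_pow N P \<longleftrightarrow>
     prob_space P \<and> sets P = sets (Pi\<^sub>M {..<N} (\<lambda>_. borel :: 'a measure))"

definition tensor_pow :: "nat \<Rightarrow> 'a measure \<Rightarrow> (nat \<Rightarrow> 'a) measure" where
  "tensor_pow N \<rho> = Pi\<^sub>M {..<N} (\<lambda>_. \<rho>)"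

definition avg_relative_entropy ::
  "nat \<Rightarrow> (nat \<Rightarrow> 'a) measure \<Rightarrow> (nat \<Rightarrow> 'a) measure \<Rightarrow> ereal" where
  "avg_relative_entropy N \<mu> \<nu> = ereal (1 / real N) * relative_entropy \<mu> \<nu>"


section \<open>Signed measures and energies\<close>

text \<open>A pair \<open>(\<mu>, \<nu>)\<close> of finite Borel measures represents the finite signed measure \<open>\<mu> - \<nu>\<close>;
  by the Jordan decomposition every finite signed measure arises this way.\<close>

type_synonym 'a signed = "'a measure \<times> 'a measure"

definition finite_signed :: "('a::topological_space) signed \<Rightarrow> bool" where
  "finite_signed \<eta> \<longleftrightarrow>
     finite_measure (fst \<eta>) \<and> sets (fst \<eta>) = sets borel \<and>
     finite_measure (snd \<eta>) \<and> sets (snd \<eta>) = sets borel"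

definition total_mass :: "'a signed \<Rightarrow> real" where
  "total_mass \<eta> = measure (fst \<eta>) (space (fst \<eta>)) - measure (snd \<eta>) (space (snd \<eta>))"

definition signed_double_integral :: "('a \<times> 'a \<Rightarrow> ereal) \<Rightarrow> 'a signed \<Rightarrow> ereal" where
  "signed_double_integral V \<eta> =
     (case \<eta> of (\<mu>, \<nu>) \<Rightarrow>
        (eintegral (\<mu> \<Otimes>\<^sub>M \<mu>) V + eintegral (\<nu> \<Otimes>\<^sub>M \<nu>) V)
          - (eintegral (\<mu> \<Otimes>\<^sub>M \<nu>) V + eintegral (\<nu> \<Otimes>\<^sub>M \<mu>) V))"

definition signed_double_integrable :: "('a \<times> 'a \<Rightarrow> ereal) \<Rightarrow> 'a signed \<Rightarrow> bool" where
  "signed_double_integrable V \<eta> \<longleftrightarrow>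
     (case \<eta> of (\<mu>, \<nu>) \<Rightarrow>
        eabs_integrable (\<mu> \<Otimes>\<^sub>M \<mu>) V \<and> eabs_integrable (\<nu> \<Otimes>\<^sub>M \<nu>) V \<and>
        eabs_integrable (\<mu> \<Otimes>\<^sub>M \<nu>) V \<and> eabs_integrable (\<nu> \<Otimes>\<^sub>M \<mu>) V)"

definition offdiag_energy :: "('a \<times> 'a \<Rightarrow> ereal) \<Rightarrow> 'a signed \<Rightarrow> ereal" where
  "offdiag_energy W \<eta> =
     ereal (1 / 2) * signed_double_integral (\<lambda>(x, y). if x = y then 0 else W (x, y)) \<eta>"

text \<open>The image of counting measure on \<open>{..<N}\<close> under \<open>x\<close> is the sum of the Dirac measures
  at the points \<open>x i\<close>, and \<open>N\<close> copies of \<open>\<rho>\<close> with weight \<open>1 / sqrt N\<close> amount to \<open>sqrt N\<close> times \<open>\<rho>\<close>.\<close>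

definition fluctuation ::
  "nat \<Rightarrow> ('a::topological_space) measure \<Rightarrow> (nat \<Rightarrow> 'a) \<Rightarrow> 'a signed" where
  "fluctuation N \<rho> x =
     (scale_measure (ennreal (1 / sqrt (real N))) (distr (count_space {..<N}) borel x),
      scale_measure (ennreal (sqrt (real N))) \<rho>)"


section \<open>Assumptions on the potential\<close>

text \<open>Below, \<open>L\<close> is the Lebesgue measure of \<open>\<Omega>\<close>, \<open>P\<close> the heat semigroup on \<open>\<Omega>\<^sup>2\<close>, and \<open>S\<close> the
  semigroup of the quantitative conditions (fractional in dimension one).\<close>

definition lower_semicontinuous :: "('b::topological_space \<Rightarrow> ereal) \<Rightarrow> bool" where
  "lower_semicontinuous f \<longleftrightarrow> (\<forall>a. open {z. a < f z})"

definition locally_integrable ::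
  "('b::topological_space) measure \<Rightarrow> ('b \<Rightarrow> ereal) \<Rightarrow> bool" where
  "locally_integrable M f \<longleftrightarrow> (\<forall>K. compact K \<longrightarrow> eabs_integrable (restrict_space M K) f)"

definition H_stable ::
  "(real \<Rightarrow> ('a \<times> 'a \<Rightarrow> ereal) \<Rightarrow> 'a \<times> 'a \<Rightarrow> ereal) \<Rightarrow>
     ('a::topological_space \<times> 'a \<Rightarrow> ereal) \<Rightarrow> bool" where
  "H_stable P W \<longleftrightarrow>
     (\<forall>\<epsilon>>0. \<forall>\<eta>. finite_signed \<eta> \<and> total_mass \<eta> = 0 \<and> signed_double_integrable (P \<epsilon> W) \<eta>
        \<longrightarrow> signed_double_integral (P \<epsilon> W) \<eta> \<ge> 0)"

definition log_diagonal ::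
  "(real \<Rightarrow> ('a \<times> 'a \<Rightarrow> ereal) \<Rightarrow> 'a \<times> 'a \<Rightarrow> ereal) \<Rightarrow> ('a \<times> 'a \<Rightarrow> ereal) \<Rightarrow> bool" where
  "log_diagonal S W \<longleftrightarrow>
     (\<exists>C\<^sub>0 :: real. \<forall>x. \<forall>\<epsilon>. 0 < \<epsilon> \<and> \<epsilon> < 1 \<longrightarrow> \<bar>S \<epsilon> W (x, x)\<bar> \<le> ereal (C\<^sub>0 * (\<bar>ln \<epsilon>\<bar> + 1)))"

definition Lp_approximation ::
  "'a measure \<Rightarrow> (real \<Rightarrow> ('a \<times> 'a \<Rightarrow> ereal) \<Rightarrow> 'a \<times> 'a \<Rightarrow> ereal) \<Rightarrow>
     ('a::topological_space \<times> 'a \<Rightarrow> ereal) \<Rightarrow> bool" where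
  "Lp_approximation L S W \<longleftrightarrow>
     (\<exists>C :: real \<Rightarrow> ennreal \<Rightarrow> real. \<forall>\<rho> p.
        borel_probability \<rho> \<and> bounded_density L \<rho> \<and> 1 \<le> p \<longrightarrow>
        (\<exists>\<kappa>>0. \<forall>\<epsilon>>0.
           (SUP x. \<integral>\<^sup>+ y. abs_powr (S \<epsilon> W (x, y) - W (x, y)) p \<partial>\<rho>)
             < ennreal (C p (density_norm L \<rho>) * \<epsilon> powr \<kappa>)))"

definition almost_superharmonic ::
  "(real \<Rightarrow> ('a \<times> 'a \<Rightarrow> ereal) \<Rightarrow> 'a \<times> 'a \<Rightarrow> ereal) \<Rightarrow> ('a \<times> 'a \<Rightarrow> ereal) \<Rightarrow> bool" where
  "almost_superharmonic S W \<longleftrightarrow>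
     (\<exists>\<alpha>>0. \<exists>\<epsilon>\<^sub>0>0. \<exists>K :: real. \<forall>z. \<forall>\<epsilon>. 0 < \<epsilon> \<and> \<epsilon> < \<epsilon>\<^sub>0 \<longrightarrow>
        W z - S \<epsilon> W z \<ge> ereal (- K * \<epsilon> powr \<alpha>))"

definition structural_assumptions ::
  "'a measure \<Rightarrow> (real \<Rightarrow> ('a \<times> 'a \<Rightarrow> ereal) \<Rightarrow> 'a \<times> 'a \<Rightarrow> ereal) \<Rightarrow>
     (real \<Rightarrow> ('a \<times> 'a \<Rightarrow> ereal) \<Rightarrow> 'a \<times> 'a \<Rightarrow> ereal) \<Rightarrow>
     ('a::topological_space \<times> 'a \<Rightarrow> ereal) \<Rightarrow> bool" where
  "structural_assumptions L P S W \<longleftrightarrow>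
     (\<forall>z. W z \<noteq> -\<infinity>) \<and> (\<forall>x y. W (x, y) = W (y, x)) \<and>
     locally_integrable (L \<Otimes>\<^sub>M L) W \<and> lower_semicontinuous W \<and> H_stable P W \<and>
     log_diagonal S W \<and> Lp_approximation L S W \<and> almost_superharmonic S W"

definition potential_integrable :: "('a \<times> 'a \<Rightarrow> ereal) \<Rightarrow> 'a measure \<Rightarrow> bool" where
  "potential_integrable W \<rho> \<longleftrightarrow>
     (\<forall>x. eabs_integrable \<rho> (\<lambda>y. W (x, y))) \<and> eabs_integrable (\<rho> \<Otimes>\<^sub>M \<rho>) W"

end

theory Submission
  imports Defs "HOL-Real_Asymp.Real_Asymp"
begin

text \<open>
  By the Gibbs variational principle it suffices to bound
  \<open>\<integral> exp (- 2 \<beta> I\<^sub>W[\<eta>]) d\<rho>\<^bsup>\<otimes>N\<^esup>\<close> independently of \<open>N\<close>.  As in Nelson's proof of the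
  stability of \<open>P(\<phi>)\<^sub>2\<close>, one splits \<open>W = P\<^sub>\<epsilon> W + (W - P\<^sub>\<epsilon> W)\<close> at a scale \<open>\<epsilon>\<close> adapted to the size of
  the energy.  Repulsivity and the diagonal bound give \<open>I[\<eta>] \<ge> - C (\<bar>ln \<epsilon>\<bar> + 1)\<close> for the smooth
  part, so at scale \<open>\<epsilon> = exp (- c n)\<close> the event \<open>- 2 \<beta> I\<^sub>W \<ge> n\<close> forces the energy of the rough part to
  be of order one.  The rough part is, up to a small bounded error, a completely degenerate
  U-statistic whose kernel is small in \<open>L\<^sup>2\<close>, uniformly in one variable, and almost nonnegative;
  integrating out one particle at a time shows that its negative has exponential moments of all
  orders \<open>\<lambda>\<close> with \<open>\<lambda> \<epsilon>\<^sup>\<kappa>\<close> small, in particular of order \<open>\<lambda> \<sim> n\<close>.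

  The exponent \<open>\<kappa>\<close> in the approximation hypothesis may depend on \<open>\<rho>\<close>; a convex combination of
  countably many bad densities shows that it can be chosen depending on the norm only.  In
  dimension one, where repulsivity refers to the heat semigroup and the quantitative conditions to the
  Poisson semigroup, positivity is transferred by subordination.
\<close>

section \<open>Exponential moments of degenerate U-statistics\<close>

text \<open>No fixed scale suffices: the diagonal bound on the smooth part diverges as \<epsilon>
  tends to 0, while the rough part has controlled exponential moments only up to an order limited by
  its size. The scale therefore depends on the configuration, through the integer part n of X = - 2
  \<beta> I, where I is the energy. With c = 1 / (2 \<beta> C0), where C0 is the constant of the
  diagonal bound, the smooth part contributes at most n/2 plus a constant to X, so for large n the
  contribution Y of the rough part is at least 1, and n <= X < n + 1 gives X <= 1 - n + 2 n Y. Hence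
  exp X is dominated pointwise by a constant plus the sum over n of exp (1 - n) exp (2 n Y), with Y
  taken at the n-th scale; the integrals of these terms are bounded by a geometric series. The
  factor 1/2 in front of the entropy comes from using the Gibbs principle at 2 \<beta> rather than
  \<beta>.\<close>

lemma exp_le_quadratic:
  fixes x :: real
  assumes "x \<le> 1"
  shows "exp x \<le> 1 + x + x\<^sup>2"
proof (cases "x \<ge> 0")
  case True
  then show ?thesis using exp_bound assms by blast
next
  case False
  \<comment> \<open>For negative x, 1 - x <= exp (- x), while (1 - x) (1 + x + x^2) = 1 - x^3 is at
    least 1. This is what makes the estimate one-sided.\<close>
  have "(1 - x) * exp x \<le> exp (- x) * exp x"
    using exp_ge_add_one_self[of "- x"] by (intro mult_right_mono) auto
  also have "\<dots> = 1" by (simp add: exp_minus)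
  also have "1 \<le> 1 - x ^ 3"
    using False by (simp add: power_le_zero_eq)
  also have "\<dots> = (1 - x) * (1 + x + x\<^sup>2)" by (simp add: algebra_simps power2_eq_square power3_eq_cube)
  finally show ?thesis using False by simp
qed

lemma integrable_mult_of_squares:
  fixes f g :: "'a \<Rightarrow> real"
  assumes [measurable]: "f \<in> borel_measurable M" "g \<in> borel_measurable M"
    and f: "integrable M (\<lambda>x. (f x)\<^sup>2)" and g: "integrable M (\<lambda>x. (g x)\<^sup>2)"
  shows "integrable M (\<lambda>x. f x * g x)"
proof (rule Bochner_Integration.integrable_bound[OF Bochner_Integration.integrable_add[OF f g]])
  show "AE x in M. norm (f x * g x) \<le> norm ((f x)\<^sup>2 + (g x)\<^sup>2)"
  proof (rule AE_I2)
    fix x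
    have "2 * (\<bar>f x\<bar> * \<bar>g x\<bar>) \<le> (f x)\<^sup>2 + (g x)\<^sup>2"
      using sum_squares_bound[of "\<bar>f x\<bar>" "\<bar>g x\<bar>"] by (simp add: mult.assoc)
    moreover have "\<bar>f x\<bar> * \<bar>g x\<bar> \<ge> 0" by simp
    ultimately have "\<bar>f x\<bar> * \<bar>g x\<bar> \<le> (f x)\<^sup>2 + (g x)\<^sup>2" by linarith
    then show "norm (f x * g x) \<le> norm ((f x)\<^sup>2 + (g x)\<^sup>2)" by (simp add: abs_mult)
  qed
qed simp

text \<open>Discriminant argument: A + 2 t P + t^2 G is the integral of a square for every t. If G =
  0 and P were nonzero, a suitable t would give the value -1; otherwise t = - P / G is the
  minimiser.\<close>

lemma Cauchy_Schwarz_integral: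
  fixes f g :: "'a \<Rightarrow> real"
  assumes [measurable]: "f \<in> borel_measurable M" "g \<in> borel_measurable M"
    and f: "integrable M (\<lambda>x. (f x)\<^sup>2)" and g: "integrable M (\<lambda>x. (g x)\<^sup>2)"
  shows "(\<integral>x. f x * g x \<partial>M)\<^sup>2 \<le> (\<integral>x. (f x)\<^sup>2 \<partial>M) * (\<integral>x. (g x)\<^sup>2 \<partial>M)"
proof -
  define A P G where "A = (\<integral>x. (f x)\<^sup>2 \<partial>M)" "P = (\<integral>x. f x * g x \<partial>M)" "G = (\<integral>x. (g x)\<^sup>2 \<partial>M)"
  note fg = integrable_mult_of_squares[OF assms]
  have pos: "0 \<le> A + 2 * t * P + t\<^sup>2 * G" for t
  proof -
    have "0 \<le> (\<integral>x. (f x + t * g x)\<^sup>2 \<partial>M)" by simp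
    also have "(\<lambda>x. (f x + t * g x)\<^sup>2) = (\<lambda>x. (f x)\<^sup>2 + 2 * t * (f x * g x) + t\<^sup>2 * (g x)\<^sup>2)"
      by (auto simp: power2_eq_square algebra_simps)
    also have "(\<integral>x. \<dots> x \<partial>M) = A + 2 * t * P + t\<^sup>2 * G"
      using f g fg unfolding A_P_G_def by simp
    finally show ?thesis .
  qed
  have "P\<^sup>2 \<le> A * G"
  proof (cases "G = 0")
    case True
    have "P = 0"
    proof (rule ccontr)
      assume "P \<noteq> 0"
      then show False using pos[of "- (A + 1) / (2 * P)"] True by (simp add: field_simps)
    qed
    then show ?thesis using True by simp
  next
    case False
    moreover have "G \<ge> 0" unfolding A_P_G_def by simp
    ultimately show ?thesis using pos[of "- P / G"]
      by (simp add: field_simps power2_eq_square)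
  qed
  then show ?thesis unfolding A_P_G_def .
qed

text \<open>Canonical (completely degenerate) kernels in the sense of Hoeffding. The second moment
  is bounded uniformly in the other variable, and boundedness is asked only from below because the
  kernel may inherit the positive singularities of the potential. Since the space is everything,
  each point is an admissible parameter of a section.\<close>

locale canonical_kernel = prob_space M for M :: "'a measure" +
  fixes H :: "'a \<Rightarrow> 'a \<Rightarrow> real" and a h :: real
  assumes space_M: "space M = UNIV"
    and measurable_kernel [measurable]: "case_prod H \<in> borel_measurable (M \<Otimes>\<^sub>M M)"
    and symmetric: "H x y = H y x"
    and integrable_square: "integrable M (\<lambda>x. (H x y)\<^sup>2)"
    and integral_square: "(\<integral>x. (H x y)\<^sup>2 \<partial>M) \<le> a\<^sup>2"
    and integral_zero: "(\<integral>x. H x y \<partial>M) = 0"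
    and lower_bound: "- h \<le> H x y"
    and nonneg: "0 \<le> a" "0 \<le> h"
begin

text \<open>The Gram kernel in L2 of the functions \<open>H w y\<close> of \<open>w\<close>,
  equivalently the kernel of the square of the integral operator given by \<open>H\<close>. This
  makes \<open>gram_sum\<close> a squared norm.\<close>

definition gram :: "'a \<Rightarrow> 'a \<Rightarrow> real" where
  "gram y z = (\<integral>w. H w y * H w z \<partial>M)"

definition pair_sum :: "nat \<Rightarrow> (nat \<Rightarrow> 'a) \<Rightarrow> real" where
  "pair_sum k x = (\<Sum>i<k. \<Sum>j<i. H (x i) (x j))"

definition gram_sum :: "nat \<Rightarrow> (nat \<Rightarrow> 'a) \<Rightarrow> real" where
  "gram_sum k x = (\<Sum>i<k. \<Sum>j<k. gram (x i) (x j))"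

lemma measurable_gram [measurable]: "case_prod gram \<in> borel_measurable (M \<Otimes>\<^sub>M M)"
  unfolding gram_def by measurable

lemma measurable_pair_sum [measurable]: "pair_sum k \<in> borel_measurable (Pi\<^sub>M {..<k} (\<lambda>_. M))"
  unfolding pair_sum_def by measurable

lemma measurable_gram_sum [measurable]: "gram_sum k \<in> borel_measurable (Pi\<^sub>M {..<k} (\<lambda>_. M))"
  unfolding gram_sum_def by measurable


lemma measurable_section [measurable]: "(\<lambda>x. H x y) \<in> borel_measurable M"
proof -
  have [measurable]: "y \<in> space M" by (simp add: space_M)
  show ?thesis by measurable
qed

lemma measurable_gram_section [measurable]: "gram y \<in> borel_measurable M"
proof -
  have [measurable]: "y \<in> space M" by (simp add: space_M)
  show ?thesis by measurable
qed

lemma integrable_kernel: "integrable M (\<lambda>x. H x y)"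
  using integrable_square[of y] by (rule square_integrable_imp_integrable[rotated]) simp

lemma integrable_kernel_product: "integrable M (\<lambda>w. H w y * H w z)"
  by (intro integrable_mult_of_squares integrable_square) simp_all

lemma gram_commute: "gram y z = gram z y"
  by (simp add: gram_def mult.commute)

lemma gram_diagonal_le: "gram y y \<le> a\<^sup>2"
  using integral_square[of y] by (simp add: gram_def power2_eq_square)

text \<open>Fubini brings the vanishing mean of \<open>H\<close> inside. Integrability on the
  product holds because both factors are square integrable there, the second by the uniform bound
  a^2 on the sections.\<close>

lemma integral_gram: "(\<integral>y. gram z y \<partial>M) = 0"
proof -
  interpret P: pair_sigma_finite M M ..
  have 1: "integrable (M \<Otimes>\<^sub>M M) (\<lambda>p. (H (fst p) z)\<^sup>2)"
    by (rule P.Fubini_integrable) (simp_all add: prob_space integrable_square)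
  have 2: "integrable (M \<Otimes>\<^sub>M M) (\<lambda>p. (H (fst p) (snd p))\<^sup>2)"
  proof (rule P.Fubini_integrable)
    show "integrable M (\<lambda>w. \<integral>y. norm ((H (fst (w, y)) (snd (w, y)))\<^sup>2) \<partial>M)"
    proof (rule integrable_const_bound)
      show "AE w in M. norm (\<integral>y. norm ((H (fst (w, y)) (snd (w, y)))\<^sup>2) \<partial>M) \<le> a\<^sup>2"
      proof (rule AE_I2)
        fix w show "norm (\<integral>y. norm ((H (fst (w, y)) (snd (w, y)))\<^sup>2) \<partial>M) \<le> a\<^sup>2"
          using integral_square[of w] by (simp add: symmetric[of w])
      qed
    qed simp
    show "AE w in M. integrable M (\<lambda>y. (H (fst (w, y)) (snd (w, y)))\<^sup>2)"
    proof (rule AE_I2)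
      fix w show "integrable M (\<lambda>y. (H (fst (w, y)) (snd (w, y)))\<^sup>2)"
        using integrable_square[of w] by (simp add: symmetric[of w])
    qed
  qed simp
  have "integrable (M \<Otimes>\<^sub>M M) (\<lambda>p. H (fst p) z * H (fst p) (snd p))"
    by (rule integrable_mult_of_squares[OF _ _ 1 2]) simp_all
  then have "(\<integral>y. \<integral>w. H w z * H w y \<partial>M \<partial>M) = (\<integral>w. \<integral>y. H w z * H w y \<partial>M \<partial>M)"
    using P.Fubini_integral[of "\<lambda>w y. H w z * H w y"] by (simp add: case_prod_beta')
  also have "\<dots> = (\<integral>w. H w z * (\<integral>y. H y w \<partial>M) \<partial>M)"
    by (intro Bochner_Integration.integral_cong refl) (simp add: symmetric)
  finally show ?thesis by (simp add: gram_def integral_zero)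
qed

lemma square_sum_kernel_integrable: "integrable M (\<lambda>w. (\<Sum>j<k. H w (x j))\<^sup>2)"
  unfolding power2_eq_square sum_product
  by (intro Bochner_Integration.integrable_sum integrable_kernel_product)

lemma gram_sum_eq: "gram_sum k x = (\<integral>w. (\<Sum>j<k. H w (x j))\<^sup>2 \<partial>M)"
  unfolding power2_eq_square sum_product gram_sum_def gram_def
  by (simp add: integrable_kernel_product)

lemma gram_sum_nonneg: "0 \<le> gram_sum k x"
  by (simp add: gram_sum_eq)

text \<open>Cauchy-Schwarz against the single function \<open>H w y\<close> of \<open>w\<close>. The
  bound depends on \<open>k\<close> only through \<open>gram_sum\<close>, so the squared cross term
  reproduces the quadratic form when a particle is integrated out.\<close>

lemma sum_gram_square_le: "(\<Sum>j<k. gram (x j) y)\<^sup>2 \<le> gram_sum k x * a\<^sup>2"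
proof -
  have "(\<Sum>j<k. gram (x j) y) = (\<integral>w. (\<Sum>j<k. H w (x j)) * H w y \<partial>M)"
    by (simp add: gram_def sum_distrib_right integrable_kernel_product)
  then have "(\<Sum>j<k. gram (x j) y)\<^sup>2 \<le> gram_sum k x * (\<integral>w. (H w y)\<^sup>2 \<partial>M)"
    using Cauchy_Schwarz_integral[of "\<lambda>w. \<Sum>j<k. H w (x j)" M "\<lambda>w. H w y"]
    by (simp add: gram_sum_eq square_sum_kernel_integrable integrable_square)
  also have "\<dots> \<le> gram_sum k x * a\<^sup>2"
    by (intro mult_left_mono integral_square gram_sum_nonneg)
  finally show ?thesis .
qed

lemma abs_gram_le: "\<bar>gram y z\<bar> \<le> a\<^sup>2"
proof -
  have "(gram y z)\<^sup>2 \<le> (\<integral>w. (H w y)\<^sup>2 \<partial>M) * (\<integral>w. (H w z)\<^sup>2 \<partial>M)"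
    unfolding gram_def by (intro Cauchy_Schwarz_integral integrable_square) simp_all
  also have "\<dots> \<le> a\<^sup>2 * a\<^sup>2"
    by (intro mult_mono integral_square) simp_all
  finally have "\<bar>gram y z\<bar>\<^sup>2 \<le> (a\<^sup>2)\<^sup>2" by (simp add: power2_eq_square)
  then show ?thesis by (rule power2_le_imp_le) simp
qed

lemma integrable_gram: "integrable M (gram z)"
  by (rule integrable_const_bound[where B="a\<^sup>2"]) (simp_all add: abs_gram_le)

text \<open>\<open>F\<close> is the interaction with the new particle and \<open>G\<close> collects
  the cross terms that it adds to the quadratic form. Both have mean zero, so the quadratic bound on
  exp leaves 1 plus a second moment, and 1 + u <= exp u. The coefficient 2 s^2 + 8 t^2 a^2 comes
  from (F + G)^2 <= 2 F^2 + 2 G^2.\<close>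

lemma exp_moment_section:
  assumes s: "0 \<le> s" and t: "0 \<le> t"
    and small: "s * k * h + 2 * t * k * a\<^sup>2 \<le> 1"
  shows "(\<integral>\<^sup>+y. ennreal (exp (- s * (\<Sum>j<k. H y (x j)) + 2 * t * (\<Sum>j<k. gram (x j) y))) \<partial>M)
    \<le> ennreal (exp ((2 * s\<^sup>2 + 8 * t\<^sup>2 * a\<^sup>2) * gram_sum k x))"
proof -
  define F where "F y = - s * (\<Sum>j<k. H y (x j))" for y
  define G where "G y = 2 * t * (\<Sum>j<k. gram (x j) y)" for y
  have [measurable]: "F \<in> borel_measurable M" "G \<in> borel_measurable M"
    unfolding F_def G_def by measurable
  have F_int: "integrable M F" and G_int: "integrable M G"
    unfolding F_def G_def
    by (intro Bochner_Integration.integrable_sum integrable_mult_right integrable_kernel integrable_gram)+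
  have F_0: "(\<integral>y. F y \<partial>M) = 0" unfolding F_def
    by (simp add: integrable_kernel integral_zero)
  have G_0: "(\<integral>y. G y \<partial>M) = 0" unfolding G_def
    by (simp add: integrable_gram integral_gram)
  have F2: "integrable M (\<lambda>y. (F y)\<^sup>2)" "(\<integral>y. (F y)\<^sup>2 \<partial>M) = s\<^sup>2 * gram_sum k x"
    unfolding F_def by (simp_all add: power_mult_distrib square_sum_kernel_integrable gram_sum_eq)
  have G2: "(G y)\<^sup>2 \<le> 4 * t\<^sup>2 * a\<^sup>2 * gram_sum k x" for y
    using mult_left_mono[OF sum_gram_square_le[of x y k], of "4 * t\<^sup>2"]
    by (simp add: G_def power_mult_distrib mult_ac)
  have G2_int: "integrable M (\<lambda>y. (G y)\<^sup>2)"
    by (rule integrable_const_bound[where B="4 * t\<^sup>2 * a\<^sup>2 * gram_sum k x"]) (use G2 in auto)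
  have FG2_int: "integrable M (\<lambda>y. (F y + G y)\<^sup>2)"
    unfolding power2_sum
    by (intro Bochner_Integration.integrable_add integrable_mult_of_squares F2 G2_int
        integrable_mult_right | simp add: mult.assoc)+
  \<comment> \<open>The lower bound on \<open>H\<close> limits \<open>F\<close> from above, and
    \<open>abs_gram_le\<close> limits \<open>G\<close>; these are the two terms of
    \<open>small\<close>.\<close>
  have FG_le: "F y + G y \<le> 1" for y
  proof -
    have "F y \<le> s * (\<Sum>j<k. h)"
      unfolding F_def minus_mult_left[symmetric] minus_mult_right sum_negf[symmetric]
      using lower_bound by (intro mult_left_mono sum_mono s) (simp add: minus_le_iff)
    moreover have "G y \<le> 2 * t * (\<Sum>j<k. a\<^sup>2)"
      unfolding G_def using abs_gram_le t by (intro mult_left_mono sum_mono) (auto intro: order_trans[OF abs_ge_self])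
    ultimately show ?thesis using small by (simp add: mult_ac)
  qed
  have "(\<integral>\<^sup>+y. ennreal (exp (F y + G y)) \<partial>M) \<le> (\<integral>\<^sup>+y. ennreal (1 + (F y + G y) + (F y + G y)\<^sup>2) \<partial>M)"
    by (intro nn_integral_mono ennreal_leI exp_le_quadratic FG_le)
  also have "\<dots> = ennreal (\<integral>y. 1 + (F y + G y) + (F y + G y)\<^sup>2 \<partial>M)"
  proof (rule nn_integral_eq_integral)
    show "integrable M (\<lambda>y. 1 + (F y + G y) + (F y + G y)\<^sup>2)"
      by (intro Bochner_Integration.integrable_add F_int G_int FG2_int) simp
    have "0 \<le> 1 + u + u\<^sup>2" for u :: real
      using zero_le_power2[of "u + 1/2"] by (simp add: power2_eq_square algebra_simps)
    then show "AE y in M. 0 \<le> 1 + (F y + G y) + (F y + G y)\<^sup>2" by simp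
  qed
  also have "(\<integral>y. 1 + (F y + G y) + (F y + G y)\<^sup>2 \<partial>M) = 1 + (\<integral>y. (F y + G y)\<^sup>2 \<partial>M)"
    using F_int G_int FG2_int F_0 G_0 by (simp add: prob_space)
  also have "(\<integral>y. (F y + G y)\<^sup>2 \<partial>M) \<le> (\<integral>y. 2 * (F y)\<^sup>2 + 8 * t\<^sup>2 * a\<^sup>2 * gram_sum k x \<partial>M)"
  proof (rule integral_mono)
    show "(F y + G y)\<^sup>2 \<le> 2 * (F y)\<^sup>2 + 8 * t\<^sup>2 * a\<^sup>2 * gram_sum k x" for y
      using zero_le_power2[of "F y - G y"] G2[of y] by (simp add: power2_sum power2_diff)
  qed (use FG2_int F2 in auto)
  also have "\<dots> = (2 * s\<^sup>2 + 8 * t\<^sup>2 * a\<^sup>2) * gram_sum k x"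
    using F2 by (simp add: prob_space algebra_simps)
  also have "1 + \<dots> \<le> exp \<dots>" by (rule exp_ge_add_one_self)
  finally show ?thesis by (simp add: F_def G_def ennreal_leI)
qed

text \<open>Integrating out the last particle costs only an increase of the weight of the quadratic form
  \<^const>\<open>gram_sum\<close>, because \<open>exp L \<le> 1 + L + L\<^sup>2\<close> for \<open>L \<le> 1\<close> and the linear term has mean zero.  The
  bound on \<open>L\<close> is one-sided, so the kernel need only be bounded below.\<close>

lemma exp_moment_step:
  assumes s: "0 \<le> s" and t: "0 \<le> t"
    and small: "s * k * h + 2 * t * k * a\<^sup>2 \<le> 1"
  shows "(\<integral>\<^sup>+x. ennreal (exp (- s * pair_sum (Suc k) x + t * gram_sum (Suc k) x)) \<partial>Pi\<^sub>M {..<Suc k} (\<lambda>_. M))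
    \<le> ennreal (exp (t * a\<^sup>2)) *
      (\<integral>\<^sup>+x. ennreal (exp (- s * pair_sum k x + (t + (2 * s\<^sup>2 + 8 * t\<^sup>2 * a\<^sup>2)) * gram_sum k x))
         \<partial>Pi\<^sub>M {..<k} (\<lambda>_. M))"
proof -
  interpret P: product_sigma_finite "\<lambda>_::nat. M" ..
  define F where "F x = ennreal (exp (- s * pair_sum (Suc k) x + t * gram_sum (Suc k) x))" for x
  have F_meas: "F \<in> borel_measurable (Pi\<^sub>M (insert k {..<k}) (\<lambda>_. M))"
    using measurable_pair_sum[of "Suc k"] measurable_gram_sum[of "Suc k"]
    unfolding F_def lessThan_Suc by measurable
  have inner: "(\<integral>\<^sup>+y. F (x(k := y)) \<partial>M) \<le> ennreal (exp (t * a\<^sup>2)) *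
      ennreal (exp (- s * pair_sum k x + (t + (2 * s\<^sup>2 + 8 * t\<^sup>2 * a\<^sup>2)) * gram_sum k x))" for x
  proof -
    define c where "c = t * a\<^sup>2 + (- s * pair_sum k x + t * gram_sum k x)"
    have "F (x(k := y)) \<le> ennreal (exp c) *
      ennreal (exp (- s * (\<Sum>j<k. H y (x j)) + 2 * t * (\<Sum>j<k. gram (x j) y)))" for y
    proof -
      have 1: "pair_sum (Suc k) (x(k := y)) = pair_sum k x + (\<Sum>j<k. H y (x j))"
        by (simp add: pair_sum_def)
      have swap: "(\<Sum>j<k. gram y (x j)) = (\<Sum>j<k. gram (x j) y)"
        by (intro sum.cong refl gram_commute)
      \<comment> \<open>The quadratic form gains two equal rows and one diagonal entry: the rows
        produce the weight 2 t, the entry the factor exp (t a^2).\<close>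
      have "gram_sum (Suc k) (x(k := y)) = gram_sum k x + 2 * (\<Sum>j<k. gram (x j) y) + gram y y"
        by (simp add: gram_sum_def sum.distrib swap)
      also have "\<dots> \<le> gram_sum k x + 2 * (\<Sum>j<k. gram (x j) y) + a\<^sup>2"
        using gram_diagonal_le by simp
      finally have "t * gram_sum (Suc k) (x(k := y))
          \<le> t * (gram_sum k x + 2 * (\<Sum>j<k. gram (x j) y) + a\<^sup>2)"
        using t by (rule mult_left_mono)
      with 1 show ?thesis
        unfolding F_def c_def
        by (simp add: ennreal_mult[symmetric] exp_add[symmetric] algebra_simps)
    qed
    then have "(\<integral>\<^sup>+y. F (x(k := y)) \<partial>M) \<le> (\<integral>\<^sup>+y. ennreal (exp c) *
      ennreal (exp (- s * (\<Sum>j<k. H y (x j)) + 2 * t * (\<Sum>j<k. gram (x j) y))) \<partial>M)"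
      by (intro nn_integral_mono)
    also have "\<dots> = ennreal (exp c) *
      (\<integral>\<^sup>+y. ennreal (exp (- s * (\<Sum>j<k. H y (x j)) + 2 * t * (\<Sum>j<k. gram (x j) y))) \<partial>M)"
      by (rule nn_integral_cmult) measurable
    also have "\<dots> \<le> ennreal (exp c) * ennreal (exp ((2 * s\<^sup>2 + 8 * t\<^sup>2 * a\<^sup>2) * gram_sum k x))"
      by (intro mult_left_mono exp_moment_section assms) simp
    also have "\<dots> = ennreal (exp (t * a\<^sup>2)) *
      ennreal (exp (- s * pair_sum k x + (t + (2 * s\<^sup>2 + 8 * t\<^sup>2 * a\<^sup>2)) * gram_sum k x))"
      by (simp add: ennreal_mult[symmetric] exp_add[symmetric] c_def algebra_simps)
    finally show ?thesis .
  qed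
  have "(\<integral>\<^sup>+x. F x \<partial>Pi\<^sub>M {..<Suc k} (\<lambda>_. M)) = (\<integral>\<^sup>+x. \<integral>\<^sup>+y. F (x(k := y)) \<partial>M \<partial>Pi\<^sub>M {..<k} (\<lambda>_. M))"
    unfolding lessThan_Suc by (rule P.product_nn_integral_insert[OF _ _ F_meas]) auto
  also have "\<dots> \<le> (\<integral>\<^sup>+x. ennreal (exp (t * a\<^sup>2)) *
      ennreal (exp (- s * pair_sum k x + (t + (2 * s\<^sup>2 + 8 * t\<^sup>2 * a\<^sup>2)) * gram_sum k x)) \<partial>Pi\<^sub>M {..<k} (\<lambda>_. M))"
    by (intro nn_integral_mono inner)
  finally show ?thesis unfolding F_def by (simp add: nn_integral_cmult)
qed

text \<open>\<open>exp_moment_step\<close> is iterated with weights 4 s^2 (N - k), where s =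
  \<theta> / N: the weight is zero when all particles are present, and the quadratic form is empty
  when none is left. One step adds 2 s^2 + 8 t^2 a^2, which fits into 4 s^2 as soon as 4 t^2 a^2 <=
  s^2; since t <= 4 s^2 N, this follows from 64 \<theta>^2 a^2 <= 1. The diagonal factors accumulate
  to exp (4 \<theta>^2 a^2), independently of N.\<close>

lemma exp_moment_pair_sum:
  assumes lam: "0 \<le> \<theta>" "8 * \<theta> * a \<le> 1" "2 * \<theta> * h \<le> 1"
  shows "(\<integral>\<^sup>+x. ennreal (exp (- (\<theta> / N) * pair_sum N x)) \<partial>Pi\<^sub>M {..<N} (\<lambda>_. M)) \<le> ennreal (exp 1)"
proof (cases "N = 0")
  case True
  then show ?thesis by (simp add: pair_sum_def space_PiM)
next
  case False
  define s where "s = \<theta> / N"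
  have s: "0 \<le> s" "s * N = \<theta>" using lam False by (auto simp: s_def)
  have la: "64 * (\<theta>\<^sup>2 * a\<^sup>2) \<le> 1"
  proof -
    have "(8 * \<theta> * a)\<^sup>2 \<le> 1\<^sup>2" using lam nonneg by (intro power_mono) auto
    then show ?thesis by (simp add: power_mult_distrib)
  qed
  have "(\<integral>\<^sup>+x. ennreal (exp (- s * pair_sum k x + 4 * s\<^sup>2 * (N - k) * gram_sum k x)) \<partial>Pi\<^sub>M {..<k} (\<lambda>_. M))
      \<le> ennreal (exp (4 * s\<^sup>2 * N * a\<^sup>2 * k))" if "k \<le> N" for k
    using that
  proof (induction k)
    case 0
    then show ?case by (simp add: pair_sum_def gram_sum_def space_PiM)
  next
    case (Suc k)
    define t where "t = 4 * s\<^sup>2 * (real N - Suc k)"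
    have t: "0 \<le> t" using Suc.prems by (simp add: t_def)
    have t_le: "t \<le> 4 * s\<^sup>2 * N" by (simp add: t_def mult_left_mono)
    have sN: "s\<^sup>2 * (real N)\<^sup>2 = \<theta>\<^sup>2" by (simp flip: s(2) add: power_mult_distrib)
    have small: "s * k * h + 2 * t * k * a\<^sup>2 \<le> 1"
    proof -
      have "s * k * h \<le> s * N * h"
        using Suc.prems s nonneg by (intro mult_right_mono mult_left_mono) auto
      moreover have "2 * t * k * a\<^sup>2 \<le> 2 * (4 * s\<^sup>2 * N) * N * a\<^sup>2"
        using Suc.prems t_le t by (intro mult_right_mono mult_mono) auto
      moreover have "2 * (4 * s\<^sup>2 * N) * N * a\<^sup>2 = 8 * (\<theta>\<^sup>2 * a\<^sup>2)"
        unfolding sN[symmetric] by (simp add: power2_eq_square)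
      moreover have "s * N * h = \<theta> * h" using s by simp
      ultimately show ?thesis using lam la by linarith
    qed
    have t2: "4 * t\<^sup>2 * a\<^sup>2 \<le> s\<^sup>2"
    proof -
      have "t\<^sup>2 \<le> (4 * s\<^sup>2 * N)\<^sup>2" using t t_le by (rule power_mono[rotated])
      then have "4 * t\<^sup>2 * a\<^sup>2 \<le> 4 * (4 * s\<^sup>2 * N)\<^sup>2 * a\<^sup>2" by (intro mult_right_mono mult_left_mono) auto
      also have "\<dots> = 64 * (\<theta>\<^sup>2 * a\<^sup>2) * s\<^sup>2" unfolding sN[symmetric] by (simp add: power2_eq_square)
      also have "\<dots> \<le> 1 * s\<^sup>2" using la by (intro mult_right_mono) auto
      finally show ?thesis by simp
    qed
    have "(\<integral>\<^sup>+x. ennreal (exp (- s * pair_sum (Suc k) x + t * gram_sum (Suc k) x)) \<partial>Pi\<^sub>M {..<Suc k} (\<lambda>_. M))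
      \<le> ennreal (exp (t * a\<^sup>2)) *
      (\<integral>\<^sup>+x. ennreal (exp (- s * pair_sum k x + (t + (2 * s\<^sup>2 + 8 * t\<^sup>2 * a\<^sup>2)) * gram_sum k x))
         \<partial>Pi\<^sub>M {..<k} (\<lambda>_. M))"
      by (rule exp_moment_step[OF s(1) t small])
    also have "\<dots> \<le> ennreal (exp (4 * s\<^sup>2 * N * a\<^sup>2)) *
      (\<integral>\<^sup>+x. ennreal (exp (- s * pair_sum k x + 4 * s\<^sup>2 * (N - k) * gram_sum k x)) \<partial>Pi\<^sub>M {..<k} (\<lambda>_. M))"
    proof (intro mult_mono nn_integral_mono ennreal_leI)
      show "exp (t * a\<^sup>2) \<le> exp (4 * s\<^sup>2 * N * a\<^sup>2)" using t_le by (simp add: mult_right_mono)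
      have "t + (2 * s\<^sup>2 + 8 * t\<^sup>2 * a\<^sup>2) \<le> 4 * s\<^sup>2 * (real N - k)"
        using t2 by (simp add: t_def algebra_simps)
      then show "exp (- s * pair_sum k x + (t + (2 * s\<^sup>2 + 8 * t\<^sup>2 * a\<^sup>2)) * gram_sum k x)
          \<le> exp (- s * pair_sum k x + 4 * s\<^sup>2 * (N - k) * gram_sum k x)" for x
        using Suc.prems by (simp add: mult_right_mono gram_sum_nonneg of_nat_diff)
    qed auto
    also have "\<dots> \<le> ennreal (exp (4 * s\<^sup>2 * N * a\<^sup>2)) * ennreal (exp (4 * s\<^sup>2 * N * a\<^sup>2 * k))"
      using Suc by (intro mult_left_mono) auto
    also have "\<dots> = ennreal (exp (4 * s\<^sup>2 * N * a\<^sup>2 * Suc k))"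
      by (simp add: ennreal_mult[symmetric] exp_add[symmetric] algebra_simps)
    finally show ?case using Suc.prems by (simp add: t_def of_nat_diff)
  qed
  from this[of N] have "(\<integral>\<^sup>+x. ennreal (exp (- s * pair_sum N x)) \<partial>Pi\<^sub>M {..<N} (\<lambda>_. M))
      \<le> ennreal (exp (4 * s\<^sup>2 * N * a\<^sup>2 * N))" by simp
  also have "4 * s\<^sup>2 * N * a\<^sup>2 * N = 4 * (\<theta>\<^sup>2 * a\<^sup>2)"
    by (simp flip: s(2) add: power2_eq_square)
  also have "ennreal (exp (4 * (\<theta>\<^sup>2 * a\<^sup>2))) \<le> ennreal (exp 1)"
    using la by (intro ennreal_leI) simp
  finally show ?thesis by (simp add: s_def)
qed

end

text \<open>The value of \<open>offdiag_energy\<close> at N distinct points with an atomless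
  background, after multiplying out the double integral; the division by 2 N collects the factor 1/2
  and the weights 1 / sqrt N. A real kernel is used so that it can be split into a smooth and a
  rough part.\<close>

definition energy :: "nat \<Rightarrow> 'a measure \<Rightarrow> ('a \<Rightarrow> 'a \<Rightarrow> real) \<Rightarrow> (nat \<Rightarrow> 'a) \<Rightarrow> real" where
  "energy N \<rho> V x =
     ((\<Sum>i<N. \<Sum>j\<in>{..<N} - {i}. V (x i) (x j)) - 2 * real N * (\<Sum>i<N. \<integral>y. V (x i) y \<partial>\<rho>)
        + (real N)\<^sup>2 * (\<integral>u. \<integral>y. V u y \<partial>\<rho> \<partial>\<rho>)) / (2 * real N)"

lemma sum_offdiag_symmetric:
  fixes f :: "nat \<Rightarrow> nat \<Rightarrow> real"
  assumes "\<And>i j. f i j = f j i"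
  shows "(\<Sum>i<n. \<Sum>j\<in>{..<n} - {i}. f i j) = 2 * (\<Sum>i<n. \<Sum>j<i. f i j)"
proof (induction n)
  case (Suc n)
  have "(\<Sum>j\<in>{..<Suc n} - {i}. f i j) = (\<Sum>j\<in>{..<n} - {i}. f i j) + f n i" if "i < n" for i
  proof -
    have "{..<Suc n} - {i} = insert n ({..<n} - {i})" using that by auto
    then show ?thesis using assms by simp
  qed
  moreover have "{..<Suc n} - {n} = {..<n}" by auto
  ultimately show ?case using Suc by (simp add: sum.distrib)
qed simp

text \<open>Hoeffding decomposition reduces the energy to the pair sum of a canonical kernel. The
  hypotheses \<open>small\<close> are those of \<open>exp_moment_pair_sum\<close> for a = 4 \<sigma>
  and h = \<delta> + 3 \<sigma>, and the remainder contributes the second factor exp 1.\<close>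

lemma exp_moment_energy:
  fixes V :: "'a \<Rightarrow> 'a \<Rightarrow> real"
  assumes "prob_space M" and space: "space M = UNIV"
    and meas [measurable]: "case_prod V \<in> borel_measurable (M \<Otimes>\<^sub>M M)"
    and sym: "\<And>x y. V x y = V y x"
    and int: "\<And>x. integrable M (\<lambda>y. (V x y)\<^sup>2)"
    and sq: "\<And>x. (\<integral>y. (V x y)\<^sup>2 \<partial>M) \<le> \<sigma>\<^sup>2"
    and lower: "\<And>x y. - \<delta> \<le> V x y"
    and pos: "0 \<le> \<sigma>" "0 \<le> \<delta>" "0 \<le> \<theta>" "0 < N"
    and small: "32 * \<theta> * \<sigma> \<le> 1" "4 * \<theta> * \<delta> \<le> 1"
  shows "(\<integral>\<^sup>+x. ennreal (exp (- \<theta> * energy N M V x)) \<partial>Pi\<^sub>M {..<N} (\<lambda>_. M)) \<le> ennreal (exp 2)"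
proof -
  interpret prob_space M by fact
  have [measurable]: "(\<lambda>y. V x y) \<in> borel_measurable M" for x
  proof -
    have [measurable]: "x \<in> space M" by (simp add: space)
    show ?thesis by measurable
  qed
  have V_int: "integrable M (V x)" for x
    using int[of x] by (rule square_integrable_imp_integrable[rotated]) simp
  define v where "v x = (\<integral>y. V x y \<partial>M)" for x
  define vbar where "vbar = (\<integral>x. v x \<partial>M)"
  have [measurable]: "v \<in> borel_measurable M" unfolding v_def by measurable
  have v_sq: "(v x)\<^sup>2 \<le> \<sigma>\<^sup>2" for x
    using Cauchy_Schwarz_integral[of "\<lambda>_. 1" M "V x"] int[of x] sq[of x] by (simp add: v_def prob_space)
  then have v_abs: "\<bar>v x\<bar> \<le> \<sigma>" for x
    using pos abs_le_square_iff[of "v x" \<sigma>] by simp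
  have v_int: "integrable M v"
    by (rule integrable_const_bound[where B=\<sigma>]) (simp_all add: v_abs)
  have vbar_abs: "\<bar>vbar\<bar> \<le> \<sigma>"
  proof -
    have "\<bar>vbar\<bar> \<le> (\<integral>x. \<bar>v x\<bar> \<partial>M)" unfolding vbar_def by (rule integral_abs_bound)
    also have "\<dots> \<le> (\<integral>x. \<sigma> \<partial>M)" using v_abs v_int by (intro integral_mono) auto
    finally show ?thesis by (simp add: prob_space)
  qed
  \<comment> \<open>Its square is at most four times the sum of the squares of the four terms, each
    of mean at most \<sigma>^2 in either variable, hence the bound (4 \<sigma>)^2. Each of the three
    corrections costs \<sigma> in the lower bound.\<close>
  define H where "H x y = V x y - v x - v y + vbar" for x y
  have H_sq: "(H x y)\<^sup>2 \<le> 4 * ((V y x)\<^sup>2 + 3 * \<sigma>\<^sup>2)" for x y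
  proof -
    have *: "(p - q - r + u)\<^sup>2 \<le> 4 * (p\<^sup>2 + (q\<^sup>2 + r\<^sup>2 + u\<^sup>2))" for p q r u :: real
    proof -
      have "0 \<le> (p + q)\<^sup>2 + (p + r)\<^sup>2 + (p - u)\<^sup>2 + (q - r)\<^sup>2 + (q + u)\<^sup>2 + (r + u)\<^sup>2" by simp
      then show ?thesis by (simp add: power2_eq_square algebra_simps)
    qed
    have "vbar\<^sup>2 \<le> \<sigma>\<^sup>2" using vbar_abs pos abs_le_square_iff[of vbar \<sigma>] by simp
    then have "4 * ((V x y)\<^sup>2 + ((v x)\<^sup>2 + (v y)\<^sup>2 + vbar\<^sup>2)) \<le> 4 * ((V x y)\<^sup>2 + 3 * \<sigma>\<^sup>2)"
      using v_sq[of x] v_sq[of y] by simp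
    then show ?thesis
      using *[of "V x y" "v x" "v y" vbar] unfolding H_def sym[of y x] by (rule order_trans[rotated])
  qed
  have [measurable]: "case_prod H \<in> borel_measurable (M \<Otimes>\<^sub>M M)"
    unfolding H_def by measurable
  have [measurable]: "(\<lambda>x. H x y) \<in> borel_measurable M" for y
    unfolding H_def sym[of _ y] by measurable
  have H_int: "integrable M (\<lambda>x. (H x y)\<^sup>2)" for y
  proof (rule Bochner_Integration.integrable_bound)
    show "integrable M (\<lambda>x. 4 * ((V y x)\<^sup>2 + 3 * \<sigma>\<^sup>2))" using int[of y] by simp
    show "AE x in M. norm ((H x y)\<^sup>2) \<le> norm (4 * ((V y x)\<^sup>2 + 3 * \<sigma>\<^sup>2))"
      using H_sq[of _ y] by simp
  qed simp
  interpret canonical_kernel M H "4 * \<sigma>" "\<delta> + 3 * \<sigma>"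
  proof
    show "H x y = H y x" for x y by (simp add: H_def sym[of x y])
    show "integrable M (\<lambda>x. (H x y)\<^sup>2)" for y by (rule H_int)
    show "(\<integral>x. (H x y)\<^sup>2 \<partial>M) \<le> (4 * \<sigma>)\<^sup>2" for y
    proof -
      have "(\<integral>x. (H x y)\<^sup>2 \<partial>M) \<le> (\<integral>x. 4 * ((V y x)\<^sup>2 + 3 * \<sigma>\<^sup>2) \<partial>M)"
        using H_int[of y] H_sq[of _ y] int[of y] by (intro integral_mono) auto
      also have "\<dots> = 4 * ((\<integral>x. (V y x)\<^sup>2 \<partial>M) + 3 * \<sigma>\<^sup>2)" using int[of y] by (simp add: prob_space)
      finally show ?thesis using sq[of y] by (simp add: power_mult_distrib)
    qed
    show "(\<integral>x. H x y \<partial>M) = 0" for y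
      using V_int[of y] v_int by (simp add: H_def sym[of _ y] prob_space v_def[of y, symmetric] vbar_def)
    show "- (\<delta> + 3 * \<sigma>) \<le> H x y" for x y
      using lower[of x y] v_abs[of x] v_abs[of y] vbar_abs unfolding H_def by (simp add: abs_le_iff)
  qed (use pos space in simp_all)
  \<comment> \<open>The one-particle terms nearly cancel against the background. Since the sum skips
    j = i, the remainder (N vbar - 2 sum v) / (2 N) survives; it is at least -3/2 \<sigma>.\<close>
  have energy_ge: "- \<theta> * energy N M V x \<le> - (\<theta> / N) * pair_sum N x + 1" for x
  proof -
    have "(\<Sum>i<N. \<Sum>j\<in>{..<N} - {i}. V (x i) (x j)) =
      (\<Sum>i<N. \<Sum>j\<in>{..<N} - {i}. H (x i) (x j) + (v (x i) + v (x j) - vbar))"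
      by (simp add: H_def)
    also have "\<dots> = 2 * pair_sum N x + (\<Sum>i<N. \<Sum>j\<in>{..<N} - {i}. v (x i) + v (x j) - vbar)"
      unfolding pair_sum_def using symmetric by (subst sum_offdiag_symmetric[symmetric]) (auto simp: sum.distrib)
    also have "(\<Sum>i<N. \<Sum>j\<in>{..<N} - {i}. v (x i) + v (x j) - vbar)
        = (\<Sum>i<N. (real N - 2) * v (x i) + (\<Sum>j<N. v (x j)) - (real N - 1) * vbar)"
      using pos by (intro sum.cong refl)
        (simp add: sum.distrib sum_subtractf sum_diff1 of_nat_diff algebra_simps)
    also have "\<dots> = 2 * (real N - 1) * (\<Sum>i<N. v (x i)) - real N * (real N - 1) * vbar"
      by (simp add: sum.distrib sum_subtractf sum_distrib_left[symmetric] algebra_simps)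
    finally have "energy N M V x = (2 * pair_sum N x - 2 * (\<Sum>i<N. v (x i)) + N * vbar) / (2 * N)"
      unfolding energy_def v_def[symmetric] vbar_def[symmetric]
      by (simp add: algebra_simps power2_eq_square)
    also have "\<dots> \<ge> (2 * pair_sum N x - 3 * N * \<sigma>) / (2 * N)"
    proof -
      have "(\<Sum>i<N. v (x i)) \<le> (\<Sum>i<N. \<sigma>)" using v_abs by (intro sum_mono) (simp add: abs_le_iff)
      moreover have "N * vbar \<ge> N * (- \<sigma>)" using vbar_abs by (intro mult_left_mono) auto
      ultimately show ?thesis using pos by (intro divide_right_mono) auto
    qed
    finally have "energy N M V x \<ge> pair_sum N x / N - 3 / 2 * \<sigma>"
      using pos by (simp add: field_simps)
    then have "- \<theta> * energy N M V x \<le> - \<theta> * (pair_sum N x / N - 3 / 2 * \<sigma>)"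
      using pos by (simp add: mult_left_mono)
    also have "\<dots> = - (\<theta> / N) * pair_sum N x + 3 / 2 * (\<theta> * \<sigma>)" by (simp add: algebra_simps)
    finally show ?thesis using small by linarith
  qed
  have "(\<integral>\<^sup>+x. ennreal (exp (- \<theta> * energy N M V x)) \<partial>Pi\<^sub>M {..<N} (\<lambda>_. M))
      \<le> (\<integral>\<^sup>+x. ennreal (exp 1) * ennreal (exp (- (\<theta> / N) * pair_sum N x)) \<partial>Pi\<^sub>M {..<N} (\<lambda>_. M))"
    using energy_ge
    by (intro nn_integral_mono) (simp add: ennreal_mult[symmetric] exp_add[symmetric] add.commute)
  also have "\<dots> = ennreal (exp 1) * (\<integral>\<^sup>+x. ennreal (exp (- (\<theta> / N) * pair_sum N x)) \<partial>Pi\<^sub>M {..<N} (\<lambda>_. M))"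
    by (rule nn_integral_cmult) measurable
  also have "\<dots> \<le> ennreal (exp 1) * ennreal (exp 1)"
  proof (intro mult_left_mono exp_moment_pair_sum)
    show "2 * \<theta> * (\<delta> + 3 * \<sigma>) \<le> 1" using small by (simp add: algebra_simps)
  qed (use pos small in auto)
  also have "\<dots> = ennreal (exp 2)" by (simp add: ennreal_mult[symmetric] exp_add[symmetric])
  finally show ?thesis .
qed

section \<open>Conditionally positive kernels\<close>

lemma distr_PiM_pair:
  assumes "prob_space M" "finite I" "i \<in> I" "j \<in> I" "i \<noteq> j"
  shows "distr (Pi\<^sub>M I (\<lambda>_. M)) (M \<Otimes>\<^sub>M M) (\<lambda>x. (x i, x j)) = M \<Otimes>\<^sub>M M"
proof -
  interpret prob_space M by fact
  interpret P: product_prob_space "\<lambda>_. M" I ..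
  have [measurable]: "i \<in> I" "j \<in> I" by fact+
  show ?thesis
  proof (rule pair_measure_eqI[symmetric])
    fix A B assume [measurable]: "A \<in> sets M" "B \<in> sets M"
    define X where "X k = (if k = i then A else B)" for k
    have "emeasure (distr (Pi\<^sub>M I (\<lambda>_. M)) (M \<Otimes>\<^sub>M M) (\<lambda>x. (x i, x j))) (A \<times> B)
        = emeasure (Pi\<^sub>M I (\<lambda>_. M)) {x \<in> space (Pi\<^sub>M I (\<lambda>_. M)). \<forall>k\<in>{i, j}. x k \<in> X k}"
      using assms(5) by (subst emeasure_distr) (auto simp: X_def intro!: arg_cong2[where f=emeasure])
    also have "\<dots> = (\<Prod>k\<in>{i, j}. emeasure M (X k))"
      using assms by (intro P.emeasure_PiM_Collect) (auto simp: X_def)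
    also have "\<dots> = emeasure M A * emeasure M B" using assms(5) by (simp add: X_def)
    finally show "emeasure M A * emeasure M B
        = emeasure (distr (Pi\<^sub>M I (\<lambda>_. M)) (M \<Otimes>\<^sub>M M) (\<lambda>x. (x i, x j))) (A \<times> B)" by simp
  qed (auto intro: sigma_finite_measure_axioms)
qed

text \<open>Positivity is only assumed for equally many positive and negative unit charges.  Replacing
  \<open>\<rho>\<close> by \<open>N K\<close> independent samples, with \<open>K\<close> copies of each particle, and letting \<open>K\<close> tend to infinity
  recovers the fluctuation measure.\<close>

lemma energy_ge_of_conditionally_positive:
  fixes U :: "'a \<Rightarrow> 'a \<Rightarrow> real"
  assumes "prob_space M" and space: "space M = UNIV"
    and [measurable]: "case_prod U \<in> borel_measurable (M \<Otimes>\<^sub>M M)"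
    and sym: "\<And>x y. U x y = U y x"
    and int: "\<And>x. integrable M (U x)" "integrable (M \<Otimes>\<^sub>M M) (case_prod U)"
    and diag: "\<And>x. \<bar>U x x\<bar> \<le> B"
    and cpd: "\<And>(I :: (nat \<times> nat) set) x y. finite I \<Longrightarrow>
      0 \<le> (\<Sum>p\<in>I. \<Sum>q\<in>I. U (x p) (x q) + U (y p) (y q) - (U (x p) (y q) + U (y p) (x q)))"
    and N: "0 < N"
  shows "- B / 2 \<le> energy N M U x"
proof -
  interpret prob_space M by fact
  interpret MM: pair_sigma_finite M M ..
  define u where "u x = (\<integral>y. U x y \<partial>M)" for x
  define ubar where "ubar = (\<integral>x. u x \<partial>M)"
  define S where "S = (\<Sum>i<N. \<Sum>j<N. U (x i) (x j))"
  define d where "d = (\<integral>y. U y y \<partial>M)"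
  define T where "T = S - 2 * real N * (\<Sum>i<N. u (x i)) + (real N)\<^sup>2 * ubar"
  have ubar: "(\<integral>p. U (fst p) (snd p) \<partial>(M \<Otimes>\<^sub>M M)) = ubar"
    using MM.integral_fst[OF int(2)] by (simp add: ubar_def u_def case_prod_beta')
  have diag_int: "integrable M (\<lambda>y. U y y)"
    using diag by (intro integrable_const_bound[where B=B]) auto
  \<comment> \<open>A site is a particle index paired with a copy number. Independent samples at
    distinct sites average to \<open>ubar\<close>; only the N K coincident sites see the diagonal
    mean \<open>d\<close>, so division by K^2 leaves an error of order 1 / K.\<close>
  have "0 \<le> T + real N * (d - ubar) / real (Suc k)" for k
  proof -
    define K where "K = Suc k"
    have K: "real K \<noteq> 0" by (simp add: K_def)
    define I where "I = {..<N} \<times> {..<K}"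
    have I: "finite I" "card I = N * K" by (auto simp: I_def)
    define P where "P = Pi\<^sub>M I (\<lambda>_. M)"
    interpret PP: product_prob_space "\<lambda>_. M" I ..
    interpret P: prob_space P unfolding P_def by (intro prob_space_PiM prob_space_axioms)
    have comp: "p \<in> I \<Longrightarrow> (\<lambda>y. y p) \<in> P \<rightarrow>\<^sub>M M" for p by (simp add: P_def)
    have distr1: "distr P M (\<lambda>y. y p) = M" if "p \<in> I" for p
      using PP.PiM_component[OF that] by (simp add: P_def)
    have one: "integrable P (\<lambda>y. f (y p))" "(\<integral>y. f (y p) \<partial>P) = (\<integral>z. f z \<partial>M)"
      if "p \<in> I" "integrable M f" for p and f :: "'a \<Rightarrow> real"
      using that comp[OF that(1)] integrable_distr_eq[of "\<lambda>y. y p" P M f]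
        integral_distr[of "\<lambda>y. y p" P M f] by (simp_all add: distr1 borel_measurable_integrable)
    have two: "integrable P (\<lambda>y. U (y p) (y q))" "(\<integral>y. U (y p) (y q) \<partial>P) = ubar"
      if "p \<in> I" "q \<in> I" "p \<noteq> q" for p q
    proof -
      have [measurable]: "(\<lambda>y. (y p, y q)) \<in> P \<rightarrow>\<^sub>M M \<Otimes>\<^sub>M M" using that comp by simp
      have D: "distr P (M \<Otimes>\<^sub>M M) (\<lambda>y. (y p, y q)) = M \<Otimes>\<^sub>M M"
        unfolding P_def by (rule distr_PiM_pair) (use that I prob_space_axioms in auto)
      show "integrable P (\<lambda>y. U (y p) (y q))"
        using integrable_distr_eq[of "\<lambda>y. (y p, y q)" P "M \<Otimes>\<^sub>M M" "case_prod U"] int(2) by (simp add: D)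
      show "(\<integral>y. U (y p) (y q) \<partial>P) = ubar"
        using integral_distr[of "\<lambda>y. (y p, y q)" P "M \<Otimes>\<^sub>M M" "case_prod U"] ubar
        by (simp add: D case_prod_beta')
    qed
    have term_int: "integrable P (\<lambda>y. U (y p) (y q))"
      and term_eq: "(\<integral>y. U (y p) (y q) \<partial>P) = ubar + (if p = q then d - ubar else 0)"
      if "p \<in> I" "q \<in> I" for p q
      using two[OF that] one[OF that(1) diag_int] by (cases "p = q"; simp add: d_def)+
    note mixed = one[OF _ int(1), folded u_def]
    have mixed': "integrable P (\<lambda>y. U (y p) z)" "(\<integral>y. U (y p) z \<partial>P) = u z" if "p \<in> I" for p z
      using mixed[OF that, of z] by (simp_all add: sym[of _ z])
    have sumI: "(\<Sum>p\<in>I. f (fst p)) = real K * (\<Sum>i<N. f i)" for f :: "nat \<Rightarrow> real"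
      unfolding I_def by (simp add: sum.cartesian_product' sum_distrib_left)
    define X where "X p = x (fst p)" for p :: "nat \<times> nat"
    have "0 \<le> (\<integral>y. (\<Sum>p\<in>I. \<Sum>q\<in>I. U (X p) (X q) + U (y p) (y q) - (U (X p) (y q) + U (y p) (X q))) \<partial>P)"
      by (intro integral_nonneg_AE AE_I2 cpd I)
    also have "\<dots> = (\<Sum>p\<in>I. \<Sum>q\<in>I. (\<integral>y. U (X p) (X q) + U (y p) (y q) - (U (X p) (y q) + U (y p) (X q)) \<partial>P))"
      using term_int mixed mixed' by (simp add: Bochner_Integration.integral_sum)
    also have "\<dots> = (\<Sum>p\<in>I. \<Sum>q\<in>I. U (X p) (X q) + (ubar + (if p = q then d - ubar else 0)) - (u (X p) + u (X q)))"
      using term_int mixed mixed' term_eq by (intro sum.cong refl) (simp add: P.prob_space)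
    also have "\<dots> = (\<Sum>p\<in>I. \<Sum>q\<in>I. U (X p) (X q)) + (\<Sum>p\<in>I. real (card I) * ubar + (d - ubar))
        - 2 * real (card I) * (\<Sum>p\<in>I. u (X p))"
      using I by (simp add: sum.distrib sum_subtractf sum_distrib_left algebra_simps)
    also have "(\<Sum>p\<in>I. \<Sum>q\<in>I. U (X p) (X q)) = (real K)\<^sup>2 * S"
      unfolding X_def S_def sumI[of "\<lambda>j. U (x i) (x j)" for i] sumI[of "\<lambda>i. real K * (\<Sum>j<N. U (x i) (x j))"]
      by (simp add: sum_distrib_left power2_eq_square mult.assoc)
    also have "(\<Sum>p\<in>I. u (X p)) = real K * (\<Sum>i<N. u (x i))"
      unfolding X_def by (rule sumI)
    finally have *: "0 \<le> (real K)\<^sup>2 * S + (\<Sum>p\<in>I. real (card I) * ubar + (d - ubar))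
        - 2 * real (card I) * (real K * (\<Sum>i<N. u (x i)))" .
    have "0 \<le> (real K)\<^sup>2 * (T + real N * (d - ubar) / real K)"
    proof -
      have "(real K)\<^sup>2 * (T + real N * (d - ubar) / real K) = (real K)\<^sup>2 * T + real K * (real N * (d - ubar))"
        using K by (simp add: power2_eq_square distrib_left)
      with * show ?thesis unfolding T_def I by (simp add: I power2_eq_square algebra_simps)
    qed
    then show ?thesis by (simp add: K_def zero_le_mult_iff)
  qed
  moreover have "(\<lambda>k. T + real N * (d - ubar) / real (Suc k)) \<longlonglongrightarrow> T + 0"
    by (intro tendsto_add tendsto_const LIMSEQ_Suc lim_const_over_n)
  ultimately have T: "0 \<le> T" by (intro LIMSEQ_le_const[where X="\<lambda>k. T + real N * (d - ubar) / real (Suc k)"]) auto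
  \<comment> \<open>The price of omitting the diagonal: the self-interactions contained in
    \<open>T\<close> sum to at most N B, and the normalisation by 2 N turns this into B / 2.\<close>
  have "(\<Sum>i<N. U (x i) (x i)) \<le> (\<Sum>i<N. B)" using diag by (intro sum_mono) (simp add: abs_le_iff)
  moreover have "S = (\<Sum>i<N. \<Sum>j\<in>{..<N} - {i}. U (x i) (x j)) + (\<Sum>i<N. U (x i) (x i))"
    unfolding S_def sum.distrib[symmetric] by (intro sum.cong refl) (simp add: sum.remove[where A="{..<N}"])
  ultimately have "- (real N * B) \<le> (\<Sum>i<N. \<Sum>j\<in>{..<N} - {i}. U (x i) (x j)) - 2 * real N * (\<Sum>i<N. u (x i))
        + (real N)\<^sup>2 * ubar"
    using T unfolding T_def by simp
  then have "- (real N * B) / (2 * real N) \<le> energy N M U x"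
    unfolding energy_def u_def[symmetric] ubar_def[symmetric] by (intro divide_right_mono) auto
  then show ?thesis using N by simp
qed

section \<open>Summation over scales\<close>

lemma measurable_energy [measurable]:
  assumes "prob_space M" and [measurable]: "case_prod V \<in> borel_measurable (M \<Otimes>\<^sub>M M)"
  shows "energy N M V \<in> borel_measurable (Pi\<^sub>M {..<N} (\<lambda>_. M))"
proof -
  interpret prob_space M by fact
  show ?thesis unfolding energy_def by measurable
qed

text \<open>Along \<epsilon> = exp (- c n) every positive power of \<epsilon> decays exponentially
  in n and beats the linearly growing order 2 n \<theta>. The constants 32 and 4 are those of
  \<open>exp_moment_energy\<close>, used with \<sigma> = sqrt (D * \<epsilon> powr \<kappa>) and
  \<delta> = K * \<epsilon> powr \<alpha>.\<close>

lemma ex_scale_threshold: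
  fixes \<theta> C0 D K \<kappa> \<alpha> \<epsilon>0 c :: real
  assumes "0 < \<theta>" "0 < c" "0 \<le> D" "0 \<le> K" "0 < \<kappa>" "0 < \<alpha>" "0 < \<epsilon>0"
  shows "\<exists>n0. \<forall>n\<ge>n0. 1 \<le> real n / 2 - B \<and> exp (- (c * real n)) < \<epsilon>0 \<and> exp (- (c * real n)) < 1 \<and>
    32 * (2 * real n * \<theta>) * sqrt (D * exp (- (c * real n)) powr \<kappa>) \<le> 1 \<and>
    4 * (2 * real n * \<theta>) * (K * exp (- (c * real n)) powr \<alpha>) \<le> 1"
proof -
  have "eventually (\<lambda>n::nat. 1 \<le> real n / 2 - B) sequentially" by real_asymp
  moreover have "((\<lambda>n::nat. exp (- (c * real n))) \<longlongrightarrow> 0) sequentially" using assms(2) by real_asymp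
  then have "eventually (\<lambda>n::nat. exp (- (c * real n)) < min \<epsilon>0 1) sequentially"
    using assms by (intro order_tendstoD) auto
  moreover have decay: "((\<lambda>n::nat. x * (real n * exp (- (c * y) * real n))) \<longlongrightarrow> 0) sequentially" if "0 < y" for x y
  proof -
    have "((\<lambda>n::nat. real n * exp (- (c * y) * real n)) \<longlongrightarrow> 0) sequentially"
    proof -
      have "((\<lambda>n::nat. real n * exp (- b * real n)) \<longlongrightarrow> 0) sequentially" if "0 < b" for b :: real
        using that by real_asymp
      from this[OF mult_pos_pos[OF assms(2) \<open>0 < y\<close>]] show ?thesis .
    qed
    from tendsto_mult_right_zero[OF this] show ?thesis .
  qed
  have "eventually (\<lambda>n::nat. 64 * \<theta> * sqrt D * (real n * exp (- (c * (\<kappa> / 2)) * real n)) < 1) sequentially"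
    using assms by (intro order_tendstoD(2)[OF decay]) auto
  moreover have "eventually (\<lambda>n::nat. 8 * \<theta> * K * (real n * exp (- (c * \<alpha>) * real n)) < 1) sequentially"
    using assms by (intro order_tendstoD(2)[OF decay]) auto
  ultimately have "eventually (\<lambda>n::nat. 1 \<le> real n / 2 - B \<and> exp (- (c * real n)) < \<epsilon>0 \<and> exp (- (c * real n)) < 1 \<and>
    32 * (2 * real n * \<theta>) * sqrt (D * exp (- (c * real n)) powr \<kappa>) \<le> 1 \<and>
    4 * (2 * real n * \<theta>) * (K * exp (- (c * real n)) powr \<alpha>) \<le> 1) sequentially"
  proof eventually_elim
    case (elim n)
    have "sqrt (exp (- (c * real n)) powr \<kappa>) = exp (- (c * (\<kappa> / 2)) * real n)"
      by (rule real_sqrt_unique) (simp_all add: powr_def power2_eq_square flip: exp_add)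
    then have "32 * (2 * real n * \<theta>) * sqrt (D * exp (- (c * real n)) powr \<kappa>)
        = 64 * \<theta> * sqrt D * (real n * exp (- (c * (\<kappa> / 2)) * real n))"
      by (simp add: real_sqrt_mult)
    moreover have "4 * (2 * real n * \<theta>) * (K * exp (- (c * real n)) powr \<alpha>)
        = 8 * \<theta> * K * (real n * exp (- (c * \<alpha>) * real n))" by (simp add: powr_def mult_ac)
    ultimately have "32 * (2 * real n * \<theta>) * sqrt (D * exp (- (c * real n)) powr \<kappa>) \<le> 1"
      "4 * (2 * real n * \<theta>) * (K * exp (- (c * real n)) powr \<alpha>) \<le> 1" using elim(3,4) by linarith+
    then show ?case using elim(1,2) by simp
  qed
  then show ?thesis by (simp add: eventually_sequentially)
qed

text \<open>\<open>U\<close> is the smooth and \<open>V\<close> the rough part at each scale. The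
  bound sees the data only through \<open>n0\<close>, which is why the final constant is uniform in
  N and in the measure.\<close>

lemma exp_moment_multiscale:
  fixes w :: "'a \<Rightarrow> 'a \<Rightarrow> real" and U V :: "real \<Rightarrow> 'a \<Rightarrow> 'a \<Rightarrow> real"
  assumes "prob_space M" and space: "space M = UNIV" and N: "0 < N"
    and \<theta>: "0 < \<theta>" and C0: "0 < C0" and DK: "0 \<le> D" "0 \<le> K"
    and threshold: "\<And>n. n0 \<le> n \<Longrightarrow> 1 \<le> real n / 2 - \<theta> * C0 / 2 \<and>
      exp (- (1 / (\<theta> * C0) * real n)) < \<epsilon>0 \<and> exp (- (1 / (\<theta> * C0) * real n)) < 1 \<and>
      32 * (2 * real n * \<theta>) * sqrt (D * exp (- (1 / (\<theta> * C0) * real n)) powr \<kappa>) \<le> 1 \<and>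
      4 * (2 * real n * \<theta>) * (K * exp (- (1 / (\<theta> * C0) * real n)) powr \<alpha>) \<le> 1"
    and U_meas: "\<And>\<epsilon>. 0 < \<epsilon> \<Longrightarrow> \<epsilon> < 1 \<Longrightarrow> case_prod (U \<epsilon>) \<in> borel_measurable (M \<Otimes>\<^sub>M M)"
    and U_sym: "\<And>\<epsilon> x y. 0 < \<epsilon> \<Longrightarrow> \<epsilon> < 1 \<Longrightarrow> U \<epsilon> x y = U \<epsilon> y x"
    and U_int: "\<And>\<epsilon> x. 0 < \<epsilon> \<Longrightarrow> \<epsilon> < 1 \<Longrightarrow> integrable M (U \<epsilon> x)"
      "\<And>\<epsilon>. 0 < \<epsilon> \<Longrightarrow> \<epsilon> < 1 \<Longrightarrow> integrable (M \<Otimes>\<^sub>M M) (case_prod (U \<epsilon>))"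
    and U_diag: "\<And>\<epsilon> x. 0 < \<epsilon> \<Longrightarrow> \<epsilon> < 1 \<Longrightarrow> \<bar>U \<epsilon> x x\<bar> \<le> C0 * (\<bar>ln \<epsilon>\<bar> + 1)"
    and U_cpd: "\<And>\<epsilon> (I :: (nat \<times> nat) set) x y. 0 < \<epsilon> \<Longrightarrow> \<epsilon> < 1 \<Longrightarrow> finite I \<Longrightarrow>
      0 \<le> (\<Sum>p\<in>I. \<Sum>q\<in>I. U \<epsilon> (x p) (x q) + U \<epsilon> (y p) (y q) - (U \<epsilon> (x p) (y q) + U \<epsilon> (y p) (x q)))"
    and V_meas: "\<And>\<epsilon>. 0 < \<epsilon> \<Longrightarrow> \<epsilon> < 1 \<Longrightarrow> case_prod (V \<epsilon>) \<in> borel_measurable (M \<Otimes>\<^sub>M M)"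
    and V_sym: "\<And>\<epsilon> x y. 0 < \<epsilon> \<Longrightarrow> \<epsilon> < 1 \<Longrightarrow> V \<epsilon> x y = V \<epsilon> y x"
    and V_int: "\<And>\<epsilon> x. 0 < \<epsilon> \<Longrightarrow> \<epsilon> < 1 \<Longrightarrow> integrable M (\<lambda>y. (V \<epsilon> x y)\<^sup>2)"
    and V_sq: "\<And>\<epsilon> x. 0 < \<epsilon> \<Longrightarrow> \<epsilon> < 1 \<Longrightarrow> (\<integral>y. (V \<epsilon> x y)\<^sup>2 \<partial>M) \<le> D * \<epsilon> powr \<kappa>"
    and V_lower: "\<And>\<epsilon> x y. 0 < \<epsilon> \<Longrightarrow> \<epsilon> < \<epsilon>0 \<Longrightarrow> \<epsilon> < 1 \<Longrightarrow> - (K * \<epsilon> powr \<alpha>) \<le> V \<epsilon> x y"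
    and split: "\<And>\<epsilon>. 0 < \<epsilon> \<Longrightarrow> \<epsilon> < 1 \<Longrightarrow>
      AE x in Pi\<^sub>M {..<N} (\<lambda>_. M). energy N M w x = energy N M (U \<epsilon>) x + energy N M (V \<epsilon>) x"
  shows "(\<integral>\<^sup>+x. ennreal (exp (- \<theta> * energy N M w x)) \<partial>Pi\<^sub>M {..<N} (\<lambda>_. M))
    \<le> ennreal (exp (real n0) + exp 3 / (1 - exp (- 1)))"
proof -
  interpret prob_space M by fact
  interpret P: prob_space "Pi\<^sub>M {..<N} (\<lambda>_. M)" by (intro prob_space_PiM prob_space_axioms)
  \<comment> \<open>The rate makes C0 times the absolute value of the logarithm equal to n /
    \<theta>, so that the logarithmic part of the smooth energy costs exactly n / 2 after
    multiplication by \<theta>.\<close>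
  define \<epsilon> where "\<epsilon> n = exp (- (1 / (\<theta> * C0) * real n))" for n
  have th: "1 \<le> real n / 2 - \<theta> * C0 / 2" "\<epsilon> n < \<epsilon>0" "\<epsilon> n < 1"
      "32 * (2 * real n * \<theta>) * sqrt (D * \<epsilon> n powr \<kappa>) \<le> 1"
      "4 * (2 * real n * \<theta>) * (K * \<epsilon> n powr \<alpha>) \<le> 1" if "n0 \<le> n" for n
    using threshold[OF that] by (simp_all add: \<epsilon>_def)
  have \<epsilon>_pos: "0 < \<epsilon> n" for n by (simp add: \<epsilon>_def)
  have V_energy_meas: "energy N M (V (\<epsilon> n)) \<in> borel_measurable (Pi\<^sub>M {..<N} (\<lambda>_. M))" if "n0 \<le> n" for n
    using prob_space_axioms V_meas[OF \<epsilon>_pos th(3)[OF that]] by (rule measurable_energy)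
  \<comment> \<open>Terms before \<open>n0\<close> are switched off; where the exponent lies below
    \<open>n0\<close>, the constant exp n0 takes over.\<close>
  define T where "T n x = (if n0 \<le> n then
      ennreal (exp (1 - real n)) * ennreal (exp (- (2 * real n * \<theta>) * energy N M (V (\<epsilon> n)) x)) else 0)" for n x
  have T_meas: "T n \<in> borel_measurable (Pi\<^sub>M {..<N} (\<lambda>_. M))" for n
    using V_energy_meas[of n] unfolding T_def by (cases "n0 \<le> n") simp_all
  have T_int: "(\<integral>\<^sup>+x. T n x \<partial>Pi\<^sub>M {..<N} (\<lambda>_. M)) \<le> ennreal (exp 3 * exp (- 1) ^ n)" for n
  proof (cases "n0 \<le> n")
    case True
    note e = \<epsilon>_pos[of n] th(3)[OF True]
    have "(\<integral>\<^sup>+x. T n x \<partial>Pi\<^sub>M {..<N} (\<lambda>_. M)) = ennreal (exp (1 - real n)) *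
       (\<integral>\<^sup>+x. ennreal (exp (- (2 * real n * \<theta>) * energy N M (V (\<epsilon> n)) x)) \<partial>Pi\<^sub>M {..<N} (\<lambda>_. M))"
      using True V_energy_meas[OF True] by (simp add: T_def nn_integral_cmult)
    also have "\<dots> \<le> ennreal (exp (1 - real n)) * ennreal (exp 2)"
    proof (intro mult_left_mono exp_moment_energy[where \<sigma>="sqrt (D * \<epsilon> n powr \<kappa>)" and \<delta>="K * \<epsilon> n powr \<alpha>"])
      show "(\<integral>y. (V (\<epsilon> n) x y)\<^sup>2 \<partial>M) \<le> (sqrt (D * \<epsilon> n powr \<kappa>))\<^sup>2" for x
        using V_sq[OF e, of x] DK by simp
    qed (use prob_space_axioms space V_meas[OF e] V_sym[OF e] V_int[OF e] V_lower[OF e(1) th(2)[OF True] e(2)]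
          DK N \<theta> th(4,5)[OF True] in auto)
    also have "\<dots> = ennreal (exp 3 * exp (- 1) ^ n)"
      by (simp add: ennreal_mult[symmetric] exp_add[symmetric] exp_of_nat_mult[symmetric])
    finally show ?thesis .
  qed (simp add: T_def)
  \<comment> \<open>Since the scale will be selected by the configuration, one null set must serve
    all scales; there are only countably many.\<close>
  have AE_split: "AE x in Pi\<^sub>M {..<N} (\<lambda>_. M). \<forall>n. n0 \<le> n \<longrightarrow>
      energy N M w x = energy N M (U (\<epsilon> n)) x + energy N M (V (\<epsilon> n)) x"
    unfolding AE_all_countable using split[OF \<epsilon>_pos th(3)] by (metis (mono_tags, lifting) AE_I2 AE_mp)
  have "(\<integral>\<^sup>+x. ennreal (exp (- \<theta> * energy N M w x)) \<partial>Pi\<^sub>M {..<N} (\<lambda>_. M))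
    \<le> (\<integral>\<^sup>+x. ennreal (exp (real n0)) + (\<Sum>n. T n x) \<partial>Pi\<^sub>M {..<N} (\<lambda>_. M))"
  proof (rule nn_integral_mono_AE)
    show "AE x in Pi\<^sub>M {..<N} (\<lambda>_. M). ennreal (exp (- \<theta> * energy N M w x)) \<le> ennreal (exp (real n0)) + (\<Sum>n. T n x)"
      using AE_split
    proof eventually_elim
      case (elim x)
      define X where "X = - \<theta> * energy N M w x"
      show ?case
      proof (cases "X < real n0")
        case True
        then have "ennreal (exp X) \<le> ennreal (exp (real n0))" by (intro ennreal_leI) simp
        then show ?thesis unfolding X_def by (intro add_increasing2) auto
      next
        case False
        define n where "n = nat \<lfloor>X\<rfloor>"
        have n: "real n \<le> X" "X < real n + 1" "n0 \<le> n"
          using False by (auto simp: n_def le_nat_iff le_floor_iff)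
        note e = \<epsilon>_pos[of n] th(3)[OF n(3)]
        define Y where "Y = - \<theta> * energy N M (V (\<epsilon> n)) x"
        have "- (C0 * (\<bar>ln (\<epsilon> n)\<bar> + 1)) / 2 \<le> energy N M (U (\<epsilon> n)) x"
          by (rule energy_ge_of_conditionally_positive)
             (use prob_space_axioms space U_meas[OF e] U_sym[OF e] U_int[OF e(1,2)] U_diag[OF e] U_cpd[OF e] N in auto)
        also have "\<bar>ln (\<epsilon> n)\<bar> = real n / (\<theta> * C0)" using \<theta> C0 by (simp add: \<epsilon>_def)
        finally have "\<theta> * (- (C0 * (real n / (\<theta> * C0) + 1)) / 2) \<le> \<theta> * energy N M (U (\<epsilon> n)) x"
          using \<theta> by (intro mult_left_mono) auto
        moreover have "\<theta> * (- (C0 * (real n / (\<theta> * C0) + 1)) / 2) = - (real n / 2 + \<theta> * C0 / 2)"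
          using \<theta> C0 by (simp add: field_simps)
        ultimately have "- (real n / 2 + \<theta> * C0 / 2) \<le> \<theta> * energy N M (U (\<epsilon> n)) x"
          by simp
        moreover have "X = - (\<theta> * energy N M (U (\<epsilon> n)) x) + Y"
          using elim n(3) by (simp add: X_def Y_def algebra_simps)
        ultimately have Y: "1 \<le> Y" using n(1) th(1)[OF n(3)] by linarith
        \<comment> \<open>Exponential Chebyshev carried out pointwise: X < n + 1 = (1 - n) + 2 n,
          and 2 n is multiplied by \<open>Y\<close>, which is at least 1.\<close>
        have "X \<le> 1 - real n + 2 * real n * Y"
          using n(2) mult_left_mono[OF Y, of "2 * real n"] by simp
        then have "ennreal (exp X) \<le> T n x"
          using n(3) by (simp add: T_def Y_def ennreal_mult[symmetric] exp_add[symmetric] mult_ac)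
        also have "T n x \<le> (\<Sum>n. T n x)"
          using sum_le_suminf[of "\<lambda>n. T n x" "{n}"] by simp
        finally show ?thesis unfolding X_def by (intro add_increasing) auto
      qed
    qed
  qed
  also have "\<dots> = ennreal (exp (real n0)) + (\<Sum>n. \<integral>\<^sup>+x. T n x \<partial>Pi\<^sub>M {..<N} (\<lambda>_. M))"
    using T_meas by (subst nn_integral_add) (simp_all add: nn_integral_suminf P.emeasure_space_1)
  also have "\<dots> \<le> ennreal (exp (real n0)) + (\<Sum>n. ennreal (exp 3 * exp (- 1) ^ n))"
    by (intro add_left_mono suminf_le T_int) auto
  also have "(\<Sum>n. ennreal (exp 3 * exp (- 1) ^ n)) = ennreal (exp 3 * (1 / (1 - exp (- 1))))"
    by (intro suminf_ennreal_eq sums_mult geometric_sums) auto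
  also have "ennreal (exp (real n0)) + \<dots> = ennreal (exp (real n0) + exp 3 / (1 - exp (- 1)))"
    by (subst ennreal_plus) auto
  finally show ?thesis .
qed

section \<open>The Gibbs variational principle\<close>

lemma eintegral_integrable:
  assumes "integrable M f"
  shows "eintegral M (\<lambda>x. ereal (f x)) = ereal (\<integral>x. f x \<partial>M)"
proof -
  have "(\<integral>\<^sup>+x. ennreal (f x) \<partial>M) < \<infinity>" "(\<integral>\<^sup>+x. ennreal (- f x) \<partial>M) < \<infinity>"
    using assms by (auto simp: real_integrable_def less_top)
  then show ?thesis
    using real_lebesgue_integral_def[OF assms] 
    by (cases "\<integral>\<^sup>+x. ennreal (f x) \<partial>M"; cases "\<integral>\<^sup>+x. ennreal (- f x) \<partial>M")
       (simp_all add: eintegral_def enn2ereal_ennreal)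
qed

lemma eintegral_eq_PInf:
  assumes "(\<integral>\<^sup>+x. e2ennreal (f x) \<partial>M) = \<infinity>"
  shows "eintegral M f = \<infinity>"
  using assms by (simp add: eintegral_def)

text \<open>The tangent inequality 1 + u <= exp u at u = - \<theta> F - ln f - ln K, with f the
  density of \<mu>, is integrated against \<mu>; the exponential becomes q / K, whose mean is at
  most 1. The remaining work is to ensure that the integrals exist or that the claim is
  trivial.\<close>

lemma Gibbs_variational_bound:
  fixes F :: "'a \<Rightarrow> real"
  assumes "prob_space \<nu>" "prob_space \<mu>" and sets_eq: "sets \<mu> = sets \<nu>"
    and F [measurable]: "F \<in> borel_measurable \<nu>"
    and \<theta>: "0 < \<theta>" and K: "0 < K"
    and exp_moment: "(\<integral>\<^sup>+x. ennreal (exp (- \<theta> * F x)) \<partial>\<nu>) \<le> ennreal K"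
  shows "- (ereal \<theta> * eintegral \<mu> (\<lambda>x. ereal (F x))) \<le> relative_entropy \<mu> \<nu> + ereal (ln K)"
proof (cases "absolutely_continuous \<nu> \<mu>")
  case False
  then show ?thesis by (simp add: relative_entropy_def)
next
  case True
  interpret N: prob_space \<nu> by fact
  interpret M: prob_space \<mu> by fact
  have [measurable_cong]: "sets \<mu> = sets \<nu>" by fact
  define f where "f x = enn2real (RN_deriv \<nu> \<mu> x)" for x
  have [measurable]: "f \<in> borel_measurable \<nu>" unfolding f_def by measurable
  have density: "density \<nu> (RN_deriv \<nu> \<mu>) = \<mu>"
    by (rule N.density_RN_deriv[OF True sets_eq])
  have fin: "AE x in \<nu>. RN_deriv \<nu> \<mu> x \<noteq> \<infinity>"
    by (rule N.RN_deriv_finite[OF _ True sets_eq]) unfold_locales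
  then have fin': "AE x in \<mu>. RN_deriv \<nu> \<mu> x \<noteq> \<infinity>"
    by (subst density[symmetric]) (auto simp: AE_density)
  have f_pos: "AE x in \<mu>. 0 < f x"
  proof -
    have "AE x in density \<nu> (RN_deriv \<nu> \<mu>). 0 < RN_deriv \<nu> \<mu> x"
      by (simp add: AE_density)
    then show ?thesis
      using fin' unfolding density by eventually_elim (simp add: f_def enn2real_positive_iff less_top)
  qed
  \<comment> \<open>Only an inequality, because \<nu> may charge the set where the density vanishes
    whereas \<mu> does not.\<close>
  have quot: "(\<integral>\<^sup>+x. ennreal (exp (g x) / f x) \<partial>\<mu>) \<le> (\<integral>\<^sup>+x. ennreal (exp (g x)) \<partial>\<nu>)"
    if [measurable]: "g \<in> borel_measurable \<nu>" for g
  proof -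
    have "(\<integral>\<^sup>+x. ennreal (exp (g x) / f x) \<partial>\<mu>) = (\<integral>\<^sup>+x. RN_deriv \<nu> \<mu> x * ennreal (exp (g x) / f x) \<partial>\<nu>)"
      by (subst density[symmetric], subst nn_integral_density) simp_all
    also have "\<dots> \<le> (\<integral>\<^sup>+x. ennreal (exp (g x)) \<partial>\<nu>)"
    proof (rule nn_integral_mono_AE)
      show "AE x in \<nu>. RN_deriv \<nu> \<mu> x * ennreal (exp (g x) / f x) \<le> ennreal (exp (g x))"
        using fin
      proof eventually_elim
        case (elim x)
        then have "RN_deriv \<nu> \<mu> x = ennreal (f x)" by (simp add: f_def less_top)
        moreover have "f x \<ge> 0" by (simp add: f_def)
        ultimately show ?case by (simp add: ennreal_mult[symmetric])
      qed
    qed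
    finally show ?thesis .
  qed
  define q where "q x = exp (- \<theta> * F x) / f x" for x
  have f_nonneg: "0 \<le> f x" for x by (simp add: f_def)
  then have q_nonneg: "0 \<le> q x" for x by (simp add: q_def)
  have [measurable]: "q \<in> borel_measurable \<nu>" unfolding q_def by measurable
  have q_le: "(\<integral>\<^sup>+x. ennreal (q x) \<partial>\<mu>) \<le> ennreal K"
    using quot[of "\<lambda>x. - \<theta> * F x"] exp_moment unfolding q_def by simp
  then have q_int: "integrable \<mu> q"
    using q_nonneg by (intro integrableI_nonneg) (auto intro: le_less_trans)
  have q_K: "(\<integral>x. q x \<partial>\<mu>) \<le> K"
  proof -
    have "ennreal (\<integral>x. q x \<partial>\<mu>) \<le> ennreal K"
      using q_le q_int q_nonneg by (subst nn_integral_eq_integral[symmetric]) auto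
    then show ?thesis using K by (simp add: ennreal_le_iff)
  qed
  have ent: "relative_entropy \<mu> \<nu> = eintegral \<mu> (\<lambda>x. ereal (ln (f x)))"
    using True by (simp add: relative_entropy_def f_def)
  show ?thesis
  proof (cases "(\<integral>\<^sup>+x. ennreal (ln (f x)) \<partial>\<mu>) = \<infinity>")
    case True
    then have "relative_entropy \<mu> \<nu> = \<infinity>" unfolding ent by (intro eintegral_eq_PInf) simp
    then show ?thesis by simp
  next
    case False
    \<comment> \<open>The negative part of the entropy is always integrable: - ln f <= 1 / f, and 1
      / f has \<mu>-mean at most 1.\<close>
    have "(\<integral>\<^sup>+x. ennreal (- ln (f x)) \<partial>\<mu>) \<le> (\<integral>\<^sup>+x. ennreal (exp 0 / f x) \<partial>\<mu>)"
    proof (rule nn_integral_mono_AE)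
      show "AE x in \<mu>. ennreal (- ln (f x)) \<le> ennreal (exp 0 / f x)"
        using f_pos
      proof eventually_elim
        case (elim x)
        then have "- ln (f x) \<le> exp 0 / f x"
          using ln_le_minus_one[of "1 / f x"] by (simp add: ln_div)
        then show ?case by (rule ennreal_leI)
      qed
    qed
    also have "\<dots> \<le> (\<integral>\<^sup>+x. ennreal (exp 0) \<partial>\<nu>)" by (rule quot) simp
    also have "\<dots> < \<infinity>" by (simp add: N.emeasure_space_1)
    finally have ln_int: "integrable \<mu> (\<lambda>x. ln (f x))"
      using False by (simp add: real_integrable_def)
    \<comment> \<open>\<open>c\<close> stays free: c = 1 yields integrability of the negative part
      of \<open>F\<close>, and c = K the final bound.\<close>
    have key: "- \<theta> * F x \<le> ln (f x) + ln c + q x / c - 1" if "0 < f x" "0 < c" for x c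
    proof -
      have "1 + (- \<theta> * F x - ln (f x) - ln c) \<le> exp (- \<theta> * F x - ln (f x) - ln c)"
        by (rule exp_ge_add_one_self)
      also have "\<dots> = q x / c" using that by (simp add: q_def exp_diff)
      finally show ?thesis by simp
    qed
    show ?thesis
    proof (cases "(\<integral>\<^sup>+x. ennreal (F x) \<partial>\<mu>) = \<infinity>")
      case True
      then have "eintegral \<mu> (\<lambda>x. ereal (F x)) = \<infinity>" by (intro eintegral_eq_PInf) simp
      then show ?thesis using \<theta> by simp
    next
      case False
      have "(\<integral>\<^sup>+x. ennreal (- F x) \<partial>\<mu>) \<le> (\<integral>\<^sup>+x. ennreal ((\<bar>ln (f x)\<bar> + q x) / \<theta>) \<partial>\<mu>)"
      proof (rule nn_integral_mono_AE)
        show "AE x in \<mu>. ennreal (- F x) \<le> ennreal ((\<bar>ln (f x)\<bar> + q x) / \<theta>)"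
          using f_pos
        proof eventually_elim
          case (elim x)
          then have "- F x \<le> (\<bar>ln (f x)\<bar> + q x) / \<theta>"
            using key[of x 1] \<theta> by (simp add: field_simps)
          then show ?case by (rule ennreal_leI)
        qed
      qed
      also have "\<dots> < \<infinity>"
      proof -
        have "integrable \<mu> (\<lambda>x. (\<bar>ln (f x)\<bar> + q x) / \<theta>)" using ln_int q_int by simp
        then show ?thesis by (simp add: real_integrable_def less_top)
      qed
      finally have F_int: "integrable \<mu> F" using False by (simp add: real_integrable_def)
      have "- \<theta> * (\<integral>x. F x \<partial>\<mu>) = (\<integral>x. - \<theta> * F x \<partial>\<mu>)" by simp
      also have "\<dots> \<le> (\<integral>x. ln (f x) + ln K + q x / K - 1 \<partial>\<mu>)"
        using F_int ln_int q_int f_pos key K by (intro integral_mono_AE) (auto elim: AE_mp)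
      also have "\<dots> = (\<integral>x. ln (f x) \<partial>\<mu>) + ln K + (\<integral>x. q x \<partial>\<mu>) / K - 1"
        using ln_int q_int by (simp add: M.prob_space)
      also have "\<dots> \<le> (\<integral>x. ln (f x) \<partial>\<mu>) + ln K"
        using q_K K by simp
      finally show ?thesis
        unfolding ent eintegral_integrable[OF F_int] eintegral_integrable[OF ln_int] by simp
    qed
  qed
qed

section \<open>A rate that is uniform over densities\<close>

text \<open>If the rates of \<open>\<rho>\<^sub>n\<close> at scales \<open>\<epsilon>\<^sub>n\<close> were worse than \<open>n \<epsilon>\<^sub>n\<^bsup>1/n\<^esup>\<close>, then \<open>\<epsilon>\<^sub>n \<le> (C / n)\<^sup>n\<close>, which beats
  the weights \<open>2\<^bsup>-n\<^esup>\<close>, and the mixture of the \<open>\<rho>\<^sub>n\<close> would have no rate at all.\<close>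

lemma uniform_rate_over_densities:
  fixes L :: "'a::topological_space measure" and g :: "real \<Rightarrow> 'a \<Rightarrow> 'a \<Rightarrow> ennreal"
  assumes "sigma_finite_measure L" and sets_L: "sets L = sets borel"
    and g [measurable]: "\<And>\<epsilon> x. g \<epsilon> x \<in> borel_measurable borel"
    and rate: "\<And>\<rho>. borel_probability \<rho> \<Longrightarrow> bounded_density L \<rho> \<Longrightarrow>
      \<exists>\<kappa>>0. \<forall>\<epsilon>>0. (SUP x. \<integral>\<^sup>+y. g \<epsilon> x y \<partial>\<rho>) < ennreal (C (density_norm L \<rho>) * \<epsilon> powr \<kappa>)"
  shows "\<exists>\<kappa>>0. \<exists>D\<ge>0. \<forall>\<rho>. borel_probability \<rho> \<longrightarrow> bounded_density L \<rho> \<longrightarrow> density_norm L \<rho> = m \<longrightarrow>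
    (\<forall>\<epsilon> x. 0 < \<epsilon> \<longrightarrow> \<epsilon> < 1 \<longrightarrow> (\<integral>\<^sup>+y. g \<epsilon> x y \<partial>\<rho>) \<le> ennreal (D * \<epsilon> powr \<kappa>))"
proof (rule ccontr)
  assume "\<not> ?thesis"
  then have *: "\<exists>\<rho> \<epsilon> x. borel_probability \<rho> \<and> bounded_density L \<rho> \<and> density_norm L \<rho> = m \<and> 0 < \<epsilon> \<and> \<epsilon> < 1
      \<and> ennreal (D * \<epsilon> powr \<kappa>) < (\<integral>\<^sup>+y. g \<epsilon> x y \<partial>\<rho>)" if "0 < \<kappa>" "0 \<le> D" for \<kappa> D
    using that by (meson not_le)
  have "\<forall>n. \<exists>\<rho> \<epsilon> x. borel_probability \<rho> \<and> bounded_density L \<rho> \<and> density_norm L \<rho> = m \<and> 0 < \<epsilon> \<and> \<epsilon> < 1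
      \<and> ennreal (real (Suc n) * \<epsilon> powr (1 / real (Suc n))) < (\<integral>\<^sup>+y. g \<epsilon> x y \<partial>\<rho>)"
    by (intro allI *) auto
  then obtain \<rho> \<epsilon> x where \<rho>: "\<And>n. borel_probability (\<rho> n)" "\<And>n. bounded_density L (\<rho> n)"
      "\<And>n. density_norm L (\<rho> n) = m"
    and \<epsilon>: "\<And>n. 0 < \<epsilon> n" "\<And>n. \<epsilon> n < 1"
    and large: "\<And>n. ennreal (real (Suc n) * \<epsilon> n powr (1 / real (Suc n))) < (\<integral>\<^sup>+y. g (\<epsilon> n) (x n) y \<partial>\<rho> n)"
    by metis
  interpret L: sigma_finite_measure L by fact
  have [measurable_cong]: "sets L = sets borel" by fact
  have sets_\<rho> [measurable_cong]: "sets (\<rho> n) = sets L" for n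
    using \<rho>(1)[of n] sets_L by (simp add: borel_probability_def)
  have ac: "absolutely_continuous L (\<rho> n)" for n using \<rho>(2) by (simp add: bounded_density_def)
  have m: "m < \<infinity>" using \<rho>(2,3)[of 0] by (simp add: bounded_density_def)
  define w where "w n = ennreal ((1 / 2) ^ Suc n)" for n
  have w_sum: "(\<Sum>n. w n) = 1"
    unfolding w_def by (subst suminf_ennreal_eq[OF _ power_half_series]) auto
  define f where "f y = (\<Sum>n. w n * RN_deriv L (\<rho> n) y)" for y
  have f_meas [measurable]: "f \<in> borel_measurable L" unfolding f_def by measurable
  define R where "R = density L f"
  have int_R: "(\<integral>\<^sup>+y. G y \<partial>R) = (\<Sum>n. w n * (\<integral>\<^sup>+y. G y \<partial>\<rho> n))"
    if [measurable]: "G \<in> borel_measurable L" for G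
  proof -
    have "(\<integral>\<^sup>+y. G y \<partial>R) = (\<integral>\<^sup>+y. (\<Sum>n. w n * (RN_deriv L (\<rho> n) y * G y)) \<partial>L)"
      unfolding R_def by (subst nn_integral_density) (simp_all add: f_def mult.assoc[symmetric] ennreal_suminf_multc)
    also have "\<dots> = (\<Sum>n. w n * (\<integral>\<^sup>+y. RN_deriv L (\<rho> n) y * G y \<partial>L))"
      by (simp add: nn_integral_suminf nn_integral_cmult)
    also have "\<dots> = (\<Sum>n. w n * (\<integral>\<^sup>+y. G y \<partial>\<rho> n))"
      by (simp add: L.RN_deriv_nn_integral[OF ac sets_\<rho>])
    finally show ?thesis .
  qed
  have R_prob: "borel_probability R"
  proof -
    have "emeasure R (space R) = (\<integral>\<^sup>+y. 1 \<partial>R)" by simp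
    also have "\<dots> = (\<Sum>n. w n * (\<integral>\<^sup>+y. 1 \<partial>\<rho> n))" by (rule int_R) simp
    also have "\<dots> = 1"
      using \<rho>(1) w_sum by (simp add: borel_probability_def prob_space.emeasure_space_1)
    finally show ?thesis
      by (simp add: borel_probability_def prob_spaceI) (simp add: R_def sets_L)
  qed
  have f_le: "AE y in L. f y \<le> m"
  proof -
    have "AE y in L. \<forall>n. RN_deriv L (\<rho> n) y \<le> m"
      using \<rho>(3) esssup_AE[of "RN_deriv L (\<rho> n)" L for n] by (simp add: AE_all_countable density_norm_def)
    then show ?thesis
    proof eventually_elim
      case (elim y)
      then have "f y \<le> (\<Sum>n. w n * m)"
        unfolding f_def by (intro suminf_le mult_left_mono) auto
      then show ?case using w_sum by simp
    qed
  qed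
  have "AE y in L. f y = RN_deriv L R y"
    by (rule L.RN_deriv_unique) (simp_all add: R_def)
  with f_le have "AE y in L. RN_deriv L R y \<le> m" by eventually_elim simp
  then have "density_norm L R \<le> m" unfolding density_norm_def by (intro esssup_I) auto
  with m have R_bd: "bounded_density L R"
    using absolutely_continuousI_density[of f L] f_meas
    by (auto simp: bounded_density_def R_def intro: le_less_trans)
  obtain \<kappa> where \<kappa>: "0 < \<kappa>"
    and R_rate: "\<And>\<epsilon>. 0 < \<epsilon> \<Longrightarrow> (SUP x. \<integral>\<^sup>+y. g \<epsilon> x y \<partial>R) < ennreal (C (density_norm L R) * \<epsilon> powr \<kappa>)"
    using rate[OF R_prob R_bd] by blast
  \<comment> \<open>Two constants, because all the \<open>\<rho> n\<close> share the norm m, while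
    the norm of the mixture \<open>R\<close> is only known to be at most m.\<close>
  define C1 C2 where "C1 = C m" "C2 = C (density_norm L R)"
  have bound1: "real (Suc n) * \<epsilon> n powr (1 / real (Suc n)) < C1" for n
  proof -
    obtain k where k: "0 < k" "(SUP x. \<integral>\<^sup>+y. g (\<epsilon> n) x y \<partial>\<rho> n) < ennreal (C1 * \<epsilon> n powr k)"
      using rate[OF \<rho>(1,2), of n] \<epsilon>(1) \<rho>(3) unfolding C1_C2_def by metis
    have "(\<integral>\<^sup>+y. g (\<epsilon> n) (x n) y \<partial>\<rho> n) \<le> (SUP x. \<integral>\<^sup>+y. g (\<epsilon> n) x y \<partial>\<rho> n)" by (rule SUP_upper) simp
    with large[of n] k(2) have "ennreal (real (Suc n) * \<epsilon> n powr (1 / real (Suc n))) < ennreal (C1 * \<epsilon> n powr k)"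
      by order
    then have *: "real (Suc n) * \<epsilon> n powr (1 / real (Suc n)) < C1 * \<epsilon> n powr k"
      by (subst (asm) ennreal_less_iff) auto
    moreover have "0 < real (Suc n) * \<epsilon> n powr (1 / real (Suc n))" using \<epsilon>(1)[of n] by simp
    ultimately have "0 < C1 * \<epsilon> n powr k" by linarith
    then have "0 < C1" by (simp add: zero_less_mult_iff not_less)
    moreover have "\<epsilon> n powr k \<le> 1" using \<epsilon>[of n] k by (intro powr_le1) auto
    ultimately have "C1 * \<epsilon> n powr k \<le> C1" by (simp add: mult_left_le)
    with * show ?thesis by simp
  qed
  have bound2: "real (Suc n) * \<epsilon> n powr (1 / real (Suc n)) < 2 ^ Suc n * C2 * \<epsilon> n powr \<kappa>" for n
  proof -
    have "w n * (\<integral>\<^sup>+y. g (\<epsilon> n) (x n) y \<partial>\<rho> n) \<le> (\<integral>\<^sup>+y. g (\<epsilon> n) (x n) y \<partial>R)"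
      using ennreal_suminf_lessD[of "\<lambda>k. w k * (\<integral>\<^sup>+y. g (\<epsilon> n) (x n) y \<partial>\<rho> k)" _ n]
      by (subst int_R) (auto simp: not_less[symmetric])
    also have "\<dots> \<le> (SUP x. \<integral>\<^sup>+y. g (\<epsilon> n) x y \<partial>R)" by (rule SUP_upper) simp
    also have "\<dots> < ennreal (C2 * \<epsilon> n powr \<kappa>)" using R_rate[OF \<epsilon>(1)[of n]] by (simp add: C1_C2_def)
    finally have "w n * (\<integral>\<^sup>+y. g (\<epsilon> n) (x n) y \<partial>\<rho> n) < ennreal (C2 * \<epsilon> n powr \<kappa>)" .
    moreover have "w n * ennreal (real (Suc n) * \<epsilon> n powr (1 / real (Suc n))) \<le> w n * (\<integral>\<^sup>+y. g (\<epsilon> n) (x n) y \<partial>\<rho> n)"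
      using large[of n] by (intro mult_left_mono) auto
    ultimately have "w n * ennreal (real (Suc n) * \<epsilon> n powr (1 / real (Suc n))) < ennreal (C2 * \<epsilon> n powr \<kappa>)"
      by order
    then have "(1 / 2) ^ Suc n * (real (Suc n) * \<epsilon> n powr (1 / real (Suc n))) < C2 * \<epsilon> n powr \<kappa>"
      unfolding w_def by (subst (asm) ennreal_mult[symmetric]) (auto simp: ennreal_less_iff)
    then show ?thesis by (simp add: power_divide field_simps)
  qed
  have C1: "0 < C1" using bound1[of 0] \<epsilon>(1)[of 0] by (simp add: less_trans)
  have C2: "0 < C2"
  proof -
    have "0 < 2 ^ Suc 0 * C2 * \<epsilon> 0 powr \<kappa>" using bound2[of 0] \<epsilon>(1)[of 0] by (simp add: less_trans)
    then show ?thesis by (simp add: zero_less_mult_iff)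
  qed
  \<comment> \<open>For k = n + 1 and e = \<open>\<epsilon> n\<close> powr (1 / k), the first
    condition gives k \<kappa> - 1 >= k \<kappa> / 2, the second gives e <= 2 powr (- (2 /
    \<kappa>)), so that e powr (k \<kappa> / 2) absorbs the inverse weight 2^k, and the third
    contradicts the resulting k e < C2 e.\<close>
  obtain n :: nat where n: "real (Suc n) \<ge> 2 / \<kappa>" "real (Suc n) \<ge> C1 * 2 powr (2 / \<kappa>)" "real (Suc n) \<ge> C2"
  proof -
    obtain n :: nat where "max (2 / \<kappa>) (max (C1 * 2 powr (2 / \<kappa>)) C2) < real n" using reals_Archimedean2 by blast
    then show ?thesis by (intro that[of n]) auto
  qed
  define k where "k = real (Suc n)"
  have k: "0 < k" "2 / \<kappa> \<le> k" "C1 * 2 powr (2 / \<kappa>) \<le> k" "C2 \<le> k" using n by (auto simp: k_def)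
  define e where "e = \<epsilon> n powr (1 / k)"
  have e: "0 < e" "e \<le> 1" using \<epsilon>[of n] k by (auto simp: e_def intro!: powr_le1)
  have "e \<le> C1 / k" using bound1[of n] k by (simp add: e_def k_def field_simps)
  also have "\<dots> \<le> 2 powr (- (2 / \<kappa>))" using k by (simp add: field_simps powr_minus)
  finally have e_le: "e \<le> 2 powr (- (2 / \<kappa>))" .
  have "2 ^ Suc n = 2 powr k" unfolding k_def by (subst powr_realpow) auto
  moreover have "\<epsilon> n powr \<kappa> = e powr (k * \<kappa>)" using k by (simp add: e_def powr_powr)
  ultimately have "k * e < 2 powr k * C2 * e powr (k * \<kappa>)"
    using bound2[of n] by (simp add: e_def k_def)
  also have "\<dots> = C2 * e * (2 powr k * e powr (k * \<kappa> - 1))"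
    using e by (simp add: powr_diff)
  also have "\<dots> \<le> C2 * e * 1"
  proof (intro mult_left_mono)
    have "e powr (k * \<kappa> - 1) \<le> e powr (k * \<kappa> / 2)"
      using e k \<kappa> by (intro powr_mono') (auto simp: field_simps)
    also have "\<dots> \<le> (2 powr (- (2 / \<kappa>))) powr (k * \<kappa> / 2)"
      using e e_le k \<kappa> by (intro powr_mono2) auto
    also have "\<dots> = 2 powr (- k)" using \<kappa> by (simp add: powr_powr)
    finally have "2 powr k * e powr (k * \<kappa> - 1) \<le> 2 powr k * 2 powr (- k)" by (intro mult_left_mono) auto
    then show "2 powr k * e powr (k * \<kappa> - 1) \<le> 1" by (simp add: powr_minus)
  qed (use C2 e in auto)
  finally show False using k e by simp
qed

section \<open>The energy of the fluctuation measure\<close>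

lemma eabs_integrable_imp:
  assumes "eabs_integrable M f" and [measurable]: "f \<in> borel_measurable M"
  shows "AE x in M. \<bar>f x\<bar> \<noteq> \<infinity>" and "integrable M (\<lambda>x. real_of_ereal (f x))"
proof -
  have "AE x in M. e2ennreal \<bar>f x\<bar> \<noteq> \<infinity>"
    using assms(1) by (intro nn_integral_PInf_AE) (auto simp: eabs_integrable_def)
  then show "AE x in M. \<bar>f x\<bar> \<noteq> \<infinity>" by eventually_elim auto
  have "ennreal (norm (real_of_ereal (f x))) \<le> e2ennreal \<bar>f x\<bar>" for x
    by (cases "f x") auto
  then have "(\<integral>\<^sup>+x. ennreal (norm (real_of_ereal (f x))) \<partial>M) \<le> (\<integral>\<^sup>+x. e2ennreal \<bar>f x\<bar> \<partial>M)"
    by (intro nn_integral_mono)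
  also have "\<dots> < \<infinity>" using assms(1) by (simp add: eabs_integrable_def)
  finally show "integrable M (\<lambda>x. real_of_ereal (f x))" by (intro integrableI_bounded) auto
qed

lemma nn_integral_scaled_pair:
  assumes "finite_measure \<mu>" "finite_measure \<nu>" and [measurable]: "f \<in> borel_measurable (\<mu> \<Otimes>\<^sub>M \<nu>)"
  shows "(\<integral>\<^sup>+z. f z \<partial>(scale_measure (ennreal a) \<mu> \<Otimes>\<^sub>M scale_measure (ennreal b) \<nu>))
    = ennreal a * ennreal b * (\<integral>\<^sup>+z. f z \<partial>(\<mu> \<Otimes>\<^sub>M \<nu>))"
proof -
  interpret M: finite_measure \<mu> by fact
  interpret N: finite_measure \<nu> by fact
  interpret N': finite_measure "scale_measure (ennreal b) \<nu>"
    by (rule finite_measureI) (simp add: space_scale_measure ennreal_mult_eq_top_iff)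
  have "(\<integral>\<^sup>+z. f z \<partial>(scale_measure (ennreal a) \<mu> \<Otimes>\<^sub>M scale_measure (ennreal b) \<nu>))
      = (\<integral>\<^sup>+x. \<integral>\<^sup>+y. f (x, y) \<partial>scale_measure (ennreal b) \<nu> \<partial>scale_measure (ennreal a) \<mu>)"
    by (rule N'.nn_integral_fst[symmetric]) simp
  also have "\<dots> = ennreal a * (\<integral>\<^sup>+x. ennreal b * (\<integral>\<^sup>+y. f (x, y) \<partial>\<nu>) \<partial>\<mu>)"
    by (subst nn_integral_scale_measure, measurable)
       (auto intro!: arg_cong2[where f="(*)"] nn_integral_cong nn_integral_scale_measure)
  also have "\<dots> = ennreal a * ennreal b * (\<integral>\<^sup>+x. \<integral>\<^sup>+y. f (x, y) \<partial>\<nu> \<partial>\<mu>)"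
    by (simp add: nn_integral_cmult mult.assoc)
  finally show ?thesis by (simp add: N.nn_integral_fst)
qed

lemma eintegral_scaled_pair:
  assumes fin: "finite_measure \<mu>" "finite_measure \<nu>" and [measurable]: "f \<in> borel_measurable (\<mu> \<Otimes>\<^sub>M \<nu>)"
    and int: "eabs_integrable (\<mu> \<Otimes>\<^sub>M \<nu>) f" and "0 \<le> a" "0 \<le> b"
  shows "eintegral (scale_measure (ennreal a) \<mu> \<Otimes>\<^sub>M scale_measure (ennreal b) \<nu>) f
    = ereal (a * b * (\<integral>z. real_of_ereal (f z) \<partial>(\<mu> \<Otimes>\<^sub>M \<nu>)))"
proof -
  define g where "g z = real_of_ereal (f z)" for z
  note ae = eabs_integrable_imp[OF int assms(3), folded g_def]
  have 1: "(\<integral>\<^sup>+z. e2ennreal (f z) \<partial>(\<mu> \<Otimes>\<^sub>M \<nu>)) = (\<integral>\<^sup>+z. ennreal (g z) \<partial>(\<mu> \<Otimes>\<^sub>M \<nu>))"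
    by (rule nn_integral_cong_AE) (use ae(1) in eventually_elim, auto simp: g_def)
  have 2: "(\<integral>\<^sup>+z. e2ennreal (- f z) \<partial>(\<mu> \<Otimes>\<^sub>M \<nu>)) = (\<integral>\<^sup>+z. ennreal (- g z) \<partial>(\<mu> \<Otimes>\<^sub>M \<nu>))"
    by (rule nn_integral_cong_AE) (use ae(1) in eventually_elim, auto simp: g_def)
  have "(\<integral>\<^sup>+z. ennreal (g z) \<partial>(\<mu> \<Otimes>\<^sub>M \<nu>)) < \<infinity>" "(\<integral>\<^sup>+z. ennreal (- g z) \<partial>(\<mu> \<Otimes>\<^sub>M \<nu>)) < \<infinity>"
    using ae(2) by (auto simp: real_integrable_def less_top)
  then obtain p q where pq: "0 \<le> p" "0 \<le> q" "(\<integral>\<^sup>+z. ennreal (g z) \<partial>(\<mu> \<Otimes>\<^sub>M \<nu>)) = ennreal p"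
      "(\<integral>\<^sup>+z. ennreal (- g z) \<partial>(\<mu> \<Otimes>\<^sub>M \<nu>)) = ennreal q"
    by (metis ennreal_cases infinity_ennreal_def less_irrefl)
  have "(\<integral>z. g z \<partial>(\<mu> \<Otimes>\<^sub>M \<nu>)) = p - q"
    using real_lebesgue_integral_def[OF ae(2)] pq by simp
  then show ?thesis
    using assms(5,6) pq unfolding eintegral_def g_def[symmetric]
    by (simp add: nn_integral_scaled_pair[OF fin] 1 2 ennreal_mult[symmetric] right_diff_distrib)
qed

lemma
  fixes x :: "'i \<Rightarrow> 'a::topological_space" and h :: "'a \<Rightarrow> real" and f :: "'a \<Rightarrow> ennreal"
  assumes I: "finite I"
  shows finite_measure_empirical: "finite_measure (distr (count_space I) borel x)"
    and integral_empirical: "h \<in> borel_measurable borel \<Longrightarrow>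
      (\<integral>y. h y \<partial>distr (count_space I) borel x) = (\<Sum>i\<in>I. h (x i))"
    and nn_integral_empirical: "f \<in> borel_measurable borel \<Longrightarrow>
      (\<integral>\<^sup>+y. f y \<partial>distr (count_space I) borel x) = (\<Sum>i\<in>I. f (x i))"
proof -
  have [measurable]: "x \<in> count_space I \<rightarrow>\<^sub>M borel" by simp
  show "finite_measure (distr (count_space I) borel x)"
    using I by (intro finite_measure.finite_measure_distr finite_measure_count_space) auto
  show "(\<integral>y. h y \<partial>distr (count_space I) borel x) = (\<Sum>i\<in>I. h (x i))" if "h \<in> borel_measurable borel"
    using that I by (subst integral_distr) (auto simp: lebesgue_integral_count_space_finite)
  show "(\<integral>\<^sup>+y. f y \<partial>distr (count_space I) borel x) = (\<Sum>i\<in>I. f (x i))" if "f \<in> borel_measurable borel"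
    using that I by (subst nn_integral_distr) (auto simp: nn_integral_count_space_finite)
qed

lemma
  fixes U :: "'a::second_countable_topology \<times> 'a \<Rightarrow> ereal" and x y :: "'i \<Rightarrow> 'a"
  assumes I: "finite I" and U: "U \<in> borel_measurable borel"
    and fin: "\<And>p q. p \<in> I \<Longrightarrow> q \<in> I \<Longrightarrow> \<bar>U (x p, y q)\<bar> \<noteq> \<infinity>"
  shows eabs_integrable_empirical:
      "eabs_integrable (distr (count_space I) borel x \<Otimes>\<^sub>M distr (count_space I) borel y) U"
    and integral_empirical_pair:
      "(\<integral>z. real_of_ereal (U z) \<partial>(distr (count_space I) borel x \<Otimes>\<^sub>M distr (count_space I) borel y))
        = (\<Sum>p\<in>I. \<Sum>q\<in>I. real_of_ereal (U (x p, y q)))"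
proof -
  let ?X = "distr (count_space I) borel x" and ?Y = "distr (count_space I) borel y"
  interpret X: finite_measure ?X by (rule finite_measure_empirical[OF I])
  interpret Y: finite_measure ?Y by (rule finite_measure_empirical[OF I])
  interpret XY: pair_sigma_finite ?X ?Y ..
  have [measurable]: "U \<in> borel_measurable (borel \<Otimes>\<^sub>M borel)" using U by (simp add: borel_prod)
  have "(\<integral>\<^sup>+z. e2ennreal \<bar>U z\<bar> \<partial>(?X \<Otimes>\<^sub>M ?Y)) = (\<integral>\<^sup>+u. \<integral>\<^sup>+v. e2ennreal \<bar>U (u, v)\<bar> \<partial>?Y \<partial>?X)"
    by (rule Y.nn_integral_fst[symmetric]) simp
  also have "\<dots> = (\<Sum>p\<in>I. \<Sum>q\<in>I. e2ennreal \<bar>U (x p, y q)\<bar>)"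
    by (simp add: nn_integral_empirical I)
  also have "\<dots> < \<infinity>" using fin I by (force simp: less_top[symmetric])
  finally show int: "eabs_integrable (?X \<Otimes>\<^sub>M ?Y) U" by (simp add: eabs_integrable_def)
  have "integrable (?X \<Otimes>\<^sub>M ?Y) (\<lambda>z. real_of_ereal (U z))" by (rule eabs_integrable_imp[OF int]) measurable
  from XY.integral_fst'[OF this]
  show "(\<integral>z. real_of_ereal (U z) \<partial>(?X \<Otimes>\<^sub>M ?Y)) = (\<Sum>p\<in>I. \<Sum>q\<in>I. real_of_ereal (U (x p, y q)))"
    by (simp add: integral_empirical I)
qed

text \<open>For distinct points, removing the diagonal of the product space removes exactly the
  terms i = j; without atoms the background gives the diagonal no mass in the other three terms. All
  four product integrals are finite, so the extended arithmetic is real arithmetic.\<close>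

lemma offdiag_energy_fluctuation:
  fixes W :: "'a::{second_countable_topology, t2_space} \<times> 'a \<Rightarrow> ereal"
  assumes "prob_space \<rho>" and sets: "sets \<rho> = sets borel"
    and W [measurable]: "W \<in> borel_measurable borel" and sym: "\<And>x y. W (x, y) = W (y, x)"
    and int: "potential_integrable W \<rho>" and atomless: "\<And>x. emeasure \<rho> {x} = 0"
    and N: "0 < N" and x: "\<And>i j. i < N \<Longrightarrow> j < N \<Longrightarrow> i \<noteq> j \<Longrightarrow> x i \<noteq> x j \<and> \<bar>W (x i, x j)\<bar> \<noteq> \<infinity>"
  shows "offdiag_energy W (fluctuation N \<rho> x) = ereal (energy N \<rho> (\<lambda>x y. real_of_ereal (W (x, y))) x)"
proof -
  interpret prob_space \<rho> by fact
  have [measurable_cong]: "sets \<rho> = sets borel" by fact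
  define \<delta> where "\<delta> = distr (count_space {..<N}) borel x"
  have sets_\<delta> [measurable_cong]: "sets \<delta> = sets borel" by (simp add: \<delta>_def)
  interpret D: finite_measure \<delta> unfolding \<delta>_def by (rule finite_measure_empirical) simp
  interpret DR: pair_sigma_finite \<delta> \<rho> ..
  interpret RD: pair_sigma_finite \<rho> \<delta> ..
  interpret RR: pair_sigma_finite \<rho> \<rho> ..
  define V where "V = (\<lambda>(x, y). if x = y then 0 else W (x, y))"
  define r where "r z = real_of_ereal (V z)" for z
  define w where "w x y = real_of_ereal (W (x, y))" for x y
  have diag: "{z :: 'a \<times> 'a. fst z = snd z} \<in> sets borel"
    by (intro borel_closed closed_Collect_eq continuous_intros)
  have "V = (\<lambda>z. if z \<in> {z. fst z = snd z} then 0 else W z)"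
    by (auto simp: V_def fun_eq_iff)
  then have V_meas: "V \<in> borel_measurable borel"
    using diag W by (simp only:) (intro measurable_If_set, auto)
  then have V_meas' [measurable]: "V \<in> borel_measurable (borel \<Otimes>\<^sub>M borel)" by (simp add: borel_prod)
  have r_meas [measurable]: "r \<in> borel_measurable (borel \<Otimes>\<^sub>M borel)" unfolding r_def by measurable
  have W_meas' [measurable]: "W \<in> borel_measurable (borel \<Otimes>\<^sub>M borel)" using W by (simp add: borel_prod)
  have V_sym: "V (u, v) = V (v, u)" for u v by (auto simp: V_def sym)
  have V_le: "e2ennreal \<bar>V z\<bar> \<le> e2ennreal \<bar>W z\<bar>" for z
    by (cases z) (auto simp: V_def)
  have sec: "(\<integral>\<^sup>+y. e2ennreal \<bar>V (u, y)\<bar> \<partial>\<rho>) < \<infinity>" for u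
  proof -
    have "(\<integral>\<^sup>+y. e2ennreal \<bar>V (u, y)\<bar> \<partial>\<rho>) \<le> (\<integral>\<^sup>+y. e2ennreal \<bar>W (u, y)\<bar> \<partial>\<rho>)"
      by (intro nn_integral_mono V_le)
    also have "\<dots> < \<infinity>" using int by (simp add: potential_integrable_def eabs_integrable_def)
    finally show ?thesis .
  qed
  have r_sec: "(\<integral>y. r (u, y) \<partial>\<rho>) = (\<integral>y. w u y \<partial>\<rho>)" for u
  proof (rule integral_cong_AE)
    have "AE y in \<rho>. y \<noteq> u" using atomless[of u] by (intro AE_I[of _ _ "{u}"]) auto
    then show "AE y in \<rho>. r (u, y) = w u y" by eventually_elim (auto simp: r_def V_def w_def)
  qed (auto simp: w_def)
  have r_swap: "r (u, v) = r (v, u)" for u v by (simp add: r_def V_sym)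
  have V_fin: "\<bar>V (x i, x j)\<bar> \<noteq> \<infinity>" if "i \<in> {..<N}" "j \<in> {..<N}" for i j
    using x[of i j] that by (cases "i = j") (auto simp: V_def)
  have iDD: "eabs_integrable (\<delta> \<Otimes>\<^sub>M \<delta>) V"
    unfolding \<delta>_def by (rule eabs_integrable_empirical[OF _ V_meas V_fin]) simp
  have sum_sec: "(\<Sum>i<N. \<integral>\<^sup>+y. e2ennreal \<bar>V (x i, y)\<bar> \<partial>\<rho>) < \<infinity>"
    using sec by (force simp: less_top[symmetric])
  have iDR: "eabs_integrable (\<delta> \<Otimes>\<^sub>M \<rho>) V"
  proof -
    have "(\<integral>\<^sup>+z. e2ennreal \<bar>V z\<bar> \<partial>(\<delta> \<Otimes>\<^sub>M \<rho>)) = (\<integral>\<^sup>+u. \<integral>\<^sup>+v. e2ennreal \<bar>V (u, v)\<bar> \<partial>\<rho> \<partial>\<delta>)"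
      by (rule nn_integral_fst[symmetric]) simp
    also have "\<dots> = (\<Sum>i<N. \<integral>\<^sup>+v. e2ennreal \<bar>V (x i, v)\<bar> \<partial>\<rho>)"
      unfolding \<delta>_def by (simp add: nn_integral_empirical)
    finally show ?thesis using sum_sec by (simp add: eabs_integrable_def)
  qed
  have iRD: "eabs_integrable (\<rho> \<Otimes>\<^sub>M \<delta>) V"
  proof -
    have "(\<integral>\<^sup>+z. e2ennreal \<bar>V z\<bar> \<partial>(\<rho> \<Otimes>\<^sub>M \<delta>)) = (\<integral>\<^sup>+v. \<integral>\<^sup>+u. e2ennreal \<bar>V (u, v)\<bar> \<partial>\<rho> \<partial>\<delta>)"
      by (rule RD.nn_integral_snd[symmetric]) simp
    also have "\<dots> = (\<Sum>i<N. \<integral>\<^sup>+v. e2ennreal \<bar>V (v, x i)\<bar> \<partial>\<rho>)"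
      unfolding \<delta>_def by (simp add: nn_integral_empirical)
    finally show ?thesis using sum_sec by (simp add: eabs_integrable_def V_sym[of _ "x _"])
  qed
  have iRR: "eabs_integrable (\<rho> \<Otimes>\<^sub>M \<rho>) V"
  proof -
    have "(\<integral>\<^sup>+z. e2ennreal \<bar>V z\<bar> \<partial>(\<rho> \<Otimes>\<^sub>M \<rho>)) \<le> (\<integral>\<^sup>+z. e2ennreal \<bar>W z\<bar> \<partial>(\<rho> \<Otimes>\<^sub>M \<rho>))"
      by (intro nn_integral_mono V_le)
    then show ?thesis using int by (auto simp: potential_integrable_def eabs_integrable_def intro: le_less_trans)
  qed
  note rDR = eabs_integrable_imp(2)[OF iDR, folded r_def]
    and rRD = eabs_integrable_imp(2)[OF iRD, folded r_def] and rRR = eabs_integrable_imp(2)[OF iRR, folded r_def]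
  have eDD: "(\<integral>z. r z \<partial>(\<delta> \<Otimes>\<^sub>M \<delta>)) = (\<Sum>i<N. \<Sum>j\<in>{..<N} - {i}. w (x i) (x j))"
  proof -
    have "(\<integral>z. r z \<partial>(\<delta> \<Otimes>\<^sub>M \<delta>)) = (\<Sum>i<N. \<Sum>j<N. r (x i, x j))"
      unfolding \<delta>_def r_def by (rule integral_empirical_pair[OF _ V_meas V_fin]) simp
    also have "\<dots> = (\<Sum>i<N. \<Sum>j\<in>{..<N} - {i}. w (x i) (x j))"
    proof (rule sum.cong[OF refl])
      fix i assume "i \<in> {..<N}"
      then have "(\<Sum>j<N. r (x i, x j)) = r (x i, x i) + (\<Sum>j\<in>{..<N} - {i}. r (x i, x j))"
        by (intro sum.remove) auto
      also have "(\<Sum>j\<in>{..<N} - {i}. r (x i, x j)) = (\<Sum>j\<in>{..<N} - {i}. w (x i) (x j))"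
        using x[of i] \<open>i \<in> {..<N}\<close> by (intro sum.cong refl) (auto simp: r_def V_def w_def)
      finally show "(\<Sum>j<N. r (x i, x j)) = (\<Sum>j\<in>{..<N} - {i}. w (x i) (x j))" by (simp add: r_def V_def)
    qed
    finally show ?thesis .
  qed
  have eDR: "(\<integral>z. r z \<partial>(\<delta> \<Otimes>\<^sub>M \<rho>)) = (\<Sum>i<N. \<integral>y. w (x i) y \<partial>\<rho>)"
  proof -
    have "(\<integral>z. r z \<partial>(\<delta> \<Otimes>\<^sub>M \<rho>)) = (\<integral>u. \<integral>v. r (u, v) \<partial>\<rho> \<partial>\<delta>)"
      using rDR by (intro DR.integral_fst'[symmetric]) simp
    also have "\<dots> = (\<Sum>i<N. \<integral>v. r (x i, v) \<partial>\<rho>)"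
      unfolding \<delta>_def by (simp add: integral_empirical)
    finally show ?thesis by (simp add: r_sec)
  qed
  have eRD: "(\<integral>z. r z \<partial>(\<rho> \<Otimes>\<^sub>M \<delta>)) = (\<Sum>i<N. \<integral>y. w (x i) y \<partial>\<rho>)"
  proof -
    have "(\<integral>z. r z \<partial>(\<rho> \<Otimes>\<^sub>M \<delta>)) = (\<integral>v. \<integral>u. r (u, v) \<partial>\<rho> \<partial>\<delta>)"
      using rRD by (subst RD.integral_snd) (simp_all add: case_prod_beta')
    also have "\<dots> = (\<integral>v. \<integral>u. r (v, u) \<partial>\<rho> \<partial>\<delta>)" 
      by (intro Bochner_Integration.integral_cong refl r_swap)
    also have "\<dots> = (\<Sum>i<N. \<integral>v. r (x i, v) \<partial>\<rho>)"
      unfolding \<delta>_def by (simp add: integral_empirical)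
    finally show ?thesis by (simp add: r_sec)
  qed
  have eRR: "(\<integral>z. r z \<partial>(\<rho> \<Otimes>\<^sub>M \<rho>)) = (\<integral>u. \<integral>y. w u y \<partial>\<rho> \<partial>\<rho>)"
    using RR.integral_fst'[of r] rRR by (simp add: r_sec)
  have s: "1 / sqrt (real N) * (1 / sqrt (real N)) = 1 / real N" "sqrt (real N) * sqrt (real N) = real N"
    "1 / sqrt (real N) * sqrt (real N) = 1" "sqrt (real N) * (1 / sqrt (real N)) = 1"
    using N by (auto simp: field_simps)
  have fins: "finite_measure \<delta>" "finite_measure \<rho>" by unfold_locales
  have "offdiag_energy W (fluctuation N \<rho> x) = ereal (1 / 2) * signed_double_integral V
     (scale_measure (ennreal (1 / sqrt (real N))) \<delta>, scale_measure (ennreal (sqrt (real N))) \<rho>)"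
    by (simp add: offdiag_energy_def fluctuation_def \<delta>_def V_def)
  also have "\<dots> = ereal (1 / 2 * ((1 / real N * (\<integral>z. r z \<partial>(\<delta> \<Otimes>\<^sub>M \<delta>)) + real N * (\<integral>z. r z \<partial>(\<rho> \<Otimes>\<^sub>M \<rho>)))
      - ((\<integral>z. r z \<partial>(\<delta> \<Otimes>\<^sub>M \<rho>)) + (\<integral>z. r z \<partial>(\<rho> \<Otimes>\<^sub>M \<delta>)))))"
    unfolding signed_double_integral_def
    using iDD iDR iRD iRR fins
    by (simp add: eintegral_scaled_pair s r_def[symmetric] del: times_divide_eq_left times_divide_eq_right)
  also have "\<dots> = ereal (energy N \<rho> w x)"
    unfolding eDD eDR eRD eRR energy_def using N by (simp add: field_simps power2_eq_square)
  finally show ?thesis unfolding w_def .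
qed

section \<open>The bound for an abstract smoothing\<close>

lemma borel_measurable_lower_semicontinuous:
  assumes "lower_semicontinuous f"
  shows "f \<in> borel_measurable borel"
proof (rule borel_measurableI_greater)
  show "{z \<in> space borel. a < f z} \<in> sets borel" for a
    using assms by (simp add: lower_semicontinuous_def)
qed

text \<open>Division by 2 n, which is how the factor 1/2 in front of the entropy appears.\<close>

lemma scaled_ereal_bound:
  fixes E R :: ereal
  assumes "- (ereal (2 * \<beta>) * E) \<le> R + ereal k" "0 < \<beta>" "0 < n"
  shows "- (ereal (\<beta> / n) * E) \<le> ereal (1 / 2) * (ereal (1 / n) * R) + ereal (k / 2 / n)"
  using assms by (cases E; cases R) (auto simp: field_simps)

text \<open>An abstract reference measure and an abstract smoothing let both spaces and both
  semigroups be instances. Positivity is phrased for balanced point charges, the form in which it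
  can be passed from the heat to the Poisson semigroup.\<close>

theorem fluctuation_bound_of_semigroup:
  fixes W :: "'a::{second_countable_topology, t2_space} \<times> 'a \<Rightarrow> ereal"
  assumes L: "sigma_finite_measure L" "sets L = sets borel" and atomless: "\<And>x. emeasure L {x} = 0"
    and W_sym: "\<And>x y. W (x, y) = W (y, x)"
    and lsc: "lower_semicontinuous W"
    and S_meas: "\<And>\<epsilon>. S \<epsilon> W \<in> borel_measurable borel"
    and S_fin: "\<And>\<epsilon> z. 0 < \<epsilon> \<Longrightarrow> \<epsilon> < 1 \<Longrightarrow> \<bar>S \<epsilon> W z\<bar> \<noteq> \<infinity>"
    and S_sym: "\<And>\<epsilon> x y. S \<epsilon> W (x, y) = S \<epsilon> W (y, x)"
    and S_cpd: "\<And>\<epsilon> (I :: (nat \<times> nat) set) x y. 0 < \<epsilon> \<Longrightarrow> \<epsilon> < 1 \<Longrightarrow> finite I \<Longrightarrow>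
      0 \<le> (\<Sum>p\<in>I. \<Sum>q\<in>I. real_of_ereal (S \<epsilon> W (x p, x q)) + real_of_ereal (S \<epsilon> W (y p, y q))
        - (real_of_ereal (S \<epsilon> W (x p, y q)) + real_of_ereal (S \<epsilon> W (y p, x q))))"
    and diag: "log_diagonal S W" and approx: "Lp_approximation L S W" and super: "almost_superharmonic S W"
  shows "\<exists>C :: real \<Rightarrow> ennreal \<Rightarrow> real. \<forall>\<beta>>0. \<forall>\<rho>.
         borel_probability \<rho> \<and> bounded_density L \<rho> \<and> potential_integrable W \<rho> \<longrightarrow>
         (\<forall>N\<ge>1. \<forall>\<rho>N. borel_probability_pow N \<rho>N \<longrightarrow>
            - (ereal (\<beta> / real N) * eintegral \<rho>N (\<lambda>x. offdiag_energy W (fluctuation N \<rho> x)))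
              \<le> ereal (1 / 2) * avg_relative_entropy N \<rho>N (tensor_pow N \<rho>)
                + ereal (C \<beta> (density_norm L \<rho>) / real N))"
proof -
  note W_meas [measurable] = borel_measurable_lower_semicontinuous[OF lsc]
  note [measurable] = S_meas
  define w where "w x y = real_of_ereal (W (x, y))" for x y
  define U where "U \<epsilon> x y = real_of_ereal (S \<epsilon> W (x, y))" for \<epsilon> x y
  \<comment> \<open>The value 0 where \<open>W\<close> is infinite keeps the kernel real and
    respects both the lower bound and the square bound; by integrability of \<open>W\<close>, the
    splitting of \<open>w\<close> still holds almost everywhere.\<close>
  define V where "V \<epsilon> x y = (if \<bar>W (x, y)\<bar> = \<infinity> then 0 else w x y - U \<epsilon> x y)" for \<epsilon> x y
  have [measurable]: "W \<in> borel_measurable (borel \<Otimes>\<^sub>M borel)" "S \<epsilon> W \<in> borel_measurable (borel \<Otimes>\<^sub>M borel)" for \<epsilon>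
    by (simp_all add: borel_prod)
  have w_meas: "case_prod w \<in> borel_measurable (borel \<Otimes>\<^sub>M borel)" unfolding w_def by measurable
  have U_meas: "case_prod (U \<epsilon>) \<in> borel_measurable (borel \<Otimes>\<^sub>M borel)" for \<epsilon> unfolding U_def by measurable
  have V_meas: "case_prod (V \<epsilon>) \<in> borel_measurable (borel \<Otimes>\<^sub>M borel)" for \<epsilon>
    unfolding V_def w_def U_def by measurable
  note [measurable] = w_meas U_meas V_meas
  have V_sec [measurable]: "V \<epsilon> x \<in> borel_measurable borel" for \<epsilon> x by measurable
  have U_sec [measurable]: "U \<epsilon> x \<in> borel_measurable borel" for \<epsilon> x by measurable
  have w_sec [measurable]: "w x \<in> borel_measurable borel" for x by measurable
  have V_sq_le: "ennreal ((V \<epsilon> x y)\<^sup>2) \<le> abs_powr (S \<epsilon> W (x, y) - W (x, y)) 2" for \<epsilon> x y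
    by (cases "S \<epsilon> W (x, y)"; cases "W (x, y)")
       (auto simp: V_def abs_powr_def w_def U_def power2_commute powr_numeral)
  obtain C0' where C0': "\<And>x \<epsilon>. 0 < \<epsilon> \<Longrightarrow> \<epsilon> < 1 \<Longrightarrow> \<bar>S \<epsilon> W (x, x)\<bar> \<le> ereal (C0' * (\<bar>ln \<epsilon>\<bar> + 1))"
    using diag unfolding log_diagonal_def by blast
  \<comment> \<open>The maximum with 1 makes \<open>C0\<close> positive, so that the rate 1 /
    (\<theta> C0) of the scales makes sense.\<close>
  define C0 where "C0 = max C0' 1"
  have C0: "0 < C0" by (simp add: C0_def)
  have U_diag: "\<bar>U \<epsilon> x x\<bar> \<le> C0 * (\<bar>ln \<epsilon>\<bar> + 1)" if "0 < \<epsilon>" "\<epsilon> < 1" for \<epsilon> x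
  proof -
    have "\<bar>U \<epsilon> x x\<bar> \<le> C0' * (\<bar>ln \<epsilon>\<bar> + 1)"
      using C0'[OF that, of x] by (cases "S \<epsilon> W (x, x)") (auto simp: U_def)
    also have "\<dots> \<le> C0 * (\<bar>ln \<epsilon>\<bar> + 1)" by (intro mult_right_mono) (auto simp: C0_def)
    finally show ?thesis .
  qed
  obtain \<alpha> \<epsilon>0 K' where sup: "0 < \<alpha>" "0 < \<epsilon>0"
      "\<And>z \<epsilon>. 0 < \<epsilon> \<Longrightarrow> \<epsilon> < \<epsilon>0 \<Longrightarrow> ereal (- K' * \<epsilon> powr \<alpha>) \<le> W z - S \<epsilon> W z"
    using super unfolding almost_superharmonic_def by blast
  define K where "K = max K' 0"
  have V_lower: "- (K * \<epsilon> powr \<alpha>) \<le> V \<epsilon> x y" if "0 < \<epsilon>" "\<epsilon> < \<epsilon>0" "\<epsilon> < 1" for \<epsilon> x y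
  proof (cases "\<bar>W (x, y)\<bar> = \<infinity>")
    case False
    have "- (K * \<epsilon> powr \<alpha>) \<le> - K' * \<epsilon> powr \<alpha>" by (simp add: K_def mult_right_mono)
    also have "\<dots> \<le> V \<epsilon> x y"
      using sup(3)[OF that(1,2), of "(x, y)"] S_fin[OF that(1,3), of "(x, y)"] False
      by (cases "W (x, y)"; cases "S \<epsilon> W (x, y)") (auto simp: V_def w_def U_def)
    finally show ?thesis .
  qed (simp add: V_def K_def)
  obtain CL :: "real \<Rightarrow> ennreal \<Rightarrow> real" where CL: "\<And>\<rho> p. borel_probability \<rho> \<Longrightarrow> bounded_density L \<rho> \<Longrightarrow> 1 \<le> p \<Longrightarrow>
      (\<exists>\<kappa>>0. \<forall>\<epsilon>>0. (SUP x. \<integral>\<^sup>+ y. abs_powr (S \<epsilon> W (x, y) - W (x, y)) p \<partial>\<rho>)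
             < ennreal (CL p (density_norm L \<rho>) * \<epsilon> powr \<kappa>))"
    using approx unfolding Lp_approximation_def by blast
  have rate: "\<exists>\<kappa>>0. \<exists>D\<ge>0. \<forall>\<rho>. borel_probability \<rho> \<longrightarrow> bounded_density L \<rho> \<longrightarrow> density_norm L \<rho> = m \<longrightarrow>
    (\<forall>\<epsilon> x. 0 < \<epsilon> \<longrightarrow> \<epsilon> < 1 \<longrightarrow> (\<integral>\<^sup>+y. ennreal ((V \<epsilon> x y)\<^sup>2) \<partial>\<rho>) \<le> ennreal (D * \<epsilon> powr \<kappa>))" for m
  proof (rule uniform_rate_over_densities[OF L, where C="CL 2"])
    fix \<rho> :: "'a measure" assume \<rho>: "borel_probability \<rho>" "bounded_density L \<rho>"
    obtain \<kappa> where \<kappa>: "0 < \<kappa>" "\<And>\<epsilon>. 0 < \<epsilon> \<Longrightarrow> (SUP x. \<integral>\<^sup>+ y. abs_powr (S \<epsilon> W (x, y) - W (x, y)) 2 \<partial>\<rho>)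
             < ennreal (CL 2 (density_norm L \<rho>) * \<epsilon> powr \<kappa>)"
      using CL[OF \<rho>, of 2] by auto
    have "(SUP x. \<integral>\<^sup>+ y. ennreal ((V \<epsilon> x y)\<^sup>2) \<partial>\<rho>) < ennreal (CL 2 (density_norm L \<rho>) * \<epsilon> powr \<kappa>)" if "0 < \<epsilon>" for \<epsilon>
    proof (rule le_less_trans[OF _ \<kappa>(2)[OF that]])
      show "(SUP x. \<integral>\<^sup>+ y. ennreal ((V \<epsilon> x y)\<^sup>2) \<partial>\<rho>)
          \<le> (SUP x. \<integral>\<^sup>+ y. abs_powr (S \<epsilon> W (x, y) - W (x, y)) 2 \<partial>\<rho>)"
        by (intro SUP_mono' nn_integral_mono V_sq_le)
    qed
    with \<kappa>(1) show "\<exists>\<kappa>>0. \<forall>\<epsilon>>0. (SUP x. \<integral>\<^sup>+ y. ennreal ((V \<epsilon> x y)\<^sup>2) \<partial>\<rho>)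
        < ennreal (CL 2 (density_norm L \<rho>) * \<epsilon> powr \<kappa>)" by blast
  qed measurable
  \<comment> \<open>The constant is fixed for each \<beta> and each value m of the density norm
    before \<rho> is introduced; a choice function of both then has the required dependence.\<close>
  have "\<forall>\<beta> m. \<exists>c. 0 < \<beta> \<longrightarrow> (\<forall>\<rho>. borel_probability \<rho> \<and> bounded_density L \<rho> \<and> potential_integrable W \<rho> \<and> density_norm L \<rho> = m \<longrightarrow>
         (\<forall>N\<ge>1. \<forall>\<rho>N. borel_probability_pow N \<rho>N \<longrightarrow>
            - (ereal (\<beta> / real N) * eintegral \<rho>N (\<lambda>x. offdiag_energy W (fluctuation N \<rho> x)))
              \<le> ereal (1 / 2) * avg_relative_entropy N \<rho>N (tensor_pow N \<rho>) + ereal (c / real N)))"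
  proof (intro allI)
    fix \<beta> :: real and m :: ennreal
    show "\<exists>c. 0 < \<beta> \<longrightarrow> (\<forall>\<rho>. borel_probability \<rho> \<and> bounded_density L \<rho> \<and> potential_integrable W \<rho> \<and> density_norm L \<rho> = m \<longrightarrow>
         (\<forall>N\<ge>1. \<forall>\<rho>N. borel_probability_pow N \<rho>N \<longrightarrow>
            - (ereal (\<beta> / real N) * eintegral \<rho>N (\<lambda>x. offdiag_energy W (fluctuation N \<rho> x)))
              \<le> ereal (1 / 2) * avg_relative_entropy N \<rho>N (tensor_pow N \<rho>) + ereal (c / real N)))"
    proof (cases "0 < \<beta>")
      case False
      then show ?thesis by simp
    next
      case True
      define \<theta> where "\<theta> = 2 * \<beta>"
      have \<theta>: "0 < \<theta>" using True by (simp add: \<theta>_def)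
      obtain \<kappa> D where \<kappa>: "0 < \<kappa>" and D: "0 \<le> D"
        and rate': "\<And>\<rho> \<epsilon> x. borel_probability \<rho> \<Longrightarrow> bounded_density L \<rho> \<Longrightarrow> density_norm L \<rho> = m \<Longrightarrow>
          0 < \<epsilon> \<Longrightarrow> \<epsilon> < 1 \<Longrightarrow> (\<integral>\<^sup>+y. ennreal ((V \<epsilon> x y)\<^sup>2) \<partial>\<rho>) \<le> ennreal (D * \<epsilon> powr \<kappa>)"
        using rate[of m] by blast
      obtain n0 where n0: "\<And>n. n0 \<le> n \<Longrightarrow> 1 \<le> real n / 2 - \<theta> * C0 / 2 \<and>
          exp (- (1 / (\<theta> * C0) * real n)) < \<epsilon>0 \<and> exp (- (1 / (\<theta> * C0) * real n)) < 1 \<and>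
          32 * (2 * real n * \<theta>) * sqrt (D * exp (- (1 / (\<theta> * C0) * real n)) powr \<kappa>) \<le> 1 \<and>
          4 * (2 * real n * \<theta>) * (K * exp (- (1 / (\<theta> * C0) * real n)) powr \<alpha>) \<le> 1"
        using ex_scale_threshold[of \<theta> "1 / (\<theta> * C0)" D K \<kappa> \<alpha> \<epsilon>0 "\<theta> * C0 / 2"] \<theta> C0 D \<kappa> sup
        by (auto simp: K_def)
      define B where "B = exp (real n0) + exp 3 / (1 - exp (- 1 :: real))"
      have B: "0 < B" unfolding B_def by (intro add_pos_nonneg) auto
      show ?thesis
      \<comment> \<open>ln B is the additive term of the Gibbs bound at 2 \<beta>, before the
        division by 2 N.\<close>
      proof (intro exI[of _ "ln B / 2"] impI allI)
        fix \<rho> :: "'a measure" and N :: nat and \<rho>N :: "(nat \<Rightarrow> 'a) measure"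
        assume \<rho>: "borel_probability \<rho> \<and> bounded_density L \<rho> \<and> potential_integrable W \<rho> \<and> density_norm L \<rho> = m"
          and N: "1 \<le> N" and \<rho>N: "borel_probability_pow N \<rho>N"
        interpret R: prob_space \<rho> using \<rho> by (simp add: borel_probability_def)
        interpret RR: pair_sigma_finite \<rho> \<rho> ..
        interpret RR': pair_prob_space \<rho> \<rho> ..
        have sets_\<rho> [measurable_cong]: "sets \<rho> = sets borel" using \<rho> by (simp add: borel_probability_def)
        have space_\<rho>: "space \<rho> = UNIV" using sets_eq_imp_space_eq[OF sets_\<rho>] by simp
        have pot: "potential_integrable W \<rho>" using \<rho> by simp
        have atom_\<rho>: "emeasure \<rho> {x} = 0" for x
        proof -
          have "{x} \<in> null_sets L" using atomless[of x] L(2) by (intro null_setsI) auto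
          then show ?thesis
            using \<rho> by (auto simp: bounded_density_def absolutely_continuous_def null_sets_def)
        qed
        have w_fin: "AE y in \<rho>. \<bar>W (x, y)\<bar> \<noteq> \<infinity>" and w_int: "integrable \<rho> (w x)" for x
        proof -
          have i: "eabs_integrable \<rho> (\<lambda>y. W (x, y))" using pot by (simp add: potential_integrable_def)
          show "AE y in \<rho>. \<bar>W (x, y)\<bar> \<noteq> \<infinity>" by (rule eabs_integrable_imp[OF i]) measurable
          have "integrable \<rho> (\<lambda>y. real_of_ereal (W (x, y)))" by (rule eabs_integrable_imp[OF i]) measurable
          then show "integrable \<rho> (w x)" by (simp add: w_def[abs_def])
        qed
        have i2: "eabs_integrable (\<rho> \<Otimes>\<^sub>M \<rho>) W" using pot by (simp add: potential_integrable_def)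
        have W_meas2: "W \<in> borel_measurable (\<rho> \<Otimes>\<^sub>M \<rho>)" by measurable
        have w_fin2: "AE z in \<rho> \<Otimes>\<^sub>M \<rho>. \<bar>W z\<bar> \<noteq> \<infinity>" by (rule eabs_integrable_imp[OF i2 W_meas2])
        have w_int2: "integrable (\<rho> \<Otimes>\<^sub>M \<rho>) (case_prod w)"
          using eabs_integrable_imp(2)[OF i2 W_meas2] by (simp add: w_def case_prod_beta')
        have V_rate: "(\<integral>\<^sup>+y. ennreal ((V \<epsilon> x y)\<^sup>2) \<partial>\<rho>) \<le> ennreal (D * \<epsilon> powr \<kappa>)" if "0 < \<epsilon>" "\<epsilon> < 1" for \<epsilon> x
          using rate'[of \<rho>] \<rho> that by blast
        have V_int_sq: "integrable \<rho> (\<lambda>y. (V \<epsilon> x y)\<^sup>2)" if "0 < \<epsilon>" "\<epsilon> < 1" for \<epsilon> x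
          using V_rate[OF that, of x] by (intro integrableI_nonneg) (auto intro: le_less_trans)
        have V_sq: "(\<integral>y. (V \<epsilon> x y)\<^sup>2 \<partial>\<rho>) \<le> D * \<epsilon> powr \<kappa>" if "0 < \<epsilon>" "\<epsilon> < 1" for \<epsilon> x
        proof -
          have "ennreal (\<integral>y. (V \<epsilon> x y)\<^sup>2 \<partial>\<rho>) \<le> ennreal (D * \<epsilon> powr \<kappa>)"
            using V_rate[OF that, of x] V_int_sq[OF that, of x]
            by (subst nn_integral_eq_integral[symmetric]) auto
          then show ?thesis using D by (simp add: ennreal_le_iff)
        qed
        have V_int: "integrable \<rho> (V \<epsilon> x)" if "0 < \<epsilon>" "\<epsilon> < 1" for \<epsilon> x
          using V_int_sq[OF that, of x] by (rule R.square_integrable_imp_integrable[rotated]) simp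
        have V_int2: "integrable (\<rho> \<Otimes>\<^sub>M \<rho>) (case_prod (V \<epsilon>))" if "0 < \<epsilon>" "\<epsilon> < 1" for \<epsilon>
        proof (rule RR'.square_integrable_imp_integrable)
          show "integrable (\<rho> \<Otimes>\<^sub>M \<rho>) (\<lambda>z. (case_prod (V \<epsilon>) z)\<^sup>2)"
          proof (rule integrableI_nonneg)
            have "(\<integral>\<^sup>+z. ennreal ((case_prod (V \<epsilon>) z)\<^sup>2) \<partial>(\<rho> \<Otimes>\<^sub>M \<rho>)) = (\<integral>\<^sup>+x. \<integral>\<^sup>+y. ennreal ((V \<epsilon> x y)\<^sup>2) \<partial>\<rho> \<partial>\<rho>)"
              by (subst R.nn_integral_fst[symmetric]) simp_all
            also have "\<dots> \<le> (\<integral>\<^sup>+x. ennreal (D * \<epsilon> powr \<kappa>) \<partial>\<rho>)"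
              by (intro nn_integral_mono V_rate that)
            also have "\<dots> < \<infinity>" by (simp add: R.emeasure_space_1)
            finally show "(\<integral>\<^sup>+z. ennreal ((case_prod (V \<epsilon>) z)\<^sup>2) \<partial>(\<rho> \<Otimes>\<^sub>M \<rho>)) < \<infinity>" .
          qed auto
        qed measurable
        have UV: "w x y = U \<epsilon> x y + V \<epsilon> x y" if "\<bar>W (x, y)\<bar> \<noteq> \<infinity>" for \<epsilon> x y
          using that by (simp add: V_def)
        have U_int: "integrable \<rho> (U \<epsilon> x)" if "0 < \<epsilon>" "\<epsilon> < 1" for \<epsilon> x
        proof -
          have "integrable \<rho> (\<lambda>y. w x y - V \<epsilon> x y)" using w_int V_int[OF that] by simp
          moreover have "AE y in \<rho>. w x y - V \<epsilon> x y = U \<epsilon> x y"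
            using w_fin[of x] by eventually_elim (simp add: UV[of _ _ \<epsilon>])
          ultimately show ?thesis by (subst integrable_cong_AE[where g="\<lambda>y. w x y - V \<epsilon> x y"]) (auto elim: AE_mp)
        qed
        have U_int2: "integrable (\<rho> \<Otimes>\<^sub>M \<rho>) (case_prod (U \<epsilon>))" if "0 < \<epsilon>" "\<epsilon> < 1" for \<epsilon>
        proof -
          have "integrable (\<rho> \<Otimes>\<^sub>M \<rho>) (\<lambda>z. case_prod w z - case_prod (V \<epsilon>) z)" 
            by (rule Bochner_Integration.integrable_diff[OF w_int2 V_int2[OF that]])
          moreover have "AE z in \<rho> \<Otimes>\<^sub>M \<rho>. case_prod (U \<epsilon>) z = case_prod w z - case_prod (V \<epsilon>) z"
            using w_fin2 by eventually_elim (auto simp: UV[of _ _ \<epsilon>])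
          ultimately show ?thesis by (subst integrable_cong_AE) auto
        qed
        define P where "P = Pi\<^sub>M {..<N} (\<lambda>_. \<rho>)"
        \<comment> \<open>Two coordinates have joint law
          \<open>\<rho> \<Otimes>\<^sub>M \<rho>\<close>, for which the diagonal and the infinities
          of \<open>W\<close> are null.\<close>
        have AE_pairs: "AE x in P. \<forall>i<N. \<forall>j<N. i \<noteq> j \<longrightarrow> x i \<noteq> x j \<and> \<bar>W (x i, x j)\<bar> \<noteq> \<infinity>"
        proof -
          have ne: "AE z in \<rho> \<Otimes>\<^sub>M \<rho>. fst z \<noteq> snd z"
          proof -
            have diag: "{z :: 'a \<times> 'a. fst z = snd z} \<in> sets (borel \<Otimes>\<^sub>M borel)"
              unfolding borel_prod by (intro borel_closed closed_Collect_eq continuous_intros)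
            have "AE x in \<rho>. AE y in \<rho>. fst (x, y) \<noteq> snd (x, y)"
            proof (rule AE_I2)
              fix x show "AE y in \<rho>. fst (x, y) \<noteq> snd (x, y)"
                using atom_\<rho>[of x] by (intro AE_I[of _ _ "{x}"]) auto
            qed
            moreover have "{z \<in> space (\<rho> \<Otimes>\<^sub>M \<rho>). fst z \<noteq> snd z} = space (\<rho> \<Otimes>\<^sub>M \<rho>) - {z. fst z = snd z}" by auto
            moreover have "{z :: 'a \<times> 'a. fst z = snd z} \<in> sets (\<rho> \<Otimes>\<^sub>M \<rho>)"
              using diag sets_pair_measure_cong[OF sets_\<rho> sets_\<rho>] by simp
            ultimately show ?thesis by (intro RR.AE_pair_measure) auto
          qed
          have "AE x in P. x i \<noteq> x j \<and> \<bar>W (x i, x j)\<bar> \<noteq> \<infinity>" if "i < N" "j < N" "i \<noteq> j" for i j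
          proof -
            have [measurable]: "(\<lambda>x. (x i, x j)) \<in> P \<rightarrow>\<^sub>M \<rho> \<Otimes>\<^sub>M \<rho>" using that by (simp add: P_def)
            have dist: "distr P (\<rho> \<Otimes>\<^sub>M \<rho>) (\<lambda>x. (x i, x j)) = \<rho> \<Otimes>\<^sub>M \<rho>"
              unfolding P_def by (rule distr_PiM_pair) (use that R.prob_space_axioms in auto)
            have "AE z in distr P (\<rho> \<Otimes>\<^sub>M \<rho>) (\<lambda>x. (x i, x j)). fst z \<noteq> snd z \<and> \<bar>W z\<bar> \<noteq> \<infinity>"
              unfolding dist using ne w_fin2 by eventually_elim simp
            from AE_distrD[OF _ this] show ?thesis by simp
          qed
          then have "\<forall>i\<in>{..<N}. \<forall>j\<in>{..<N}. AE x in P. i \<noteq> j \<longrightarrow> x i \<noteq> x j \<and> \<bar>W (x i, x j)\<bar> \<noteq> \<infinity>"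
            by (auto intro: AE_I2)
          then have "AE x in P. \<forall>i\<in>{..<N}. \<forall>j\<in>{..<N}. i \<noteq> j \<longrightarrow> x i \<noteq> x j \<and> \<bar>W (x i, x j)\<bar> \<noteq> \<infinity>"
            by (intro AE_finite_allI) auto
          then show ?thesis by eventually_elim auto
        qed
        have split: "AE x in P. energy N \<rho> w x = energy N \<rho> (U \<epsilon>) x + energy N \<rho> (V \<epsilon>) x"
          if \<epsilon>: "0 < \<epsilon>" "\<epsilon> < 1" for \<epsilon>
          using AE_pairs
        proof eventually_elim
          case (elim x)
          have sec: "(\<integral>y. w u y \<partial>\<rho>) = (\<integral>y. U \<epsilon> u y \<partial>\<rho>) + (\<integral>y. V \<epsilon> u y \<partial>\<rho>)" for u
          proof -
            have "(\<integral>y. w u y \<partial>\<rho>) = (\<integral>y. U \<epsilon> u y + V \<epsilon> u y \<partial>\<rho>)"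
            proof (rule integral_cong_AE)
              show "AE y in \<rho>. w u y = U \<epsilon> u y + V \<epsilon> u y"
                using w_fin[of u] by eventually_elim (rule UV)
            qed simp_all
            then show ?thesis using U_int[OF \<epsilon>] V_int[OF \<epsilon>] by simp
          qed
          have "(\<integral>u. \<integral>y. w u y \<partial>\<rho> \<partial>\<rho>) = (\<integral>u. \<integral>y. U \<epsilon> u y \<partial>\<rho> \<partial>\<rho>) + (\<integral>u. \<integral>y. V \<epsilon> u y \<partial>\<rho> \<partial>\<rho>)"
            unfolding sec using RR.integrable_fst[OF U_int2[OF \<epsilon>]] RR.integrable_fst[OF V_int2[OF \<epsilon>]] by simp
          moreover have "(\<Sum>i<N. \<Sum>j\<in>{..<N} - {i}. w (x i) (x j)) =
              (\<Sum>i<N. \<Sum>j\<in>{..<N} - {i}. U \<epsilon> (x i) (x j)) + (\<Sum>i<N. \<Sum>j\<in>{..<N} - {i}. V \<epsilon> (x i) (x j))"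
            unfolding sum.distrib[symmetric] using elim by (intro sum.cong refl UV) auto
          ultimately show ?case
            unfolding energy_def sec by (simp add: sum.distrib algebra_simps add_divide_distrib diff_divide_distrib)
        qed
        have "(\<integral>\<^sup>+x. ennreal (exp (- \<theta> * energy N \<rho> w x)) \<partial>Pi\<^sub>M {..<N} (\<lambda>_. \<rho>)) \<le> ennreal B"
          unfolding B_def
        proof (rule exp_moment_multiscale[where U=U and V=V and D=D and K=K and \<kappa>=\<kappa> and \<alpha>=\<alpha> and ?\<epsilon>0.0=\<epsilon>0 and ?C0.0=C0])
          show "U \<epsilon> x y = U \<epsilon> y x" for \<epsilon> x y unfolding U_def by (subst S_sym) simp
          then show "V \<epsilon> x y = V \<epsilon> y x" for \<epsilon> x y unfolding V_def w_def by (simp add: W_sym[of x y])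
          show "0 \<le> (\<Sum>p\<in>I. \<Sum>q\<in>I. U \<epsilon> (x p) (x q) + U \<epsilon> (y p) (y q) - (U \<epsilon> (x p) (y q) + U \<epsilon> (y p) (x q)))"
            if "0 < \<epsilon>" "\<epsilon> < 1" "finite I" for \<epsilon> and I :: "(nat \<times> nat) set" and x y
            unfolding U_def by (rule S_cpd[OF that])
          show "AE x in Pi\<^sub>M {..<N} (\<lambda>_. \<rho>). energy N \<rho> w x = energy N \<rho> (U \<epsilon>) x + energy N \<rho> (V \<epsilon>) x"
            if "0 < \<epsilon>" "\<epsilon> < 1" for \<epsilon> using split[OF that] unfolding P_def .
        qed (use R.prob_space_axioms space_\<rho> N \<theta> C0 D n0 U_int U_int2 U_diag V_int_sq V_sq V_lower in \<open>auto simp: K_def\<close>)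
        then have moment: "(\<integral>\<^sup>+x. ennreal (exp (- \<theta> * energy N \<rho> w x)) \<partial>P) \<le> ennreal B" unfolding P_def .
        have sets_\<rho>N: "sets \<rho>N = sets P"
          using \<rho>N unfolding borel_probability_pow_def P_def
          by (simp add: sets_PiM_cong[OF refl sets_\<rho>])
        have energy_meas: "energy N \<rho> w \<in> borel_measurable P"
          unfolding P_def by (intro measurable_energy R.prob_space_axioms) measurable
        have P_prob: "prob_space P" unfolding P_def by (intro prob_space_PiM R.prob_space_axioms)
        have "- (ereal \<theta> * eintegral \<rho>N (\<lambda>x. ereal (energy N \<rho> w x))) \<le> relative_entropy \<rho>N P + ereal (ln B)"
          by (rule Gibbs_variational_bound[OF P_prob _ sets_\<rho>N energy_meas \<theta> B moment])
             (use \<rho>N in \<open>simp add: borel_probability_pow_def\<close>)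
        \<comment> \<open>The two energies agree outside a \<open>P\<close>-null set, which is
          \<open>\<rho>N\<close>-null under absolute continuity; without it the entropy is infinite
          and the bound trivial.\<close>
        moreover have "eintegral \<rho>N (\<lambda>x. offdiag_energy W (fluctuation N \<rho> x)) = eintegral \<rho>N (\<lambda>x. ereal (energy N \<rho> w x))"
          if ac: "absolutely_continuous P \<rho>N"
        proof -
          have "AE x in \<rho>N. \<forall>i<N. \<forall>j<N. i \<noteq> j \<longrightarrow> x i \<noteq> x j \<and> \<bar>W (x i, x j)\<bar> \<noteq> \<infinity>"
            by (rule absolutely_continuous_AE[OF sets_\<rho>N ac AE_pairs])
          then have AE_eq: "AE x in \<rho>N. offdiag_energy W (fluctuation N \<rho> x) = ereal (energy N \<rho> w x)"
          proof eventually_elim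
            case (elim x)
            show ?case unfolding w_def
              by (rule offdiag_energy_fluctuation[OF R.prob_space_axioms sets_\<rho> W_meas W_sym pot atom_\<rho>])
                 (use elim N in auto)
          qed
          show ?thesis unfolding eintegral_def
            by (intro arg_cong2[where f="(-)"] arg_cong[where f=enn2ereal] nn_integral_cong_AE)
               (use AE_eq in \<open>eventually_elim, simp\<close>)+
        qed
        ultimately have "- (ereal (2 * \<beta>) * eintegral \<rho>N (\<lambda>x. offdiag_energy W (fluctuation N \<rho> x)))
            \<le> relative_entropy \<rho>N P + ereal (ln B)"
          unfolding \<theta>_def by (cases "absolutely_continuous P \<rho>N") (auto simp: relative_entropy_def)
        from scaled_ereal_bound[OF this True, of "real N"] N
        show "- (ereal (\<beta> / real N) * eintegral \<rho>N (\<lambda>x. offdiag_energy W (fluctuation N \<rho> x)))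
              \<le> ereal (1 / 2) * avg_relative_entropy N \<rho>N (tensor_pow N \<rho>) + ereal (ln B / 2 / real N)"
          by (simp add: avg_relative_entropy_def tensor_pow_def P_def)
      qed
    qed
  qed
  then obtain C :: "real \<Rightarrow> ennreal \<Rightarrow> real" where "\<forall>\<beta> m. 0 < \<beta> \<longrightarrow> (\<forall>\<rho>. borel_probability \<rho> \<and> bounded_density L \<rho> \<and> potential_integrable W \<rho> \<and> density_norm L \<rho> = m \<longrightarrow>
         (\<forall>N\<ge>1. \<forall>\<rho>N. borel_probability_pow N \<rho>N \<longrightarrow>
            - (ereal (\<beta> / real N) * eintegral \<rho>N (\<lambda>x. offdiag_energy W (fluctuation N \<rho> x)))
              \<le> ereal (1 / 2) * avg_relative_entropy N \<rho>N (tensor_pow N \<rho>) + ereal (C \<beta> m / real N)))"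
    unfolding choice_iff by (elim exE) (rule that)
  then show ?thesis by (intro exI[of _ C] allI impI) (elim conjE, simp)
qed

section \<open>Heat and Poisson kernels\<close>

lemma eintegral_eabs_integrable:
  assumes [measurable]: "f \<in> borel_measurable M" and f: "eabs_integrable M f"
  shows "eintegral M f = ereal (\<integral>x. real_of_ereal (f x) \<partial>M)"
proof -
  note ae = eabs_integrable_imp[OF f assms(1)]
  have "eintegral M f = eintegral M (\<lambda>x. ereal (real_of_ereal (f x)))"
    unfolding eintegral_def
    by (intro arg_cong2[where f="(-)"] arg_cong[where f=enn2ereal] nn_integral_cong_AE)
       (use ae(1) in \<open>eventually_elim, auto\<close>)+
  then show ?thesis using ae(2) by (simp add: eintegral_integrable)
qed

lemma eabs_integrable_of_finite:
  assumes [measurable]: "f \<in> borel_measurable M" and fin: "\<bar>eintegral M f\<bar> \<noteq> \<infinity>"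
  shows "eabs_integrable M f"
proof -
  have "(\<integral>\<^sup>+x. e2ennreal \<bar>f x\<bar> \<partial>M) = (\<integral>\<^sup>+x. e2ennreal (f x) + e2ennreal (- f x) \<partial>M)"
  proof (rule nn_integral_cong)
    fix x show "e2ennreal \<bar>f x\<bar> = e2ennreal (f x) + e2ennreal (- f x)"
    proof (cases "0 \<le> f x")
      case True
      then have "e2ennreal (- f x) = 0" by (intro e2ennreal_neg) simp
      then show ?thesis using True by simp
    next
      case False
      then have "e2ennreal (f x) = 0" by (intro e2ennreal_neg) simp
      then show ?thesis using False by (simp add: ereal_abs_leI abs_ereal_less0)
    qed
  qed
  also have "\<dots> = (\<integral>\<^sup>+x. e2ennreal (f x) \<partial>M) + (\<integral>\<^sup>+x. e2ennreal (- f x) \<partial>M)"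
    by (rule nn_integral_add) simp_all
  also have "\<dots> < \<infinity>"
    using fin unfolding eintegral_def
    by (cases "\<integral>\<^sup>+x. e2ennreal (f x) \<partial>M"; cases "\<integral>\<^sup>+x. e2ennreal (- f x) \<partial>M") auto
  finally show ?thesis by (simp add: eabs_integrable_def)
qed

lemma eabs_integrable_mono:
  assumes "eabs_integrable M f" "c < \<infinity>" and [measurable]: "f \<in> borel_measurable M"
    and "\<And>x. e2ennreal \<bar>g x\<bar> \<le> c * e2ennreal \<bar>f x\<bar>"
  shows "eabs_integrable M g"
proof -
  have "(\<integral>\<^sup>+x. e2ennreal \<bar>g x\<bar> \<partial>M) \<le> (\<integral>\<^sup>+x. c * e2ennreal \<bar>f x\<bar> \<partial>M)"
    by (intro nn_integral_mono assms)
  also have "\<dots> = c * (\<integral>\<^sup>+x. e2ennreal \<bar>f x\<bar> \<partial>M)" by (rule nn_integral_cmult) simp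
  also have "\<dots> < \<infinity>" using assms(1,2) by (simp add: eabs_integrable_def ennreal_mult_less_top)
  finally show ?thesis by (simp add: eabs_integrable_def)
qed

lemma measurable_heat_kernel [measurable]: "heat_kernel \<epsilon> \<in> borel_measurable borel"
  unfolding heat_kernel_def by measurable

lemma measurable_half_heat_kernel [measurable]: "half_heat_kernel \<epsilon> \<in> borel_measurable borel"
  unfolding half_heat_kernel_def by measurable

lemma heat_kernel_nonneg: "0 \<le> heat_kernel \<epsilon> z"
  by (simp add: heat_kernel_def)

lemma half_heat_kernel_pos:
  assumes "0 < \<epsilon>"
  shows "0 < half_heat_kernel \<epsilon> (z :: 'b::euclidean_space)"
proof -
  have "0 < \<epsilon>\<^sup>2 + (norm z)\<^sup>2" using assms by (simp add: add_pos_nonneg)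
  moreover have "0 < Gamma ((real DIM('b) + 1) / 2)" by (intro Gamma_real_pos) simp
  ultimately show ?thesis using assms by (simp add: half_heat_kernel_def)
qed

lemma heat_kernel_swap: "heat_kernel \<epsilon> (b, a) = heat_kernel \<epsilon> (a, b :: 'b::euclidean_space)"
  by (simp add: heat_kernel_def norm_Pair add.commute)

lemma half_heat_kernel_swap: "half_heat_kernel \<epsilon> (b, a) = half_heat_kernel \<epsilon> (a, b :: 'b::euclidean_space)"
  by (simp add: half_heat_kernel_def norm_Pair add.commute)

text \<open>Gaussians of equal variance are not comparable under translation; a larger time leaves
  room for (p + R)^2 <= (1 + s) p^2 + (1 + 1/s) R^2 with 1 + s = \<epsilon>' / \<epsilon>. This
  carries finiteness of a convolution from one point and time to all points at smaller
  times.\<close>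

lemma heat_kernel_translate_le:
  fixes z z' :: "'b::euclidean_space"
  assumes "0 < \<epsilon>" "\<epsilon> < \<epsilon>'"
  shows "\<exists>C. \<forall>w. heat_kernel \<epsilon> (z' - w) \<le> C * heat_kernel \<epsilon>' (z - w)"
proof -
  define s where "s = \<epsilon>' / \<epsilon> - 1"
  have s: "0 < s" "1 + s = \<epsilon>' / \<epsilon>" using assms by (auto simp: s_def field_simps)
  define R where "R = norm (z - z')"
  define D where "D = (4 * pi * \<epsilon>) powr (real DIM('b) / 2)"
  define D' where "D' = (4 * pi * \<epsilon>') powr (real DIM('b) / 2)"
  have D: "0 < D" "0 < D'" using assms by (auto simp: D_def D'_def)
  define c where "c = (1 + 1 / s) * R\<^sup>2 / (4 * \<epsilon>')"
  have "heat_kernel \<epsilon> (z' - w) \<le> (exp c * D' / D) * heat_kernel \<epsilon>' (z - w)" for w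
  proof -
    have "norm (z - w) \<le> norm (z' - w) + R"
      using norm_triangle_ineq[of "z' - w" "z - z'"] by (simp add: R_def)
    then have "(norm (z - w))\<^sup>2 \<le> (norm (z' - w) + R)\<^sup>2" by (intro power_mono) auto
    also have "\<dots> \<le> (1 + s) * (norm (z' - w))\<^sup>2 + (1 + 1 / s) * R\<^sup>2"
    proof -
      have "0 \<le> (s * norm (z' - w) - R)\<^sup>2 / s" using s by simp
      also have "\<dots> = s * (norm (z' - w))\<^sup>2 + R\<^sup>2 / s - 2 * norm (z' - w) * R"
        using s by (simp add: power2_eq_square field_simps)
      finally show ?thesis by (simp add: power2_eq_square algebra_simps)
    qed
    finally have "(norm (z - w))\<^sup>2 / (4 * \<epsilon>') \<le> ((1 + s) * (norm (z' - w))\<^sup>2 + (1 + 1 / s) * R\<^sup>2) / (4 * \<epsilon>')"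
      using assms by (intro divide_right_mono) auto
    also have "\<dots> = (norm (z' - w))\<^sup>2 / (4 * \<epsilon>) + c"
    proof -
      have "\<epsilon>' / \<epsilon> * X / (4 * \<epsilon>') = X / (4 * \<epsilon>)" for X using assms by (simp add: field_simps)
      then show ?thesis unfolding s(2) c_def add_divide_distrib by simp
    qed
    finally have "exp (- (norm (z' - w))\<^sup>2 / (4 * \<epsilon>)) \<le> exp c * exp (- (norm (z - w))\<^sup>2 / (4 * \<epsilon>'))"
      by (simp flip: exp_add)
    then have "exp (- (norm (z' - w))\<^sup>2 / (4 * \<epsilon>)) / D \<le> (exp c * exp (- (norm (z - w))\<^sup>2 / (4 * \<epsilon>'))) / D"
      using D by (intro divide_right_mono) auto
    then show ?thesis using D unfolding heat_kernel_def D_def[symmetric] D'_def[symmetric] by simp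
  qed
  then show ?thesis by blast
qed

text \<open>Polynomial decay tolerates a shift at the same height: \<epsilon>^2 + |z - w|^2 is at
  most a multiple of \<epsilon>^2 + |z' - w|^2, the squared shift being absorbed by
  \<epsilon>^2.\<close>

lemma half_heat_kernel_translate_le:
  fixes z z' :: "'b::euclidean_space"
  assumes \<epsilon>: "0 < \<epsilon>"
  shows "\<exists>C. \<forall>w. half_heat_kernel \<epsilon> (z' - w) \<le> C * half_heat_kernel \<epsilon> (z - w)"
proof -
  define R where "R = norm (z - z')"
  define c where "c = 2 + 2 * R\<^sup>2 / \<epsilon>\<^sup>2"
  define e where "e = (real DIM('b) + 1) / 2"
  define G where "G = Gamma e / pi powr e"
  have G: "0 < G" unfolding G_def e_def by (intro divide_pos_pos Gamma_real_pos) auto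
  have c: "0 < c" by (simp add: c_def add_pos_nonneg)
  have "half_heat_kernel \<epsilon> (z' - w) \<le> c powr e * half_heat_kernel \<epsilon> (z - w)" for w
  proof -
    define a b where "a = \<epsilon>\<^sup>2 + (norm (z - w))\<^sup>2" "b = \<epsilon>\<^sup>2 + (norm (z' - w))\<^sup>2"
    have ab: "0 < a" "0 < b" using \<epsilon> by (auto simp: a_b_def add_pos_nonneg)
    have "norm (z - w) \<le> norm (z' - w) + R"
      using norm_triangle_ineq[of "z' - w" "z - z'"] by (simp add: R_def)
    then have "(norm (z - w))\<^sup>2 \<le> (norm (z' - w) + R)\<^sup>2" by (intro power_mono) auto
    also have "\<dots> \<le> 2 * (norm (z' - w))\<^sup>2 + 2 * R\<^sup>2"
      using sum_squares_bound[of "norm (z' - w)" R] by (simp add: power2_sum)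
    finally have "a \<le> \<epsilon>\<^sup>2 + 2 * (norm (z' - w))\<^sup>2 + 2 * R\<^sup>2" by (simp add: a_b_def)
    also have "\<dots> \<le> c * b"
    proof -
      have "2 * R\<^sup>2 = 2 * R\<^sup>2 / \<epsilon>\<^sup>2 * \<epsilon>\<^sup>2" using \<epsilon> by simp
      also have "\<dots> \<le> 2 * R\<^sup>2 / \<epsilon>\<^sup>2 * b" by (intro mult_left_mono) (auto simp: a_b_def)
      finally have "2 * R\<^sup>2 \<le> 2 * R\<^sup>2 / \<epsilon>\<^sup>2 * b" .
      moreover have "c * b = 2 * b + 2 * R\<^sup>2 / \<epsilon>\<^sup>2 * b" by (simp add: c_def distrib_right)
      moreover have "\<epsilon>\<^sup>2 + 2 * (norm (z' - w))\<^sup>2 \<le> 2 * b" by (simp add: a_b_def)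
      ultimately show ?thesis by linarith
    qed
    finally have "a powr e \<le> (c * b) powr e" using ab by (intro powr_mono2) (auto simp: e_def)
    also have "\<dots> = c powr e * b powr e" using c ab by (simp add: powr_mult)
    finally have "1 / b powr e \<le> c powr e / a powr e"
      using ab by (simp add: field_simps)
    then have "G * \<epsilon> * (1 / b powr e) \<le> G * \<epsilon> * (c powr e / a powr e)"
      using G \<epsilon> by (intro mult_left_mono) auto
    then show ?thesis
      unfolding half_heat_kernel_def e_def[symmetric] G_def[symmetric] a_b_def[symmetric] by (simp add: mult_ac)
  qed
  then show ?thesis by blast
qed

text \<open>The density of the \<open>1/2\<close>-stable subordinator in the variable \<open>u = 1/s\<close>, where \<open>s\<close> is the time of
  the heat semigroup; in this variable the subordination formula is a Gamma integral.\<close>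

definition subordinator :: "real \<Rightarrow> real \<Rightarrow> real" where
  "subordinator \<epsilon> u = (if 0 < u then \<epsilon> / (2 * sqrt pi) * u powr (- 1 / 2) * exp (- \<epsilon>\<^sup>2 * u / 4) else 0)"

lemma measurable_subordinator [measurable]: "subordinator \<epsilon> \<in> borel_measurable borel"
  unfolding subordinator_def by measurable

lemma subordinator_nonneg: "0 < \<epsilon> \<Longrightarrow> 0 \<le> subordinator \<epsilon> u"
  by (simp add: subordinator_def)

lemma nn_integral_powr_exp:
  assumes "0 < s" "0 < A"
  shows "(\<integral>\<^sup>+t. ennreal (indicator {0..} t * t powr (s - 1) * exp (- A * t)) \<partial>lborel) = ennreal (Gamma s / A powr s)"
proof -
  define f where "f t = ennreal (indicator {0..} t * t powr (s - 1) / exp t)" for t :: real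
  have [measurable]: "f \<in> borel_measurable borel" unfolding f_def by measurable
  have "ennreal (Gamma s) = (\<integral>\<^sup>+t. f t \<partial>lborel)"
    unfolding f_def using assms by (intro Gamma_conv_nn_integral_real) 
  also have "\<dots> = ennreal \<bar>A\<bar> * (\<integral>\<^sup>+t. f (0 + A * t) \<partial>lborel)"
    by (rule nn_integral_real_affine) (use assms in auto)
  also have "(\<lambda>t. f (0 + A * t)) = (\<lambda>t. ennreal (A powr (s - 1)) * ennreal (indicator {0..} t * t powr (s - 1) * exp (- A * t)))"
  proof
    fix t
    have "indicator {0..} (A * t) * (A * t) powr (s - 1) / exp (A * t)
        = A powr (s - 1) * (indicator {0..} t * t powr (s - 1) * exp (- A * t))"
      using assms by (auto simp: indicator_def powr_mult exp_minus zero_le_mult_iff field_simps)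
    then show "f (0 + A * t) = ennreal (A powr (s - 1)) * ennreal (indicator {0..} t * t powr (s - 1) * exp (- A * t))"
      unfolding f_def by (simp add: ennreal_mult[symmetric])
  qed
  also have "(\<integral>\<^sup>+t. \<dots> t \<partial>lborel) = ennreal (A powr (s - 1)) *
      (\<integral>\<^sup>+t. ennreal (indicator {0..} t * t powr (s - 1) * exp (- A * t)) \<partial>lborel)"
    by (rule nn_integral_cmult) simp
  finally have *: "ennreal (Gamma s) = ennreal (A powr s) *
      (\<integral>\<^sup>+t. ennreal (indicator {0..} t * t powr (s - 1) * exp (- A * t)) \<partial>lborel)"
    using assms by (simp add: mult.assoc[symmetric] ennreal_mult[symmetric] powr_mult_base)
  have "ennreal (1 / A powr s) * ennreal (A powr s) = 1"
    using assms by (simp add: ennreal_mult[symmetric])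
  then have "(\<integral>\<^sup>+t. ennreal (indicator {0..} t * t powr (s - 1) * exp (- A * t)) \<partial>lborel)
      = ennreal (1 / A powr s) * ennreal (Gamma s)"
    unfolding * by (simp add: mult.assoc[symmetric])
  also have "\<dots> = ennreal (Gamma s / A powr s)" using assms by (simp add: ennreal_mult'[symmetric])
  finally show ?thesis .
qed

text \<open>In dimension n the integrand is a multiple of u powr ((n - 1) / 2) * exp (- A u) with A
  = (\<epsilon>^2 + |z|^2) / 4, a Gamma integral of parameter (n + 1) / 2.\<close>

lemma half_heat_kernel_subordination:
  fixes z :: "'b::euclidean_space"
  assumes \<epsilon>: "0 < \<epsilon>"
  shows "(\<integral>\<^sup>+u. ennreal (subordinator \<epsilon> u * heat_kernel (1 / u) z) \<partial>lborel) = ennreal (half_heat_kernel \<epsilon> z)"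
proof -
  define n where "n = real DIM('b)"
  define s where "s = (n + 1) / 2"
  define A where "A = (\<epsilon>\<^sup>2 + (norm z)\<^sup>2) / 4"
  define k where "k = \<epsilon> / (2 * sqrt pi * (4 * pi) powr (n / 2))"
  have A: "0 < A" using \<epsilon> by (simp add: A_def add_pos_nonneg)
  have s: "0 < s" by (simp add: s_def n_def)
  have k: "0 \<le> k" using \<epsilon> by (simp add: k_def)
  have "(\<integral>\<^sup>+u. ennreal (subordinator \<epsilon> u * heat_kernel (1 / u) z) \<partial>lborel)
      = (\<integral>\<^sup>+u. ennreal k * ennreal (indicator {0..} u * u powr (s - 1) * exp (- A * u)) \<partial>lborel)"
  proof (intro nn_integral_cong_AE)
    have "AE u::real in lborel. u \<noteq> 0" by (rule AE_lborel_singleton)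
    then show "AE u in lborel. ennreal (subordinator \<epsilon> u * heat_kernel (1 / u) z)
        = ennreal k * ennreal (indicator {0..} u * u powr (s - 1) * exp (- A * u))"
    proof eventually_elim
      case (elim u)
      show ?case
      proof (cases "0 < u")
        case True
        have "(4 * pi * (1 / u)) powr (n / 2) = (4 * pi) powr (n / 2) / u powr (n / 2)"
          using True by (simp add: powr_divide)
        then have "heat_kernel (1 / u) z = exp (- (norm z)\<^sup>2 * u / 4) * u powr (n / 2) / (4 * pi) powr (n / 2)"
          using True unfolding heat_kernel_def n_def[symmetric] by simp
        then have "subordinator \<epsilon> u * heat_kernel (1 / u) z
            = k * ((u powr (- 1 / 2) * u powr (n / 2)) * (exp (- \<epsilon>\<^sup>2 * u / 4) * exp (- (norm z)\<^sup>2 * u / 4)))"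
          using True by (simp add: subordinator_def k_def mult_ac)
        also have "u powr (- 1 / 2) * u powr (n / 2) = u powr (s - 1)"
          unfolding powr_add[symmetric] by (simp add: s_def field_simps)
        also have "exp (- \<epsilon>\<^sup>2 * u / 4) * exp (- (norm z)\<^sup>2 * u / 4) = exp (- A * u)"
          unfolding exp_add[symmetric] by (simp add: A_def field_simps)
        finally show ?thesis using True k by (simp add: ennreal_mult[symmetric])
      next
        case False
        then show ?thesis using elim by (simp add: subordinator_def)
      qed
    qed
  qed
  also have "\<dots> = ennreal k * ennreal (Gamma s / A powr s)"
    by (subst nn_integral_cmult, simp, subst nn_integral_powr_exp[OF s A], rule refl)
  also have "\<dots> = ennreal (k * (Gamma s / A powr s))" using k by (rule ennreal_mult'[symmetric])
  also have "k * (Gamma s / A powr s) = half_heat_kernel \<epsilon> z"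
  proof -
    have 1: "A powr s = (\<epsilon>\<^sup>2 + (norm z)\<^sup>2) powr s / 4 powr s"
      unfolding A_def by (rule powr_divide)
    have 2: "4 powr s = 2 * 4 powr (n / 2)"
    proof -
      have "4 powr s = 4 powr (1 / 2) * 4 powr (n / 2)" unfolding powr_add[symmetric] s_def by (simp add: field_simps)
      then show ?thesis by (simp add: powr_half_sqrt)
    qed
    have 3: "pi powr s = sqrt pi * pi powr (n / 2)"
    proof -
      have "pi powr s = pi powr (1 / 2) * pi powr (n / 2)" unfolding powr_add[symmetric] s_def by (simp add: field_simps)
      then show ?thesis by (simp add: powr_half_sqrt)
    qed
    show ?thesis
      unfolding half_heat_kernel_def n_def[symmetric] s_def[symmetric] 1 2 3 k_def
      by (simp add: powr_mult)
  qed
  finally show ?thesis .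
qed

section \<open>Smoothing by convolution\<close>

text \<open>H-stability is tested on the images of counting measure on \<open>I\<close> under
  \<open>x\<close> and \<open>y\<close>: equally many unit charges of either sign, hence total mass
  zero whatever points coincide.\<close>

lemma H_stable_points:
  fixes W :: "'a::second_countable_topology \<times> 'a \<Rightarrow> ereal" and x y :: "'i \<Rightarrow> 'a"
  assumes stable: "H_stable P W" and \<epsilon>: "0 < \<epsilon>" and I: "finite I"
    and meas: "P \<epsilon> W \<in> borel_measurable borel"
    and fin: "\<And>u v. u \<in> x ` I \<union> y ` I \<Longrightarrow> v \<in> x ` I \<union> y ` I \<Longrightarrow> \<bar>P \<epsilon> W (u, v)\<bar> \<noteq> \<infinity>"
  shows "0 \<le> (\<Sum>p\<in>I. \<Sum>q\<in>I. real_of_ereal (P \<epsilon> W (x p, x q)) + real_of_ereal (P \<epsilon> W (y p, y q))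
        - (real_of_ereal (P \<epsilon> W (x p, y q)) + real_of_ereal (P \<epsilon> W (y p, x q))))"
proof -
  define D where "D z = distr (count_space I) borel z" for z :: "'i \<Rightarrow> 'a"
  have eq: "eabs_integrable (D a \<Otimes>\<^sub>M D b) (P \<epsilon> W)"
      "eintegral (D a \<Otimes>\<^sub>M D b) (P \<epsilon> W) = ereal (\<Sum>p\<in>I. \<Sum>q\<in>I. real_of_ereal (P \<epsilon> W (a p, b q)))"
    if "a = x \<or> a = y" "b = x \<or> b = y" for a b
  proof -
    have f: "\<bar>P \<epsilon> W (a p, b q)\<bar> \<noteq> \<infinity>" if "p \<in> I" "q \<in> I" for p q
      using \<open>a = x \<or> a = y\<close> \<open>b = x \<or> b = y\<close> that by (intro fin) auto
    show *: "eabs_integrable (D a \<Otimes>\<^sub>M D b) (P \<epsilon> W)"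
      unfolding D_def by (rule eabs_integrable_empirical[OF I meas f])
    have "sets (D a \<Otimes>\<^sub>M D b) = sets (borel \<Otimes>\<^sub>M borel)"
      by (rule sets_pair_measure_cong) (simp_all add: D_def)
    then have "sets (D a \<Otimes>\<^sub>M D b) = sets borel" unfolding borel_prod .
    then have "P \<epsilon> W \<in> borel_measurable (D a \<Otimes>\<^sub>M D b)"
      using meas measurable_cong_sets by blast
    from eintegral_eabs_integrable[OF this *]
    show "eintegral (D a \<Otimes>\<^sub>M D b) (P \<epsilon> W) = ereal (\<Sum>p\<in>I. \<Sum>q\<in>I. real_of_ereal (P \<epsilon> W (a p, b q)))"
      using integral_empirical_pair[OF I meas f] by (simp add: D_def)
  qed
  have "measure (D z) (space (D z)) = measure (count_space I) I" for z
    by (simp add: D_def measure_distr)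
  then have "total_mass (D x, D y) = 0" by (simp add: total_mass_def)
  moreover have "finite_signed (D x, D y)"
    by (simp add: finite_signed_def D_def finite_measure_empirical[OF I])
  moreover have "signed_double_integrable (P \<epsilon> W) (D x, D y)"
    using eq by (simp add: signed_double_integrable_def)
  ultimately have "0 \<le> signed_double_integral (P \<epsilon> W) (D x, D y)"
    using stable \<epsilon> unfolding H_stable_def by blast
  then show ?thesis
    using eq by (simp add: signed_double_integral_def sum.distrib sum_subtractf)
qed

section \<open>Convolutions: measurability, symmetry, periodicity and finiteness\<close>

lemma e2ennreal_abs_mult: "0 \<le> a \<Longrightarrow> e2ennreal \<bar>ereal a * x\<bar> = ennreal a * e2ennreal \<bar>x\<bar>"
  by (cases x; cases "a = 0") (auto simp: abs_mult ennreal_mult ennreal_mult_top)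

lemma measurable_convolve:
  assumes [measurable]: "k \<in> borel_measurable borel" "W \<in> borel_measurable borel"
  shows "convolve k W \<in> borel_measurable borel"
  unfolding convolve_def[abs_def] eintegral_def by measurable

lemma nn_integral_lborel_swap:
  fixes f :: "'b::euclidean_space \<times> 'b \<Rightarrow> ennreal"
  assumes [measurable]: "f \<in> borel_measurable borel"
  shows "(\<integral>\<^sup>+w. f (snd w, fst w) \<partial>lborel) = (\<integral>\<^sup>+w. f w \<partial>lborel)"
proof -
  have [measurable]: "f \<in> borel_measurable (borel \<Otimes>\<^sub>M borel)" by (simp add: borel_prod)
  have "(\<integral>\<^sup>+w. f w \<partial>lborel) = (\<integral>\<^sup>+w. f w \<partial>(lborel \<Otimes>\<^sub>M lborel))" by (simp add: lborel_prod)
  also have "\<dots> = (\<integral>\<^sup>+w. f w \<partial>distr (lborel \<Otimes>\<^sub>M lborel) (lborel \<Otimes>\<^sub>M lborel) (\<lambda>(x, y). (y, x)))"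
    by (subst lborel_pair.distr_pair_swap[symmetric]) simp
  also have "\<dots> = (\<integral>\<^sup>+w. f (snd w, fst w) \<partial>(lborel \<Otimes>\<^sub>M lborel))"
    by (subst nn_integral_distr) (auto simp: case_prod_beta')
  finally show ?thesis by (simp add: lborel_prod)
qed

lemma convolve_swap:
  fixes W :: "'b::euclidean_space \<times> 'b \<Rightarrow> ereal"
  assumes [measurable]: "k \<in> borel_measurable borel" "W \<in> borel_measurable borel"
    and "\<And>x y. k (x, y) = k (y, x)" "\<And>x y. W (x, y) = W (y, x)"
  shows "convolve k W (x, y) = convolve k W (y, x)"
proof -
  define f where "f w = ereal (k ((x, y) - w)) * W w" for w
  have [measurable]: "f \<in> borel_measurable borel" unfolding f_def by measurable
  have f: "f (snd w, fst w) = ereal (k ((y, x) - w)) * W w" for w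
    using assms(3)[of "x - snd w" "y - fst w"] assms(4)[of "snd w" "fst w"]
    by (simp add: f_def minus_prod_def)
  have "convolve k W (x, y) = eintegral lborel f" by (simp add: convolve_def f_def[abs_def])
  also have "\<dots> = eintegral lborel (\<lambda>w. f (snd w, fst w))"
    using nn_integral_lborel_swap[of "\<lambda>w. e2ennreal (f w)"] nn_integral_lborel_swap[of "\<lambda>w. e2ennreal (- f w)"]
    by (simp add: eintegral_def)
  finally show ?thesis by (simp add: f convolve_def)
qed

lemma convolve_translate:
  fixes W :: "'b::euclidean_space \<Rightarrow> ereal"
  assumes [measurable]: "k \<in> borel_measurable borel" "W \<in> borel_measurable borel"
    and per: "\<And>w. W (l + w) = W w"
  shows "convolve k W (l + z) = convolve k W z"
proof -
  define f where "f w = ereal (k (l + z - w)) * W w" for w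
  have [measurable]: "f \<in> borel_measurable borel" unfolding f_def by measurable
  have trans: "(\<integral>\<^sup>+w. g (l + w) \<partial>lborel) = (\<integral>\<^sup>+w. g w \<partial>lborel)"
    if [measurable]: "g \<in> borel_measurable borel" for g :: "'b \<Rightarrow> ennreal"
    by (subst (2) lborel_distr_plus[symmetric, of l]) (simp add: nn_integral_distr)
  have "convolve k W (l + z) = eintegral lborel f" by (simp add: convolve_def f_def[abs_def])
  also have "\<dots> = eintegral lborel (\<lambda>w. f (l + w))"
    using trans[of "\<lambda>w. e2ennreal (f w)"] trans[of "\<lambda>w. e2ennreal (- f w)"] by (simp add: eintegral_def)
  finally show ?thesis by (simp add: f_def per convolve_def)
qed

lemma eabs_integrable_convolve_translate:
  fixes W :: "'b::euclidean_space \<Rightarrow> ereal"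
  assumes [measurable]: "k \<in> borel_measurable borel" "W \<in> borel_measurable borel"
    and fin: "\<bar>convolve k W z\<bar> \<noteq> \<infinity>" and nonneg: "\<And>w. 0 \<le> k w" "\<And>w. 0 \<le> k' w"
    and le: "\<exists>C. \<forall>w. k' (z' - w) \<le> C * k (z - w)"
  shows "eabs_integrable lborel (\<lambda>w. ereal (k' (z' - w)) * W w)"
proof -
  obtain C where C: "\<And>w. k' (z' - w) \<le> C * k (z - w)" using le by blast
  have *: "eabs_integrable lborel (\<lambda>w. ereal (k (z - w)) * W w)"
    using fin unfolding convolve_def by (intro eabs_integrable_of_finite) measurable
  show ?thesis
  proof (rule eabs_integrable_mono[OF *, where c="ennreal \<bar>C\<bar>"])
    fix w
    have "k' (z' - w) \<le> \<bar>C\<bar> * k (z - w)"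
      using C[of w] mult_right_mono[OF abs_ge_self nonneg(1), of C "z - w"] by linarith
    then have "ennreal (k' (z' - w)) * e2ennreal \<bar>W w\<bar> \<le> ennreal (\<bar>C\<bar> * k (z - w)) * e2ennreal \<bar>W w\<bar>"
      by (intro mult_right_mono ennreal_leI) auto
    then show "e2ennreal \<bar>ereal (k' (z' - w)) * W w\<bar> \<le> ennreal \<bar>C\<bar> * e2ennreal \<bar>ereal (k (z - w)) * W w\<bar>"
      using nonneg by (simp add: e2ennreal_abs_mult ennreal_mult mult.assoc)
  qed (simp, measurable)
qed

lemma convolve_eq_integral:
  fixes W :: "'b::euclidean_space \<Rightarrow> ereal"
  assumes [measurable]: "k \<in> borel_measurable borel" "W \<in> borel_measurable borel"
    and int: "eabs_integrable lborel (\<lambda>w. ereal (k (z - w)) * W w)"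
  shows "convolve k W z = ereal (\<integral>w. k (z - w) * real_of_ereal (W w) \<partial>lborel)"
proof -
  have "(\<lambda>w. ereal (k (z - w)) * W w) \<in> borel_measurable lborel" by measurable
  from eintegral_eabs_integrable[OF this int] show ?thesis
    by (simp add: convolve_def)
qed

text \<open>Subordination and Fubini write the sum as an integral over \<open>u\<close> of
  nonnegative multiples of the heat sums at time 1 / u. Fubini yields convergence of the heat
  convolutions for almost every \<open>u\<close> only, so \<open>heat\<close> is required just where
  they converge.\<close>

lemma half_heat_positivity:
  fixes W :: "'b::euclidean_space \<Rightarrow> ereal" and z :: "'i \<Rightarrow> 'b" and c :: "'i \<Rightarrow> real"
  assumes W [measurable]: "W \<in> borel_measurable borel" and \<epsilon>: "0 < \<epsilon>" and J: "finite J"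
    and int: "\<And>j. j \<in> J \<Longrightarrow> eabs_integrable lborel (\<lambda>w. ereal (half_heat_kernel \<epsilon> (z j - w)) * W w)"
    and heat: "\<And>s. 0 < s \<Longrightarrow> (\<And>j. j \<in> J \<Longrightarrow> eabs_integrable lborel (\<lambda>w. ereal (heat_kernel s (z j - w)) * W w)) \<Longrightarrow>
      0 \<le> (\<Sum>j\<in>J. c j * real_of_ereal (convolve (heat_kernel s) W (z j)))"
  shows "0 \<le> (\<Sum>j\<in>J. c j * real_of_ereal (convolve (half_heat_kernel \<epsilon>) W (z j)))"
proof -
  define V where "V w = real_of_ereal (W w)" for w
  have [measurable]: "V \<in> borel_measurable borel" unfolding V_def by measurable
  define F where "F j p = subordinator \<epsilon> (fst p) * heat_kernel (1 / fst p) (z j - snd p) * V (snd p)" for j p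
  have F_meas [measurable]: "F j \<in> borel_measurable (lborel \<Otimes>\<^sub>M lborel)" for j
    unfolding F_def heat_kernel_def by measurable
  have kernel_int: "integrable lborel (\<lambda>u. subordinator \<epsilon> u * heat_kernel (1 / u) y)"
    and kernel_eq: "(\<integral>u. subordinator \<epsilon> u * heat_kernel (1 / u) y \<partial>lborel) = half_heat_kernel \<epsilon> y" for y :: 'b
  proof -
    have m: "(\<lambda>u. subordinator \<epsilon> u * heat_kernel (1 / u) y) \<in> borel_measurable lborel"
      unfolding heat_kernel_def by measurable
    have nonneg: "0 \<le> subordinator \<epsilon> u * heat_kernel (1 / u) y" for u
      using subordinator_nonneg[OF \<epsilon>] by (simp add: heat_kernel_def)
    show "integrable lborel (\<lambda>u. subordinator \<epsilon> u * heat_kernel (1 / u) y)"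
      using half_heat_kernel_subordination[OF \<epsilon>, of y] m nonneg by (intro integrableI_nonneg) auto
    show "(\<integral>u. subordinator \<epsilon> u * heat_kernel (1 / u) y \<partial>lborel) = half_heat_kernel \<epsilon> y"
      using half_heat_kernel_subordination[OF \<epsilon>, of y] m nonneg half_heat_kernel_pos[OF \<epsilon>, of y]
      by (subst integral_eq_nn_integral) auto
  qed
  \<comment> \<open>The Poisson kernel vanishes nowhere, so integrability of the product forces
    \<open>W\<close> itself to be finite almost everywhere.\<close>
  have W_fin: "AE w in lborel. \<bar>W w\<bar> \<noteq> \<infinity>" if "j \<in> J" for j
  proof -
    have "AE w in lborel. \<bar>ereal (half_heat_kernel \<epsilon> (z j - w)) * W w\<bar> \<noteq> \<infinity>"
      by (rule eabs_integrable_imp[OF int[OF that]]) measurable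
    then show ?thesis
    proof eventually_elim
      case (elim w)
      then show ?case using half_heat_kernel_pos[OF \<epsilon>, of "z j - w"] by (cases "W w") auto
    qed
  qed
  have V_int: "integrable lborel (\<lambda>w. half_heat_kernel \<epsilon> (z j - w) * V w)" if "j \<in> J" for j
  proof -
    have "integrable lborel (\<lambda>w. real_of_ereal (ereal (half_heat_kernel \<epsilon> (z j - w)) * W w))"
      by (rule eabs_integrable_imp[OF int[OF that]]) measurable
    then show ?thesis by (simp add: V_def)
  qed
  have F_int: "integrable (lborel \<Otimes>\<^sub>M lborel) (F j)" if "j \<in> J" for j
  proof (rule integrableI_bounded)
    have "(\<integral>\<^sup>+p. ennreal (norm (F j p)) \<partial>(lborel \<Otimes>\<^sub>M lborel)) = (\<integral>\<^sup>+w. \<integral>\<^sup>+u. ennreal (norm (F j (u, w))) \<partial>lborel \<partial>lborel)"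
      by (rule lborel_pair.nn_integral_snd[symmetric]) measurable
    also have "\<dots> = (\<integral>\<^sup>+w. ennreal (norm (half_heat_kernel \<epsilon> (z j - w) * V w)) \<partial>lborel)"
    proof (rule nn_integral_cong)
      fix w
      have m: "(\<lambda>u. ennreal (subordinator \<epsilon> u * heat_kernel (1 / u) (z j - w))) \<in> borel_measurable lborel"
        unfolding heat_kernel_def by measurable
      have "ennreal (norm (F j (u, w))) = ennreal (subordinator \<epsilon> u * heat_kernel (1 / u) (z j - w)) * ennreal \<bar>V w\<bar>" for u
        using subordinator_nonneg[OF \<epsilon>, of u]
        by (simp add: F_def abs_mult heat_kernel_nonneg ennreal_mult'')
      then have "(\<integral>\<^sup>+u. ennreal (norm (F j (u, w))) \<partial>lborel)
          = (\<integral>\<^sup>+u. ennreal (subordinator \<epsilon> u * heat_kernel (1 / u) (z j - w)) \<partial>lborel) * ennreal \<bar>V w\<bar>"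
        by (simp add: nn_integral_multc[OF m])
      also have "\<dots> = ennreal (norm (half_heat_kernel \<epsilon> (z j - w) * V w))"
        using half_heat_kernel_pos[OF \<epsilon>, of "z j - w"]
        by (simp add: half_heat_kernel_subordination[OF \<epsilon>] abs_mult ennreal_mult'')
      finally show "(\<integral>\<^sup>+u. ennreal (norm (F j (u, w))) \<partial>lborel) = ennreal (norm (half_heat_kernel \<epsilon> (z j - w) * V w))" .
    qed
    also have "\<dots> < \<infinity>" using V_int[OF that] by (simp add: integrable_iff_bounded)
    finally show "(\<integral>\<^sup>+p. ennreal (norm (F j p)) \<partial>(lborel \<Otimes>\<^sub>M lborel)) < \<infinity>" .
  qed measurable
  have half: "(\<integral>u. \<integral>w. F j (u, w) \<partial>lborel \<partial>lborel) = real_of_ereal (convolve (half_heat_kernel \<epsilon>) W (z j))"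
    if "j \<in> J" for j
  proof -
    have "(\<integral>u. \<integral>w. F j (u, w) \<partial>lborel \<partial>lborel) = (\<integral>p. F j p \<partial>(lborel \<Otimes>\<^sub>M lborel))"
      by (rule lborel_pair.integral_fst'[OF F_int[OF that]])
    also have "\<dots> = (\<integral>w. \<integral>u. F j (u, w) \<partial>lborel \<partial>lborel)"
      using lborel_pair.integral_snd[of "\<lambda>u w. F j (u, w)"] F_int[OF that] by (simp add: case_prod_eta)
    also have "\<dots> = (\<integral>w. half_heat_kernel \<epsilon> (z j - w) * V w \<partial>lborel)"
      by (intro Bochner_Integration.integral_cong refl) (simp add: F_def kernel_eq)
    finally show ?thesis
      using convolve_eq_integral[OF measurable_half_heat_kernel W int[OF that]] by (simp add: V_def)
  qed
  have "AE u in lborel. \<forall>j\<in>J. integrable lborel (\<lambda>w. F j (u, w))"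
    using J lborel_pair.AE_integrable_fst'[OF F_int] by (intro AE_finite_allI) auto
  then have pos: "AE u in lborel. 0 \<le> (\<Sum>j\<in>J. c j * (\<integral>w. F j (u, w) \<partial>lborel))"
  proof eventually_elim
    case (elim u)
    show ?case
    proof (cases "0 < u")
      case False
      then show ?thesis by (simp add: F_def subordinator_def)
    next
      case True
      define q where "q = subordinator \<epsilon> u"
      have q: "0 < q" using True \<epsilon> by (simp add: q_def subordinator_def)
      have h_int: "eabs_integrable lborel (\<lambda>w. ereal (heat_kernel (1 / u) (z j - w)) * W w)" if "j \<in> J" for j
      proof -
        have "integrable lborel (\<lambda>w. 1 / q * F j (u, w))" using elim that by simp
        then have "integrable lborel (\<lambda>w. heat_kernel (1 / u) (z j - w) * V w)"
          using q by (simp add: F_def q_def[symmetric])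
        then have fin: "(\<integral>\<^sup>+w. ennreal (norm (heat_kernel (1 / u) (z j - w) * V w)) \<partial>lborel) < \<infinity>"
          by (simp add: integrable_iff_bounded)
        have "(\<integral>\<^sup>+w. e2ennreal \<bar>ereal (heat_kernel (1 / u) (z j - w)) * W w\<bar> \<partial>lborel)
            = (\<integral>\<^sup>+w. ennreal (norm (heat_kernel (1 / u) (z j - w) * V w)) \<partial>lborel)"
        proof (rule nn_integral_cong_AE)
          show "AE w in lborel. e2ennreal \<bar>ereal (heat_kernel (1 / u) (z j - w)) * W w\<bar>
              = ennreal (norm (heat_kernel (1 / u) (z j - w) * V w))"
            using W_fin[OF that]
          proof eventually_elim
            case (elim w)
            then show ?case by (cases "W w") (auto simp: V_def)
          qed
        qed
        with fin show ?thesis by (simp add: eabs_integrable_def)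
      qed
      have "(\<Sum>j\<in>J. c j * (\<integral>w. F j (u, w) \<partial>lborel))
          = q * (\<Sum>j\<in>J. c j * real_of_ereal (convolve (heat_kernel (1 / u)) W (z j)))"
        unfolding sum_distrib_left
        by (intro sum.cong refl)
           (simp add: convolve_eq_integral[OF measurable_heat_kernel W h_int] F_def q_def V_def mult.assoc)
      also have "\<dots> \<ge> 0" using q True by (intro mult_nonneg_nonneg heat h_int) auto
      finally show ?thesis .
    qed
  qed
  have "0 \<le> (\<integral>u. (\<Sum>j\<in>J. c j * (\<integral>w. F j (u, w) \<partial>lborel)) \<partial>lborel)"
    by (rule integral_nonneg_AE[OF pos])
  also have "\<dots> = (\<Sum>j\<in>J. c j * (\<integral>u. \<integral>w. F j (u, w) \<partial>lborel \<partial>lborel))"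
    using lborel_pair.integrable_fst'[OF F_int] by (simp add: Bochner_Integration.integral_sum)
  finally show ?thesis by (simp add: half)
qed

text \<open>\<open>r\<close> picks a representative of a point and \<open>Wt\<close> is the
  potential lifted to Euclidean space, so that a single argument serves the whole space and the
  torus.\<close>

lemma
  fixes r :: "'a::second_countable_topology \<Rightarrow> real ^ 'd" and Wt :: "(real ^ 'd) \<times> (real ^ 'd) \<Rightarrow> ereal"
    and W :: "'a \<times> 'a \<Rightarrow> ereal" and x y :: "'i \<Rightarrow> 'a"
  assumes r [measurable]: "r \<in> borel_measurable borel" and Wt [measurable]: "Wt \<in> borel_measurable borel"
    and Wt_sym: "\<And>a b. Wt (a, b) = Wt (b, a)"
    and P_eq: "\<And>\<epsilon> p q. P \<epsilon> W (p, q) = heat_Rd \<epsilon> Wt (r p, r q)"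
    and S_eq: "\<And>\<epsilon> p q. S \<epsilon> W (p, q) = smoothing_Rd \<epsilon> Wt (r p, r q)"
    and stable: "H_stable P W" and diag: "log_diagonal S W"
  shows smoothing_measurable: "S \<epsilon> W \<in> borel_measurable borel"
    and smoothing_symmetric: "S \<epsilon> W (p, q) = S \<epsilon> W (q, p)"
    and smoothing_finite: "0 < \<epsilon> \<Longrightarrow> \<epsilon> < 1 \<Longrightarrow> \<bar>S \<epsilon> W z\<bar> \<noteq> \<infinity>"
    and smoothing_positive: "0 < \<epsilon> \<Longrightarrow> \<epsilon> < 1 \<Longrightarrow> finite I \<Longrightarrow>
      0 \<le> (\<Sum>p\<in>I. \<Sum>q\<in>I. real_of_ereal (S \<epsilon> W (x p, x q)) + real_of_ereal (S \<epsilon> W (y p, y q))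
        - (real_of_ereal (S \<epsilon> W (x p, y q)) + real_of_ereal (S \<epsilon> W (y p, x q))))"
proof -
  define k :: "real \<Rightarrow> (real ^ 'd) \<times> (real ^ 'd) \<Rightarrow> real" where
    "k \<epsilon> = (if CARD('d) = 1 then half_heat_kernel \<epsilon> else heat_kernel \<epsilon>)" for \<epsilon>
  have k_meas [measurable]: "k \<epsilon> \<in> borel_measurable borel" for \<epsilon> unfolding k_def by simp
  have S_conv: "S \<epsilon> W (p, q) = convolve (k \<epsilon>) Wt (r p, r q)" for \<epsilon> p q
    by (simp add: S_eq smoothing_Rd_def k_def half_heat_Rd_def heat_Rd_def)
  have rr: "(\<lambda>z. (r (fst z), r (snd z))) \<in> borel \<rightarrow>\<^sub>M borel"
  proof -
    have "(\<lambda>z. (r (fst z), r (snd z))) \<in> borel \<Otimes>\<^sub>M borel \<rightarrow>\<^sub>M borel \<Otimes>\<^sub>M borel" by measurable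
    then show ?thesis unfolding borel_prod .
  qed
  have meas_of: "U \<in> borel_measurable borel" if "\<And>p q. U (p, q) = convolve g Wt (r p, r q)" "g \<in> borel_measurable borel"
    for U :: "'a \<times> 'a \<Rightarrow> ereal" and g
  proof -
    have "U = (\<lambda>z. convolve g Wt (r (fst z), r (snd z)))" using that(1) by auto
    then show ?thesis using measurable_compose[OF rr measurable_convolve[OF that(2) Wt]] by simp
  qed
  show S_meas: "S \<epsilon> W \<in> borel_measurable borel" for \<epsilon> using S_conv k_meas by (rule meas_of)
  have P_meas: "P \<epsilon> W \<in> borel_measurable borel" for \<epsilon>
    by (rule meas_of[of _ "heat_kernel \<epsilon>"]) (simp_all add: P_eq heat_Rd_def)
  have "k \<epsilon> (a, b) = k \<epsilon> (b, a)" for a b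
    using heat_kernel_swap[of \<epsilon> a b] half_heat_kernel_swap[of \<epsilon> a b] by (simp add: k_def)
  then show "S \<epsilon> W (p, q) = S \<epsilon> W (q, p)"
    unfolding S_conv by (intro convolve_swap Wt_sym) measurable
  have k_nonneg: "0 \<le> k \<epsilon> z" if "0 < \<epsilon>" for \<epsilon> z
    using half_heat_kernel_pos[OF that, of z] heat_kernel_nonneg[of \<epsilon> z] by (simp add: k_def)
  have int: "eabs_integrable lborel (\<lambda>w. ereal (k \<epsilon> (z - w)) * Wt w)" if \<epsilon>: "0 < \<epsilon>" "\<epsilon> < 1" for \<epsilon> z
  proof -
    \<comment> \<open>The diagonal bound supplies finiteness at the one point (o', o') at parameter
      \<open>e\<close>, and kernel comparison spreads it to every \<open>z\<close> at \<epsilon>.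
      The Poisson kernel allows e = \<epsilon>; the heat kernel needs a time strictly between
      \<epsilon> and 1.\<close>
    define e where "e = (if CARD('d) = 1 then \<epsilon> else (1 + \<epsilon>) / 2)"
    define o' :: 'a where "o' = undefined"
    have e: "0 < e" "e < 1" using \<epsilon> by (auto simp: e_def)
    have fin: "\<bar>convolve (k e) Wt (r o', r o')\<bar> \<noteq> \<infinity>"
    proof -
      obtain C where "\<bar>S e W (o', o')\<bar> \<le> ereal (C * (\<bar>ln e\<bar> + 1))"
        using diag e unfolding log_diagonal_def by blast
      then show ?thesis unfolding S_conv by (cases "convolve (k e) Wt (r o', r o')") auto
    qed
    have le: "\<exists>C. \<forall>w. k \<epsilon> (z - w) \<le> C * k e ((r o', r o') - w)"
    proof (cases "CARD('d) = 1")
      case True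
      then show ?thesis using half_heat_kernel_translate_le[OF \<epsilon>(1), of z "(r o', r o')"] by (simp add: k_def e_def)
    next
      case False
      then show ?thesis using heat_kernel_translate_le[of \<epsilon> e z "(r o', r o')"] \<epsilon> by (simp add: k_def e_def)
    qed
    show ?thesis
      by (rule eabs_integrable_convolve_translate[OF k_meas Wt fin _ _ le]) (use k_nonneg e \<epsilon> in auto)
  qed
  show "\<bar>S \<epsilon> W z\<bar> \<noteq> \<infinity>" if "0 < \<epsilon>" "\<epsilon> < 1"
    using convolve_eq_integral[OF k_meas Wt int[OF that]] by (cases z) (simp add: S_conv)
  show "0 \<le> (\<Sum>p\<in>I. \<Sum>q\<in>I. real_of_ereal (S \<epsilon> W (x p, x q)) + real_of_ereal (S \<epsilon> W (y p, y q))
        - (real_of_ereal (S \<epsilon> W (x p, y q)) + real_of_ereal (S \<epsilon> W (y p, x q))))"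
    if \<epsilon>: "0 < \<epsilon>" "\<epsilon> < 1" and I: "finite I"
  proof (cases "CARD('d) = 1")
    case False
    then have PS: "P \<epsilon> W = S \<epsilon> W"
      by (auto simp: fun_eq_iff P_eq S_eq smoothing_Rd_def)
    have fin: "\<bar>P \<epsilon> W (u, v)\<bar> \<noteq> \<infinity>" for u v
      using convolve_eq_integral[OF k_meas Wt int[OF \<epsilon>]] by (simp add: S_conv PS)
    show ?thesis using H_stable_points[OF stable \<epsilon>(1) I P_meas fin] unfolding PS .
  next
    case True
    \<comment> \<open>The four-term sum is flattened to one signed sum: two Booleans say whether
      each argument comes from \<open>x\<close> or \<open>y\<close>, and the sign is + 1 when they
      agree.\<close>
    define A where "A b = (if b then x else y)" for b
    define J where "J = I \<times> I \<times> (UNIV :: bool set) \<times> (UNIV :: bool set)"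
    define Z where "Z = (\<lambda>(p, q, a, b). (r (A a p), r (A b q)))"
    define c where "c = (\<lambda>(p :: 'i, q :: 'i, a :: bool, b). if a = b then 1 else - 1 :: real)"
    have sum_J: "(\<Sum>j\<in>J. c j * f (Z j)) = (\<Sum>p\<in>I. \<Sum>q\<in>I. f (r (x p), r (x q)) + f (r (y p), r (y q))
        - (f (r (x p), r (y q)) + f (r (y p), r (x q))))" for f :: "(real ^ 'd) \<times> (real ^ 'd) \<Rightarrow> real"
      unfolding J_def by (simp add: sum.cartesian_product' UNIV_bool c_def Z_def A_def algebra_simps)
    have "0 \<le> (\<Sum>j\<in>J. c j * real_of_ereal (convolve (half_heat_kernel \<epsilon>) Wt (Z j)))"
    proof (rule half_heat_positivity[OF Wt \<epsilon>(1)])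
      show "finite J" using I by (simp add: J_def)
      show "eabs_integrable lborel (\<lambda>w. ereal (half_heat_kernel \<epsilon> (Z j - w)) * Wt w)" for j
        using int[OF \<epsilon>, of "Z j"] True by (simp add: k_def)
      fix s :: real
      assume s: "0 < s" and h: "\<And>j. j \<in> J \<Longrightarrow> eabs_integrable lborel (\<lambda>w. ereal (heat_kernel s (Z j - w)) * Wt w)"
      have P_conv: "P s W (p, q) = convolve (heat_kernel s) Wt (r p, r q)" for p q by (simp add: P_eq heat_Rd_def)
      have "\<bar>P s W (u, v)\<bar> \<noteq> \<infinity>" if uv: "u \<in> x ` I \<union> y ` I" "v \<in> x ` I \<union> y ` I" for u v
      proof -
        have point: "\<exists>p a. p \<in> I \<and> t = A a p" if "t \<in> x ` I \<union> y ` I" for t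
          using that
        proof (elim UnE imageE)
          show ?thesis if "t = x p" "p \<in> I" for p using that by (intro exI[of _ p] exI[of _ True]) (simp add: A_def)
          show ?thesis if "t = y p" "p \<in> I" for p using that by (intro exI[of _ p] exI[of _ False]) (simp add: A_def)
        qed
        obtain p a where u: "p \<in> I" "u = A a p" using point[OF uv(1)] by blast
        obtain q b where v: "q \<in> I" "v = A b q" using point[OF uv(2)] by blast
        have "(p, q, a, b) \<in> J" using u v by (simp add: J_def)
        from convolve_eq_integral[OF measurable_heat_kernel Wt h[OF this]] show ?thesis
          by (simp add: P_conv u v Z_def)
      qed
      from H_stable_points[OF stable s I P_meas this]
      show "0 \<le> (\<Sum>j\<in>J. c j * real_of_ereal (convolve (heat_kernel s) Wt (Z j)))"
        unfolding sum_J[of "\<lambda>z. real_of_ereal (convolve (heat_kernel s) Wt z)"] P_conv .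
    qed
    then show ?thesis
      unfolding sum_J[of "\<lambda>z. real_of_ereal (convolve (half_heat_kernel \<epsilon>) Wt z)"] S_conv k_def
      using True by simp
  qed
qed

section \<open>Measurable representatives and periodic lifts on the torus\<close>

text \<open>\<^const>\<open>rep_torus\<close> is an arbitrary choice of representatives and need not be measurable.\<close>

definition torus_section :: "('d::finite) torus \<Rightarrow> real ^ 'd" where
  "torus_section p = (\<chi> i. frac (rep_torus p $ i))"

lemma proj_torus_section [simp]: "proj_torus (torus_section p) = p"
proof -
  have "lattice_rel (torus_section p) (rep_torus p)"
    by (simp add: lattice_rel_def torus_section_def frac_def)
  then show ?thesis by (metis proj_torus_eq_iff proj_rep_torus)
qed

lemma torus_section_nth_proj:
  assumes "0 \<le> x $ i" "x $ i < 1"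
  shows "torus_section (proj_torus x) $ i = x $ i"
proof -
  have "lattice_rel (rep_torus (proj_torus x)) x"
    by (simp only: proj_torus_eq_iff[symmetric] proj_rep_torus)
  then show ?thesis
    using assms by (simp add: frac_unique_iff lattice_rel_def torus_section_def)
qed

lemma torus_section_proj:
  assumes "\<And>i. 0 \<le> x $ i \<and> x $ i < 1"
  shows "torus_section (proj_torus x) = x"
  using assms by (simp add: vec_eq_iff torus_section_nth_proj)

lemma torus_section_bounds: "0 \<le> torus_section p $ i" "torus_section p $ i < 1"
  by (simp_all add: torus_section_def frac_lt_1)

text \<open>For a >= 0 the superlevel set of a coordinate is the projection of the open slab a < x_i
  < 1, and the projection is an open map; the other coordinates need no restriction. For a < 0 the
  set is everything.\<close>

lemma measurable_torus_section: "(torus_section :: ('d::finite) torus \<Rightarrow> real ^ 'd) \<in> borel_measurable borel"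
proof -
  have "(\<lambda>p. torus_section p $ i) \<in> borel_measurable borel" for i :: 'd
  proof (rule borel_measurableI_greater)
    fix a :: real
    show "{p \<in> space borel. a < torus_section p $ i} \<in> sets borel"
    proof (cases "a < 0")
      case True
      then have "a < torus_section p $ i" for p :: "'d torus"
        using torus_section_bounds(1)[of p i] by linarith
      then show ?thesis by simp
    next
      case False
      define O' where "O' = {x :: real ^ 'd. a < x $ i \<and> x $ i < 1}"
      have "open O'"
        unfolding O'_def by (intro open_Collect_conj open_Collect_less continuous_intros)
      then have "open (proj_torus ` O')" by (rule open_proj_torus_image)
      moreover have "{p. a < torus_section p $ i} = proj_torus ` O'"
      proof (intro equalityI subsetI)
        fix p :: "'d torus" assume "p \<in> {p. a < torus_section p $ i}"
        then have "torus_section p \<in> O'" by (simp add: O'_def torus_section_bounds)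
        then show "p \<in> proj_torus ` O'" by (rule image_eqI[rotated]) simp
      next
        fix p assume "p \<in> proj_torus ` O'"
        then obtain x where "x \<in> O'" "p = proj_torus x" by blast
        then show "p \<in> {p. a < torus_section p $ i}"
          using False by (simp add: O'_def torus_section_nth_proj)
      qed
      ultimately show ?thesis by simp
    qed
  qed
  then show ?thesis
    by (subst borel_measurable_euclidean_space) (auto simp: Basis_vec_def inner_axis)
qed

lemma measurable_lift_torus:
  fixes V :: "('d::finite) torus \<times> 'd torus \<Rightarrow> ereal"
  assumes "V \<in> borel_measurable borel"
  shows "lift_torus V \<in> borel_measurable borel"
proof -
  have "continuous_on UNIV (map_prod proj_torus proj_torus :: (real ^ 'd) \<times> (real ^ 'd) \<Rightarrow> 'd torus \<times> 'd torus)"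
    unfolding map_prod_def case_prod_beta'
    by (intro continuous_on_Pair continuous_on_compose2[OF continuous_proj_torus]
        continuous_on_fst continuous_on_snd continuous_on_id) auto
  then have "map_prod proj_torus proj_torus \<in> borel \<rightarrow>\<^sub>M (borel :: ('d torus \<times> 'd torus) measure)"
    by (rule borel_measurable_continuous_onI)
  then show ?thesis unfolding lift_torus_def using assms by (rule measurable_comp)
qed

text \<open>The two choices of representatives differ by a lattice vector in each factor; this is a
  period of the lift, and convolution preserves periods.\<close>

lemma convolve_lift_torus:
  assumes k: "k \<in> borel_measurable borel" and V: "V \<in> borel_measurable borel"
  shows "convolve k (lift_torus V) (rep_torus p, rep_torus q)
    = convolve k (lift_torus V) (torus_section p, torus_section q)"
proof -
  define l where "l = (rep_torus p - torus_section p, rep_torus q - torus_section q)"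
  have proj: "proj_torus ((rep_torus u - torus_section u) + v) = proj_torus v" for u :: "'a torus" and v
    by (simp add: proj_torus_eq_iff lattice_rel_def torus_section_def frac_def)
  have "lift_torus V (l + w) = lift_torus V w" for w
    by (cases w) (simp add: lift_torus_def l_def proj)
  from convolve_translate[OF k measurable_lift_torus[OF V] this, of "(torus_section p, torus_section q)"]
  show ?thesis by (simp add: l_def)
qed

section \<open>Lebesgue measure on the torus and the final instances\<close>

lemma sets_torus_lebesgue: "sets torus_lebesgue = sets borel"
  by (simp add: torus_lebesgue_def)

lemma unit_cube_measurable: "{x :: real ^ 'd. \<forall>i. 0 \<le> x $ i \<and> x $ i < 1} \<in> sets borel"
proof -
  have "{x :: real ^ 'd. \<forall>i. 0 \<le> x $ i \<and> x $ i < 1} = (\<Inter>i. {x. 0 \<le> x $ i} \<inter> {x. x $ i < 1})" by auto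
  also have "\<dots> \<in> sets borel"
    by (intro sets.finite_INT sets.Int borel_closed borel_open closed_Collect_le open_Collect_less continuous_intros) auto
  finally show ?thesis .
qed

lemma measurable_proj_torus_cube:
  "proj_torus \<in> restrict_space lborel {x :: real ^ 'd. \<forall>i. 0 \<le> x $ i \<and> x $ i < 1} \<rightarrow>\<^sub>M borel"
  using borel_measurable_continuous_onI[OF continuous_proj_torus] by (intro measurable_restrict_space1) simp

lemma finite_measure_torus_lebesgue: "finite_measure (torus_lebesgue :: ('d::finite) torus measure)"
proof -
  define Q where "Q = {x :: real ^ 'd. \<forall>i. 0 \<le> x $ i \<and> x $ i < 1}"
  have "bounded Q"
  proof (rule bounded_subset)
    show "Q \<subseteq> cbox 0 1" by (auto simp: Q_def mem_box_cart less_imp_le)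
  qed simp
  then have "emeasure lborel Q < \<infinity>" by (rule emeasure_bounded_finite)
  then have "finite_measure (restrict_space lborel Q)"
    using unit_cube_measurable by (intro finite_measureI) (simp add: space_restrict_space emeasure_restrict_space Q_def)
  then show ?thesis
    unfolding torus_lebesgue_def using measurable_proj_torus_cube
    by (intro finite_measure.finite_measure_distr) (simp_all add: Q_def)
qed

text \<open>The half-open unit cube contains no representative of \<open>p\<close> other than
  \<open>torus_section p\<close>.\<close>

lemma emeasure_torus_lebesgue_singleton: "emeasure torus_lebesgue {p :: ('d::finite) torus} = 0"
proof -
  define Q where "Q = {x :: real ^ 'd. \<forall>i. 0 \<le> x $ i \<and> x $ i < 1}"
  have "emeasure torus_lebesgue {p} = emeasure (restrict_space lborel Q) (proj_torus -` {p} \<inter> space (restrict_space lborel Q))"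
    unfolding torus_lebesgue_def Q_def by (rule emeasure_distr[OF measurable_proj_torus_cube]) simp
  also have "\<dots> = emeasure lborel (proj_torus -` {p} \<inter> Q)"
    using unit_cube_measurable by (subst emeasure_restrict_space) (auto simp: Q_def space_restrict_space)
  also have "\<dots> \<le> emeasure lborel {torus_section p}"
    by (rule emeasure_mono) (auto simp: Q_def torus_section_proj[symmetric])
  finally show ?thesis by simp
qed

theorem theorem1p1:
  fixes W :: "(real ^ 'd) \<times> (real ^ 'd) \<Rightarrow> ereal"
    and V :: "('d::finite) torus \<times> 'd torus \<Rightarrow> ereal"
  shows "(structural_assumptions lborel heat_Rd smoothing_Rd W \<longrightarrow>
      (\<exists>C :: real \<Rightarrow> ennreal \<Rightarrow> real. \<forall>\<beta>>0. \<forall>\<rho>.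
         borel_probability \<rho> \<and> bounded_density lborel \<rho> \<and> potential_integrable W \<rho> \<longrightarrow>
         (\<forall>N\<ge>1. \<forall>\<rho>N. borel_probability_pow N \<rho>N \<longrightarrow>
            - (ereal (\<beta> / real N) * eintegral \<rho>N (\<lambda>x. offdiag_energy W (fluctuation N \<rho> x)))
              \<le> ereal (1 / 2) * avg_relative_entropy N \<rho>N (tensor_pow N \<rho>)
                + ereal (C \<beta> (density_norm lborel \<rho>) / real N))))
    \<and> (structural_assumptions torus_lebesgue heat_Td smoothing_Td V \<longrightarrow>
      (\<exists>C :: real \<Rightarrow> ennreal \<Rightarrow> real. \<forall>\<beta>>0. \<forall>\<rho>.
         borel_probability \<rho> \<and> bounded_density torus_lebesgue \<rho> \<and> potential_integrable V \<rho> \<longrightarrow>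
         (\<forall>N\<ge>1. \<forall>\<rho>N. borel_probability_pow N \<rho>N \<longrightarrow>
            - (ereal (\<beta> / real N) * eintegral \<rho>N (\<lambda>x. offdiag_energy V (fluctuation N \<rho> x)))
              \<le> ereal (1 / 2) * avg_relative_entropy N \<rho>N (tensor_pow N \<rho>)
                + ereal (C \<beta> (density_norm torus_lebesgue \<rho>) / real N))))"
proof (intro conjI impI)
  assume "structural_assumptions lborel heat_Rd smoothing_Rd W"
  then have W: "\<And>x y. W (x, y) = W (y, x)" "lower_semicontinuous W" "H_stable heat_Rd W"
      "log_diagonal smoothing_Rd W" "Lp_approximation lborel smoothing_Rd W" "almost_superharmonic smoothing_Rd W"
    unfolding structural_assumptions_def by blast+
  note meas = borel_measurable_lower_semicontinuous[OF W(2)]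
  \<comment> \<open>On the whole space the representative map is the identity and the lift is
    \<open>W\<close> itself, so both transfer equations are reflexivity.\<close>
  note S = measurable_ident_sets[OF refl] meas W(1) refl refl W(3,4)
  show "\<exists>C :: real \<Rightarrow> ennreal \<Rightarrow> real. \<forall>\<beta>>0. \<forall>\<rho>.
         borel_probability \<rho> \<and> bounded_density lborel \<rho> \<and> potential_integrable W \<rho> \<longrightarrow>
         (\<forall>N\<ge>1. \<forall>\<rho>N. borel_probability_pow N \<rho>N \<longrightarrow>
            - (ereal (\<beta> / real N) * eintegral \<rho>N (\<lambda>x. offdiag_energy W (fluctuation N \<rho> x)))
              \<le> ereal (1 / 2) * avg_relative_entropy N \<rho>N (tensor_pow N \<rho>)
                + ereal (C \<beta> (density_norm lborel \<rho>) / real N))"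
    by (rule fluctuation_bound_of_semigroup[OF lborel.sigma_finite_measure_axioms sets_lborel _ W(1,2)
          smoothing_measurable[OF S] smoothing_finite[OF S] smoothing_symmetric[OF S] smoothing_positive[OF S] W(4-6)])
       auto
next
  assume "structural_assumptions torus_lebesgue heat_Td smoothing_Td V"
  then have V: "\<And>x y. V (x, y) = V (y, x)" "lower_semicontinuous V" "H_stable heat_Td V"
      "log_diagonal smoothing_Td V" "Lp_approximation torus_lebesgue smoothing_Td V" "almost_superharmonic smoothing_Td V"
    unfolding structural_assumptions_def by blast+
  note meas = borel_measurable_lower_semicontinuous[OF V(2)]
  have lift_sym: "lift_torus V (a, b) = lift_torus V (b, a)" for a b
    using V(1) by (simp add: lift_torus_def)
  have heat: "heat_Td \<epsilon> V (p, q) = heat_Rd \<epsilon> (lift_torus V) (torus_section p, torus_section q)" for \<epsilon> p q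
    by (simp add: heat_Td_def heat_Rd_def convolve_lift_torus[OF _ meas])
  have smoothing: "smoothing_Td \<epsilon> V (p, q) = smoothing_Rd \<epsilon> (lift_torus V) (torus_section p, torus_section q)" for \<epsilon> p q
    by (simp add: smoothing_Td_def smoothing_Rd_def heat half_heat_Td_def half_heat_Rd_def
        convolve_lift_torus[OF _ meas])
  note S = measurable_torus_section measurable_lift_torus[OF meas] lift_sym heat smoothing V(3,4)
  show "\<exists>C :: real \<Rightarrow> ennreal \<Rightarrow> real. \<forall>\<beta>>0. \<forall>\<rho>.
         borel_probability \<rho> \<and> bounded_density torus_lebesgue \<rho> \<and> potential_integrable V \<rho> \<longrightarrow>
         (\<forall>N\<ge>1. \<forall>\<rho>N. borel_probability_pow N \<rho>N \<longrightarrow>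
            - (ereal (\<beta> / real N) * eintegral \<rho>N (\<lambda>x. offdiag_energy V (fluctuation N \<rho> x)))
              \<le> ereal (1 / 2) * avg_relative_entropy N \<rho>N (tensor_pow N \<rho>)
                + ereal (C \<beta> (density_norm torus_lebesgue \<rho>) / real N))"
    by (rule fluctuation_bound_of_semigroup[OF finite_measure.sigma_finite_measure[OF finite_measure_torus_lebesgue]
          sets_torus_lebesgue emeasure_torus_lebesgue_singleton V(1,2)
          smoothing_measurable[OF S] smoothing_finite[OF S] smoothing_symmetric[OF S] smoothing_positive[OF S] V(4-6)])
qed

end
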